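(* Let $\Sigma$ be a Lagrangian cyclic surface of $\mathbb{C}^2$ which is a soliton of the mean curvature flow, i.e. a solution of the self-similar equation $$H+\lambda X^{\perp}=0$$ for some non-vanishing real number $\lambda$. Then $\Sigma$ is locally congruent either to an equivariant self-similar example, that is, a self-similar centered surface of type I, or to the Cartesian product $\mathbb{S}^1(r)\times\Gamma\subset\mathbb{C}\times\mathbb{C}$ of some circle $\mathbb{S}^1(r)$ with a planar self-shrinking curve $\Gamma$.
   Context: $\mathbb{C}^2\simeq\mathbb{R}^4$ carries its standard Euclidean inner product $\langle\cdot,\cdot\rangle$ and complex structure $J$ (multiplication by $i$). A surface is Lagrangian if $\langle v,Jw\rangle=0$ for all tangent vectors $v,w$ at the same point, and cyclic if it is foliated by round circles. $H$ denotes the mean curvature vector of the surface and $X^{\perp}$ the normal component of its position vector $X$ (changing the normalization of $H$ by a positive constant only rescales $\lambda$). A centered surface of type I is one locally parametrized by $X(s,t)=r(s)e^{i\phi(s)}(\cos t,\sin t)$, $(s,t)\in I\times\mathbb{R}/2\pi\mathbb{Z}$, with $r>0$ and $\phi$ real-valued functions. The equivariant self-similar examples are the centered type I surfaces whose generating planar curve $\gamma=re^{i\phi}$ satisfies, when $H$ is the trace of the second fundamental form, $k=\langle\gamma,N\rangle\left(\frac{1}{|\gamma|^2}-\lambda\right)$, where $k$ is the curvature and $N$ the unit normal vector of $\gamma$. $\mathbb{S}^1(r)\subset\mathbb{C}$ is the circle of radius $r$ centered at the origin. A planar curve $\Gamma\subset\mathbb{C}$ is self-shrinking if it satisfies $k+\mu\langle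 X,N\rangle=0$ for some $\mu>0$, where $X$ is its position vector, $k$ its curvature and $N$ its unit normal vector. *)

theory Defs
  imports "HOL-Analysis.Analysis"
begin

type_synonym C2 = "complex \<times> complex"

definition J :: "C2 \<Rightarrow> C2" where
  "J z = (\<i> * fst z, \<i> * snd z)"

(* Ambient congruences of complex Euclidean space: a unitary map followed by a translation. *)
definition congruence :: "(C2 \<Rightarrow> C2) \<Rightarrow> bool" where
  "congruence g \<longleftrightarrow>
     (\<exists>A b. orthogonal_transformation A \<and> (\<forall>z. A (J z) = J (A z)) \<and> g = (\<lambda>z. A z + b))"

(* Class C^n on S, by iterated directional derivatives; only used for open S. *)
primrec Cn_on :: "nat \<Rightarrow> 'a set \<Rightarrow> ('a::real_normed_vector \<Rightarrow> 'b::real_normed_vector) \<Rightarrow> bool" where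
  "Cn_on 0 S f \<longleftrightarrow> continuous_on S f"
| "Cn_on (Suc n) S f \<longleftrightarrow>
     (\<forall>x\<in>S. f differentiable (at x)) \<and> (\<forall>v. Cn_on n S (\<lambda>x. frechet_derivative f (at x) v))"

definition smooth_on :: "'a set \<Rightarrow> ('a::real_normed_vector \<Rightarrow> 'b::real_normed_vector) \<Rightarrow> bool" where
  "smooth_on S f \<longleftrightarrow> (\<forall>n. Cn_on n S f)"


(* An immersed surface is a space M together with a map F into C2 (the position vector X);
   an embedded surface is the case M \<subseteq> C2, F = id.  Since F is to be an immersion, it determines
   the smooth structure of M, so that charts of M need only be homeomorphisms for which F,
   read in the chart, is a smooth immersion: such charts are automatically smoothly compatible. *)
definition local_param ::
  "'m::topological_space set \<Rightarrow> ('m \<Rightarrow> C2) \<Rightarrow> (real \<times> real) set \<Rightarrow> (real \<times> real \<Rightarrow> 'm) \<Rightarrow> bool" where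
  "local_param M F V \<psi> \<longleftrightarrow>
     open V \<and> openin (top_of_set M) (\<psi> ` V) \<and> (\<exists>\<psi>'. homeomorphism V (\<psi> ` V) \<psi> \<psi>') \<and>
     smooth_on V (F \<circ> \<psi>) \<and> (\<forall>x\<in>V. inj (frechet_derivative (F \<circ> \<psi>) (at x)))"

definition immersed_surface ::
  "'m::{t2_space,second_countable_topology} set \<Rightarrow> ('m \<Rightarrow> C2) \<Rightarrow> bool" where
  "immersed_surface M F \<longleftrightarrow> (\<forall>p\<in>M. \<exists>V \<psi>. local_param M F V \<psi> \<and> p \<in> \<psi> ` V)"


definition tangent_plane :: "(real \<times> real \<Rightarrow> C2) \<Rightarrow> real \<times> real \<Rightarrow> C2 set" where
  "tangent_plane Y x = range (frechet_derivative Y (at x))"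

definition normal_component :: "C2 set \<Rightarrow> C2 \<Rightarrow> C2" where
  "normal_component T w = (THE n. w - n \<in> T \<and> (\<forall>v\<in>T. n \<bullet> v = 0))"

definition second_fundamental_form ::
  "(real \<times> real \<Rightarrow> C2) \<Rightarrow> real \<times> real \<Rightarrow> real \<times> real \<Rightarrow> real \<times> real \<Rightarrow> C2" where
  "second_fundamental_form Y x v w =
     normal_component (tangent_plane Y x)
       (frechet_derivative (\<lambda>y. frechet_derivative Y (at y) v) (at x) w)"

(* Trace of the second fundamental form with respect to the induced metric (E, F, G):
   (G II11 - 2 F II12 + E II22) / (E G - F^2). *)
definition mean_curvature_vector :: "(real \<times> real \<Rightarrow> C2) \<Rightarrow> real \<times> real \<Rightarrow> C2" where
  "mean_curvature_vector Y x =
     (let Y1 = frechet_derivative Y (at x) (1, 0);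
          Y2 = frechet_derivative Y (at x) (0, 1);
          gE = Y1 \<bullet> Y1; gF = Y1 \<bullet> Y2; gG = Y2 \<bullet> Y2
      in (1 / (gE * gG - gF\<^sup>2)) *\<^sub>R
           (gG *\<^sub>R second_fundamental_form Y x (1, 0) (1, 0)
            - (2 * gF) *\<^sub>R second_fundamental_form Y x (1, 0) (0, 1)
            + gE *\<^sub>R second_fundamental_form Y x (0, 1) (0, 1)))"

definition lagrangian ::
  "'m::{t2_space,second_countable_topology} set \<Rightarrow> ('m \<Rightarrow> C2) \<Rightarrow> bool" where
  "lagrangian M F \<longleftrightarrow>
     (\<forall>V \<psi>. local_param M F V \<psi> \<longrightarrow>
        (\<forall>x\<in>V. \<forall>v\<in>tangent_plane (F \<circ> \<psi>) x. \<forall>w\<in>tangent_plane (F \<circ> \<psi>) x. v \<bullet> J w = 0))"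

definition self_similar ::
  "real \<Rightarrow> 'm::{t2_space,second_countable_topology} set \<Rightarrow> ('m \<Rightarrow> C2) \<Rightarrow> bool" where
  "self_similar lam M F \<longleftrightarrow>
     (\<forall>V \<psi>. local_param M F V \<psi> \<longrightarrow>
        (\<forall>x\<in>V. mean_curvature_vector (F \<circ> \<psi>) x
               + lam *\<^sub>R normal_component (tangent_plane (F \<circ> \<psi>) x) (F (\<psi> x)) = 0))"

definition round_circle :: "C2 set \<Rightarrow> bool" where
  "round_circle C \<longleftrightarrow>
     (\<exists>c e1 e2 r. r > 0 \<and> norm e1 = 1 \<and> norm e2 = 1 \<and> e1 \<bullet> e2 = 0 \<and>
        C = {c + (r * cos t) *\<^sub>R e1 + (r * sin t) *\<^sub>R e2 | t :: real. True})"

(* A smooth foliation of M: a partition into leaves such that every point lies in the domain of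
   an adapted chart, i.e. a chart on a rectangle each of whose vertical lines lies in one leaf.
   The leaves are required to be (mapped by the immersion onto) entire round circles. *)
definition cyclic ::
  "'m::{t2_space,second_countable_topology} set \<Rightarrow> ('m \<Rightarrow> C2) \<Rightarrow> bool" where
  "cyclic M F \<longleftrightarrow>
     (\<exists>\<L>. partition_on M \<L> \<and>
        (\<forall>L\<in>\<L>. \<exists>C. round_circle C \<and> bij_betw F L C) \<and>
        (\<forall>p\<in>M. \<exists>a b c d \<psi>.
           local_param M F ({a<..<b} \<times> {c<..<d}) \<psi> \<and> p \<in> \<psi> ` ({a<..<b} \<times> {c<..<d}) \<and>
           (\<forall>s\<in>{a<..<b}. \<exists>L\<in>\<L>. \<psi> ` ({s} \<times> {c<..<d}) \<subseteq> L)))"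


definition regular_curve :: "real set \<Rightarrow> (real \<Rightarrow> complex) \<Rightarrow> bool" where
  "regular_curve I \<gamma> \<longleftrightarrow>
     open I \<and> is_interval I \<and> smooth_on I \<gamma> \<and> (\<forall>s\<in>I. vector_derivative \<gamma> (at s) \<noteq> 0)"

definition unit_normal :: "(real \<Rightarrow> complex) \<Rightarrow> real \<Rightarrow> complex" where
  "unit_normal \<gamma> s = \<i> * sgn (vector_derivative \<gamma> (at s))"

definition curvature :: "(real \<Rightarrow> complex) \<Rightarrow> real \<Rightarrow> real" where
  "curvature \<gamma> s =
     (vector_derivative (\<lambda>u. vector_derivative \<gamma> (at u)) (at s) \<bullet> unit_normal \<gamma> s)
     / (norm (vector_derivative \<gamma> (at s)))\<^sup>2"

definition self_shrinking_curve :: "real set \<Rightarrow> (real \<Rightarrow> complex) \<Rightarrow> bool" where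
  "self_shrinking_curve I \<Gamma> \<longleftrightarrow>
     regular_curve I \<Gamma> \<and>
     (\<exists>\<mu>>0. \<forall>s\<in>I. curvature \<Gamma> s + \<mu> * (\<Gamma> s \<bullet> unit_normal \<Gamma> s) = 0)"

definition polar_curve :: "(real \<Rightarrow> real) \<Rightarrow> (real \<Rightarrow> real) \<Rightarrow> real \<Rightarrow> complex" where
  "polar_curve r \<phi> s = complex_of_real (r s) * exp (\<i> * complex_of_real (\<phi> s))"

definition centered_type_I :: "(real \<Rightarrow> real) \<Rightarrow> (real \<Rightarrow> real) \<Rightarrow> real \<times> real \<Rightarrow> C2" where
  "centered_type_I r \<phi> =
     (\<lambda>(s, t). (polar_curve r \<phi> s * complex_of_real (cos t), polar_curve r \<phi> s * complex_of_real (sin t)))"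

(* The equation on the generating curve is the one that corresponds to H + lam X^\<bottom> = 0
   when H is the trace of the second fundamental form. *)
definition equivariant_self_similar ::
  "real \<Rightarrow> real set \<Rightarrow> (real \<Rightarrow> real) \<Rightarrow> (real \<Rightarrow> real) \<Rightarrow> bool" where
  "equivariant_self_similar lam I r \<phi> \<longleftrightarrow>
     smooth_on I r \<and> smooth_on I \<phi> \<and> (\<forall>s\<in>I. r s > 0) \<and> regular_curve I (polar_curve r \<phi>) \<and>
     (\<forall>s\<in>I. let \<gamma> = polar_curve r \<phi> in
        curvature \<gamma> s = (\<gamma> s \<bullet> unit_normal \<gamma> s) * (1 / (norm (\<gamma> s))\<^sup>2 - lam))"

definition circle_times_curve :: "real \<Rightarrow> (real \<Rightarrow> complex) \<Rightarrow> real \<times> real \<Rightarrow> C2" where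
  "circle_times_curve r \<Gamma> = (\<lambda>(s, t). (complex_of_real r * exp (\<i> * complex_of_real t), \<Gamma> s))"

(* Some neighbourhood of p in the surface is carried by a congruence onto an open piece
   of the surface parametrized by X on D. *)
definition locally_congruent_at ::
  "'m::{t2_space,second_countable_topology} set \<Rightarrow> ('m \<Rightarrow> C2) \<Rightarrow> 'm \<Rightarrow>
   (real \<times> real) set \<Rightarrow> (real \<times> real \<Rightarrow> C2) \<Rightarrow> bool" where
  "locally_congruent_at M F p D X \<longleftrightarrow>
     (\<exists>V \<psi> g. local_param M F V \<psi> \<and> p \<in> \<psi> ` V \<and> V \<subseteq> D \<and> congruence g \<and>
        (\<forall>x\<in>V. g (F (\<psi> x)) = X x))"

end

theory Submission
  imports Defs
begin

text \<open>
  Near every point the surface is a family of arcs of circles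
  \<open>X(s, \<theta>) = c + r (cos \<theta> e1 + sin \<theta> e2)\<close>, where the centre \<open>c\<close>, the radius \<open>r\<close> and the orthonormal pair
  \<open>e1, e2\<close> depend smoothly on \<open>s\<close> and the frame may be chosen parallel, \<open>\<langle>e1', e2\<rangle> = 0\<close>
  (\<open>circle_family_chart_ex\<close>). For fixed \<open>s\<close> the Lagrangian condition and the self-similarity equation tested with
  \<open>J X_\<theta>\<close> are trigonometric polynomials in \<open>\<theta>\<close> that vanish on an arc, hence vanish identically
  (\<open>trig_poly_eq_0\<close>), and their Fourier coefficients are algebraic relations between \<open>c, c', e1, e2, e1', e2', r, r'\<close>.

  Let \<open>P\<close> be the plane of the circle and \<open>w = \<langle>e1, J e2\<rangle>\<close> the cosine of its Kaehler angle. If \<open>\<bar>w\<bar> < 1\<close>, the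
  highest Fourier coefficients give \<open>c \<bottom> JP\<close> (\<open>centre_normal\<close>). Differentiating this shows that \<open>c = 0\<close> or the
  plane stands still, and either alternative forces \<open>w = 0\<close>. So \<open>w\<close> takes values in \<open>{-1, 0, 1}\<close> and is
  constant by continuity (\<open>w_constant\<close>).

  If \<open>w = 0\<close>, the plane rotates by \<open>e_j' = \<alpha> J e_j\<close>, and at each \<open>s\<close> one of \<open>\<alpha>\<close> and \<open>c\<close> vanishes. The equation
  tested with \<open>J X_s\<close> has the form \<open>\<alpha>' = q \<alpha>\<close> where \<open>r' \<noteq> 0\<close>, and uniqueness for linear differential equations shows that near
  a given point one of them vanishes identically (\<open>planar_near_or_centred_near\<close>): with \<open>c = 0\<close> the surface is of type I, generated by the curve
  \<open>r exp(i \<phi>)\<close> with \<open>\<phi>' = \<alpha>\<close>; with \<open>\<alpha> = 0\<close> it is a piece of a Lagrangian plane, which after a translation is of type I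
  over a segment of a line.

  If \<open>w = \<plusminus>1\<close>, the circles lie in complex lines and have constant radius, and \<open>c\<close> is orthogonal to the line
  (\<open>complex_line\<close>). A line that stays fixed requires \<open>\<lambda> r\<^sup>2 = 1\<close> and gives a product of a circle and a curve in the
  orthogonal line, for which the equation says that the curve is self-shrinking. A line that moves requires
  \<open>c = 0\<close> and \<open>\<lambda> r\<^sup>2 = 2\<close>; then \<open>e1\<close> traverses a horizontal great circle and the surface is a piece of a Clifford torus, the
  type I surface generated by a circle.
\<close>

section \<open>Smooth maps between normed spaces\<close>

lemma Cn_on_cong:
  assumes "open S" "\<And>x. x \<in> S \<Longrightarrow> f x = g x" "Cn_on n S f"
  shows "Cn_on n S g"
  using assms(2,3)
proof (induction n arbitrary: f g)
  case 0
  then show ?case using continuous_on_cong[of S S f g] by auto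
next
  case (Suc n)
  have d: "(g has_derivative frechet_derivative f (at x)) (at x)" if "x \<in> S" for x
    using Suc.prems that assms(1)
    by (metis Cn_on.simps(2) frechet_derivative_works has_derivative_transform_within_open)
  then have "frechet_derivative f (at x) = frechet_derivative g (at x)" if "x \<in> S" for x
    using that by (simp add: frechet_derivative_at)
  moreover have "g differentiable at x" if "x \<in> S" for x
    using d[OF that] by (auto simp: differentiable_def)
  ultimately show ?case
    using Suc.prems Suc.IH[of "\<lambda>x. frechet_derivative f (at x) v" "\<lambda>x. frechet_derivative g (at x) v" for v]
    by auto
qed

lemma Cn_on_subset: "Cn_on n S f \<Longrightarrow> T \<subseteq> S \<Longrightarrow> Cn_on n T f"
  by (induction n arbitrary: f) (auto intro: continuous_on_subset)

lemma Cn_on_SucD: "Cn_on (Suc n) S f \<Longrightarrow> Cn_on n S f"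
proof (induction n arbitrary: f)
  case 0
  then show ?case
    by (auto intro!: continuous_at_imp_continuous_on differentiable_imp_continuous_within)
next
  case (Suc n)
  then show ?case by (metis Cn_on.simps(2))
qed

text \<open>Every closure property below is an induction on the order, in which this rule replaces the abstract
  derivative by an explicit formula.\<close>

lemma Cn_on_SucI:
  assumes "open S" "\<And>x. x \<in> S \<Longrightarrow> (f has_derivative f' x) (at x)"
    and "\<And>v. Cn_on n S (\<lambda>x. f' x v)"
  shows "Cn_on (Suc n) S f"
proof -
  have "f' x = frechet_derivative f (at x)" if "x \<in> S" for x
    using assms(2) that frechet_derivative_at by blast
  then have "Cn_on n S (\<lambda>x. frechet_derivative f (at x) v)" for v
    using Cn_on_cong[OF assms(1) _ assms(3)[of v]] by simp
  then show ?thesis using assms(2) by (auto simp: differentiable_def)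
qed

lemma Cn_on_const: "Cn_on n S (\<lambda>x. c)"
  by (induction n arbitrary: c) auto

lemma Cn_on_add:
  assumes "open S" "Cn_on n S f" "Cn_on n S g"
  shows "Cn_on n S (\<lambda>x. f x + g x)"
  using assms(2,3)
proof (induction n arbitrary: f g)
  case 0
  then show ?case by (simp add: continuous_on_add)
next
  case (Suc n)
  show ?case
  proof (rule Cn_on_SucI[OF assms(1)])
    fix x assume "x \<in> S"
    then show "((\<lambda>x. f x + g x) has_derivative
        (\<lambda>v. frechet_derivative f (at x) v + frechet_derivative g (at x) v)) (at x)"
      using Suc.prems by (auto intro!: has_derivative_add simp: frechet_derivative_works[symmetric])
  qed (use Suc in auto)
qed

lemma Cn_on_bilinear:
  assumes "open S" and B: "bounded_bilinear B" and "Cn_on n S f" "Cn_on n S g"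
  shows "Cn_on n S (\<lambda>x. B (f x) (g x))"
  using assms(3,4)
proof (induction n arbitrary: f g)
  case 0
  then show ?case using bounded_bilinear.continuous_on[OF B] by auto
next
  case (Suc n)
  show ?case
  proof (rule Cn_on_SucI[OF assms(1)])
    fix x assume "x \<in> S"
    then show "((\<lambda>x. B (f x) (g x)) has_derivative
        (\<lambda>v. B (f x) (frechet_derivative g (at x) v) + B (frechet_derivative f (at x) v) (g x))) (at x)"
      using Suc.prems by (auto intro!: bounded_bilinear.FDERIV[OF B] simp: frechet_derivative_works[symmetric])
  next
    fix v
    show "Cn_on n S (\<lambda>x. B (f x) (frechet_derivative g (at x) v) + B (frechet_derivative f (at x) v) (g x))"
      using Suc.prems by (intro Cn_on_add assms(1) Suc.IH) (auto intro: Cn_on_SucD)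
  qed
qed

text \<open>Precomposition with an affine map covers restriction to coordinate lines, dependence on
  one coordinate only, and translations.\<close>

lemma Cn_on_compose_affine:
  assumes "open S" "open T" and L: "bounded_linear L" and sub: "\<And>x. x \<in> T \<Longrightarrow> L x + b \<in> S"
    and "Cn_on n S f"
  shows "Cn_on n T (\<lambda>x. f (L x + b))"
  using assms(5)
proof (induction n arbitrary: f)
  case 0
  have "continuous_on T (\<lambda>x. L x + b)"
    using L by (intro continuous_intros) (auto intro: linear_continuous_on)
  then show ?case using 0 sub continuous_on_compose2[of S f T "\<lambda>x. L x + b"] by auto
next
  case (Suc n)
  show ?case
  proof (rule Cn_on_SucI[OF assms(2)])
    fix x assume "x \<in> T"
    have "((\<lambda>x. L x + b) has_derivative L) (at x)"
      using bounded_linear_imp_has_derivative[OF L] by (auto intro!: derivative_eq_intros)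
    moreover have "(f has_derivative frechet_derivative f (at (L x + b))) (at (L x + b))"
      using Suc.prems sub[OF \<open>x \<in> T\<close>] by (auto simp: frechet_derivative_works[symmetric])
    ultimately show "((\<lambda>x. f (L x + b)) has_derivative (\<lambda>v. frechet_derivative f (at (L x + b)) (L v))) (at x)"
      by (rule has_derivative_compose)
  qed (use Suc in auto)
qed

lemma Cn_on_bounded_linear:
  assumes "open S" "bounded_linear L"
  shows "Cn_on n S L"
proof -
  have "Cn_on n UNIV (\<lambda>x. L x)"
  proof (cases n)
    case 0
    then show ?thesis by (simp add: assms(2) linear_continuous_on)
  next
    case (Suc m)
    show ?thesis unfolding Suc
      by (rule Cn_on_SucI[where f' = "\<lambda>x. L"])
         (auto intro: Cn_on_const bounded_linear_imp_has_derivative[OF assms(2)])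
  qed
  then show ?thesis by (rule Cn_on_subset) simp
qed

lemma Cn_on_linear_compose:
  assumes "open S" and L: "bounded_linear L" and "Cn_on n S f"
  shows "Cn_on n S (\<lambda>x. L (f x))"
  using assms(3)
proof (induction n arbitrary: f)
  case 0
  then show ?case
    using bounded_linear.continuous_on[OF L] by auto
next
  case (Suc n)
  show ?case
  proof (rule Cn_on_SucI[OF assms(1)])
    fix x assume "x \<in> S"
    then show "((\<lambda>x. L (f x)) has_derivative (\<lambda>v. L (frechet_derivative f (at x) v))) (at x)"
      using Suc.prems
      by (auto intro!: bounded_linear.has_derivative[OF L] simp: frechet_derivative_works[symmetric])
  qed (use Suc in auto)
qed

text \<open>The inductive step common to \<open>inverse\<close>, \<open>sqrt\<close>, \<open>cos\<close> and \<open>sin\<close>: their derivatives are polynomials in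
  functions of the same kind, which are under control one order lower.\<close>

lemma Cn_on_real_compose:
  fixes f :: "'a::real_normed_vector \<Rightarrow> real"
  assumes "open S" "Cn_on (Suc n) S f"
    and "\<And>x. x \<in> S \<Longrightarrow> (h has_real_derivative h' (f x)) (at (f x))"
    and "Cn_on n S (\<lambda>x. h' (f x))"
  shows "Cn_on (Suc n) S (\<lambda>x. h (f x))"
proof (rule Cn_on_SucI[OF assms(1)])
  fix x assume "x \<in> S"
  then have "(f has_derivative frechet_derivative f (at x)) (at x)"
    using assms(2) by (auto simp: frechet_derivative_works[symmetric])
  then show "((\<lambda>x. h (f x)) has_derivative (\<lambda>v. frechet_derivative f (at x) v * h' (f x))) (at x)"
    using assms(3)[OF \<open>x \<in> S\<close>] by (rule DERIV_compose_FDERIV[rotated])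
next
  fix v
  show "Cn_on n S (\<lambda>x. frechet_derivative f (at x) v * h' (f x))"
    using assms(2,4) by (intro Cn_on_bilinear[OF assms(1) bounded_bilinear_mult, of n "\<lambda>x. frechet_derivative f (at x) v"]) simp_all
qed

lemma smooth_on_cong:
  "open S \<Longrightarrow> (\<And>x. x \<in> S \<Longrightarrow> f x = g x) \<Longrightarrow> smooth_on S f \<Longrightarrow> smooth_on S g"
  unfolding smooth_on_def using Cn_on_cong by blast

lemma smooth_on_subset: "smooth_on S f \<Longrightarrow> T \<subseteq> S \<Longrightarrow> smooth_on T f"
  unfolding smooth_on_def using Cn_on_subset by blast

lemma smooth_on_differentiable: "smooth_on S f \<Longrightarrow> x \<in> S \<Longrightarrow> f differentiable (at x)"
  unfolding smooth_on_def by (metis Cn_on.simps(2))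

lemma smooth_on_has_derivative:
  "smooth_on S f \<Longrightarrow> x \<in> S \<Longrightarrow> (f has_derivative frechet_derivative f (at x)) (at x)"
  using smooth_on_differentiable frechet_derivative_works by blast

lemma smooth_on_continuous: "smooth_on S f \<Longrightarrow> continuous_on S f"
  unfolding smooth_on_def by (metis Cn_on.simps(1))

lemma smooth_on_frechet_derivative:
  "smooth_on S f \<Longrightarrow> smooth_on S (\<lambda>x. frechet_derivative f (at x) v)"
  unfolding smooth_on_def by (metis Cn_on.simps(2))

lemma smooth_on_const: "smooth_on S (\<lambda>x. c)"
  unfolding smooth_on_def by (simp add: Cn_on_const)

lemma smooth_on_add: "open S \<Longrightarrow> smooth_on S f \<Longrightarrow> smooth_on S g \<Longrightarrow> smooth_on S (\<lambda>x. f x + g x)"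
  unfolding smooth_on_def by (simp add: Cn_on_add)

lemma smooth_on_bilinear:
  "open S \<Longrightarrow> bounded_bilinear B \<Longrightarrow> smooth_on S f \<Longrightarrow> smooth_on S g \<Longrightarrow> smooth_on S (\<lambda>x. B (f x) (g x))"
  unfolding smooth_on_def by (simp add: Cn_on_bilinear)

lemmas smooth_on_mult = smooth_on_bilinear[OF _ bounded_bilinear_mult]
  and smooth_on_scaleR = smooth_on_bilinear[OF _ bounded_bilinear_scaleR]
  and smooth_on_inner = smooth_on_bilinear[OF _ bounded_bilinear_inner]

lemma smooth_on_linear_compose:
  "open S \<Longrightarrow> bounded_linear L \<Longrightarrow> smooth_on S f \<Longrightarrow> smooth_on S (\<lambda>x. L (f x))"
  unfolding smooth_on_def by (simp add: Cn_on_linear_compose)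

lemma smooth_on_minus: "open S \<Longrightarrow> smooth_on S f \<Longrightarrow> smooth_on S (\<lambda>x. - f x)"
  by (rule smooth_on_linear_compose) (auto intro: bounded_linear_minus bounded_linear_ident)

lemma smooth_on_diff: "open S \<Longrightarrow> smooth_on S f \<Longrightarrow> smooth_on S g \<Longrightarrow> smooth_on S (\<lambda>x. f x - g x)"
  using smooth_on_add[of S f "\<lambda>x. - g x"] smooth_on_minus[of S g] by simp

lemma smooth_on_bounded_linear: "open S \<Longrightarrow> bounded_linear L \<Longrightarrow> smooth_on S L"
  unfolding smooth_on_def by (simp add: Cn_on_bounded_linear)

lemma smooth_on_compose_affine:
  "open S \<Longrightarrow> open T \<Longrightarrow> bounded_linear L \<Longrightarrow> (\<And>x. x \<in> T \<Longrightarrow> L x + b \<in> S) \<Longrightarrow> smooth_on S f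
    \<Longrightarrow> smooth_on T (\<lambda>x. f (L x + b))"
  unfolding smooth_on_def using Cn_on_compose_affine by blast

lemma smooth_on_inverse:
  fixes f :: "'a::real_normed_vector \<Rightarrow> real"
  assumes "open S" "smooth_on S f" "\<And>x. x \<in> S \<Longrightarrow> f x \<noteq> 0"
  shows "smooth_on S (\<lambda>x. inverse (f x))"
proof -
  have "Cn_on n S (\<lambda>x. inverse (f x))" for n
  proof (induction n)
    case 0
    show ?case using continuous_on_inverse[OF smooth_on_continuous[OF assms(2)]] assms(3) by simp
  next
    case (Suc n)
    show ?case
    proof (rule Cn_on_real_compose[OF assms(1), where f = f and h = inverse and h' = "\<lambda>y. - (inverse y * inverse y)"])
      show "Cn_on n S (\<lambda>x. - (inverse (f x) * inverse (f x)))"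
        by (rule Cn_on_linear_compose[OF assms(1), where L = uminus, OF bounded_linear_minus[OF bounded_linear_ident]
            Cn_on_bilinear[OF assms(1) bounded_bilinear_mult Suc Suc]])
      show "Cn_on (Suc n) S f" using assms(2) unfolding smooth_on_def by blast
      show "(inverse has_real_derivative - (inverse (f x) * inverse (f x))) (at (f x))" if "x \<in> S" for x
        using DERIV_inverse'[OF DERIV_ident, of "f x"] assms(3)[OF that] by simp
    qed
  qed
  then show ?thesis by (simp add: smooth_on_def)
qed

lemma smooth_on_divide:
  fixes f :: "'a::real_normed_vector \<Rightarrow> real"
  shows "open S \<Longrightarrow> smooth_on S f \<Longrightarrow> smooth_on S g \<Longrightarrow> (\<And>x. x \<in> S \<Longrightarrow> g x \<noteq> 0) \<Longrightarrow> smooth_on S (\<lambda>x. f x / g x)"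
  unfolding divide_inverse by (intro smooth_on_mult smooth_on_inverse) auto

lemma smooth_on_sqrt:
  fixes f :: "'a::real_normed_vector \<Rightarrow> real"
  assumes "open S" "smooth_on S f" "\<And>x. x \<in> S \<Longrightarrow> f x > 0"
  shows "smooth_on S (\<lambda>x. sqrt (f x))"
proof -
  have "Cn_on n S (\<lambda>x. sqrt (f x))" for n
  proof (induction n)
    case 0
    show ?case using smooth_on_continuous[OF assms(2)] by (simp add: continuous_on_real_sqrt)
  next
    case (Suc n)
    have i: "Cn_on n S (\<lambda>x. inverse (f x))"
    proof -
      have "smooth_on S (\<lambda>x. inverse (f x))"
        by (rule smooth_on_inverse[OF assms(1,2)]) (use assms(3) in force)
      then show ?thesis unfolding smooth_on_def by blast
    qed
    show ?case
    proof (rule Cn_on_real_compose[OF assms(1), where f = f and h = sqrt and h' = "\<lambda>y. (1/2) * (sqrt y * inverse y)"])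
      show "Cn_on n S (\<lambda>x. (1/2) * (sqrt (f x) * inverse (f x)))"
        by (rule Cn_on_bilinear[OF assms(1) bounded_bilinear_mult Cn_on_const
            Cn_on_bilinear[OF assms(1) bounded_bilinear_mult Suc i]])
      show "(sqrt has_real_derivative 1 / 2 * (sqrt (f x) * inverse (f x))) (at (f x))" if "x \<in> S" for x
      proof -
        have "sqrt (f x) * sqrt (f x) = f x" "sqrt (f x) > 0" using assms(3)[OF that] by auto
        then have "inverse (sqrt (f x)) / 2 = 1 / 2 * (sqrt (f x) * inverse (f x))"
          by (simp add: divide_simps)
        then show ?thesis using DERIV_real_sqrt[OF assms(3)[OF that]] by simp
      qed
      show "Cn_on (Suc n) S f" using assms(2) unfolding smooth_on_def by blast
    qed
  qed
  then show ?thesis by (simp add: smooth_on_def)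
qed

lemma smooth_on_norm:
  fixes f :: "'a::real_normed_vector \<Rightarrow> 'b::real_inner"
  assumes "open S" "smooth_on S f" "\<And>x. x \<in> S \<Longrightarrow> f x \<noteq> 0"
  shows "smooth_on S (\<lambda>x. norm (f x))"
  unfolding norm_eq_sqrt_inner using assms by (intro smooth_on_sqrt smooth_on_inner) auto

lemma smooth_on_cos_sin:
  fixes f :: "'a::real_normed_vector \<Rightarrow> real"
  assumes "open S" "smooth_on S f"
  shows "smooth_on S (\<lambda>x. cos (f x))" and "smooth_on S (\<lambda>x. sin (f x))"
proof -
  have "Cn_on n S (\<lambda>x. cos (f x)) \<and> Cn_on n S (\<lambda>x. sin (f x))" for n
  proof (induction n)
    case 0
    show ?case using smooth_on_continuous[OF assms(2)] by (simp add: continuous_on_cos continuous_on_sin)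
  next
    case (Suc n)
    have "Cn_on n S (\<lambda>x. - sin (f x))"
      using Suc Cn_on_linear_compose[OF assms(1), where L = uminus, OF bounded_linear_minus[OF bounded_linear_ident]]
      by blast
    moreover have "Cn_on (Suc n) S f" using assms(2) unfolding smooth_on_def by blast
    ultimately show ?case
      using Cn_on_real_compose[OF assms(1), of n f cos "\<lambda>y. - sin y"]
        Cn_on_real_compose[OF assms(1), of n f sin cos] Suc by (auto simp del: Cn_on.simps)
  qed
  then show "smooth_on S (\<lambda>x. cos (f x))" "smooth_on S (\<lambda>x. sin (f x))" by (simp_all add: smooth_on_def)
qed

lemma vector_derivative_eq_frechet:
  "f differentiable at s \<Longrightarrow> vector_derivative f (at s) = frechet_derivative f (at s) 1"
proof (rule vector_derivative_at)
  assume "f differentiable at s"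
  then have f: "(f has_derivative frechet_derivative f (at s)) (at s)"
    by (simp add: frechet_derivative_works)
  then interpret bounded_linear "frechet_derivative f (at s)" by (rule has_derivative_bounded_linear)
  have "frechet_derivative f (at s) = (\<lambda>h. h *\<^sub>R frechet_derivative f (at s) 1)"
  proof
    fix h :: real
    have "frechet_derivative f (at s) (h *\<^sub>R 1) = h *\<^sub>R frechet_derivative f (at s) 1" by (rule scaleR)
    then show "frechet_derivative f (at s) h = h *\<^sub>R frechet_derivative f (at s) 1" by simp
  qed
  then show "(f has_vector_derivative frechet_derivative f (at s) 1) (at s)"
    using f unfolding has_vector_derivative_def by simp
qed

lemma smooth_on_vector_derivative:
  fixes f :: "real \<Rightarrow> 'a::real_normed_vector"
  assumes "open S" "smooth_on S f"
  shows "smooth_on S (\<lambda>s. vector_derivative f (at s))"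
  by (rule smooth_on_cong[OF assms(1) _ smooth_on_frechet_derivative[OF assms(2), of 1]])
     (simp add: vector_derivative_eq_frechet[OF smooth_on_differentiable[OF assms(2)]])

lemma smooth_on_has_vector_derivative:
  fixes f :: "real \<Rightarrow> 'a::real_normed_vector"
  shows "smooth_on S f \<Longrightarrow> s \<in> S \<Longrightarrow> (f has_vector_derivative vector_derivative f (at s)) (at s)"
  using smooth_on_differentiable vector_derivative_works by blast

lemma smooth_on_antiderivative:
  fixes f :: "real \<Rightarrow> 'a::real_normed_vector"
  assumes "open S" "\<And>s. s \<in> S \<Longrightarrow> (f has_vector_derivative f' s) (at s)" "smooth_on S f'"
  shows "smooth_on S f"
proof -
  have "Cn_on (Suc n) S f" for n
  proof (rule Cn_on_SucI[OF assms(1), where f' = "\<lambda>s v. v *\<^sub>R f' s"])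
    fix v show "Cn_on n S (\<lambda>s. v *\<^sub>R f' s)"
      using assms(3) unfolding smooth_on_def
      by (blast intro: Cn_on_bilinear[OF assms(1) bounded_bilinear_scaleR Cn_on_const])
  qed (use assms(2) in \<open>auto simp: has_vector_derivative_def\<close>)
  then show ?thesis unfolding smooth_on_def using Cn_on_SucD by blast
qed

lemma smooth_primitive_ex:
  fixes f :: "real \<Rightarrow> real"
  assumes "smooth_on {a<..<b} f" "s0 \<in> {a<..<b}"
  obtains g where "smooth_on {a<..<b} g" "g s0 = 0"
    "\<And>s. s \<in> {a<..<b} \<Longrightarrow> (g has_vector_derivative f s) (at s)"
proof -
  obtain G where G: "\<And>x. \<lbrakk>a < x; x < b\<rbrakk> \<Longrightarrow> (G has_vector_derivative f x) (at x)"
    using einterval_antiderivative[of a b f] assms(2) smooth_on_continuous[OF assms(1)]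
    by (auto simp: continuous_on_eq_continuous_at)
  define g where "g = (\<lambda>s. G s - G s0)"
  have g0: "g s0 = 0" by (simp add: g_def)
  have g: "(g has_vector_derivative f s) (at s)" if "s \<in> {a<..<b}" for s
    unfolding g_def using G that by (auto intro!: derivative_eq_intros)
  then have "smooth_on {a<..<b} g"
    using assms(1) by (intro smooth_on_antiderivative[of _ g f]) auto
  then show ?thesis using g0 g by (rule that)
qed

lemma derivative_zero_if_constant:
  fixes f :: "real \<Rightarrow> 'a::real_normed_vector"
  assumes "open S" "s \<in> S" "\<And>t. t \<in> S \<Longrightarrow> f t = k" "(f has_vector_derivative f') (at s)"
  shows "f' = 0"
proof -
  have "(f has_vector_derivative 0) (at s)"
    by (rule has_vector_derivative_transform_within_open[of "\<lambda>_. k", OF _ assms(1,2)]) (auto simp: assms(3))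
  then show ?thesis using assms(4) vector_derivative_unique_at by blast
qed

lemma constant_if_derivative_zero:
  fixes f :: "real \<Rightarrow> 'a::real_normed_vector"
  assumes "\<And>s. s \<in> {a<..<b} \<Longrightarrow> (f has_vector_derivative 0) (at s)" "s \<in> {a<..<b}" "t \<in> {a<..<b}"
  shows "f s = f t"
proof -
  have "\<exists>k. \<forall>x\<in>{a<..<b}. f x = k"
    using has_vector_derivative_zero_constant[of "{a<..<b}" f] assms(1) has_vector_derivative_at_within
    by (metis convex_real_interval(8))
  then show ?thesis using assms by metis
qed

section \<open>Charts of an immersed surface\<close>

lemma local_param_subset:
  assumes "local_param M F V \<psi>" "open W" "W \<subseteq> V"
  shows "local_param M F W \<psi>"
proof -
  from assms(1) obtain \<psi>' where V: "openin (top_of_set M) (\<psi> ` V)" "homeomorphism V (\<psi> ` V) \<psi> \<psi>'"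
    "smooth_on V (F \<circ> \<psi>)" "\<forall>x\<in>V. inj (frechet_derivative (F \<circ> \<psi>) (at x))" "open V"
    unfolding local_param_def by blast
  have "openin (top_of_set V) W" using assms V by (simp add: openin_open_eq)
  then have "openin (top_of_set (\<psi> ` V)) (\<psi> ` W)"
    by (rule homeomorphism_imp_open_map[OF V(2)])
  then have "openin (top_of_set M) (\<psi> ` W)" using V(1) openin_trans by blast
  moreover have "homeomorphism W (\<psi> ` W) \<psi> \<psi>'"
    using V(2) assms(3) by (rule homeomorphism_of_subsets) auto
  ultimately show ?thesis
    using assms V smooth_on_subset[OF V(3) assms(3)] unfolding local_param_def by blast
qed

lemma linear_real_prod_expand:
  fixes L :: "real \<times> real \<Rightarrow> 'a::real_vector"
  assumes "linear L"
  shows "L v = fst v *\<^sub>R L (1, 0) + snd v *\<^sub>R L (0, 1)"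
proof -
  have "v = fst v *\<^sub>R (1, 0) + snd v *\<^sub>R (0, 1)" by (cases v) simp
  then have "L v = L (fst v *\<^sub>R (1, 0) + snd v *\<^sub>R (0, 1))" by simp
  then show ?thesis by (simp only: linear_add[OF assms] linear_scale[OF assms])
qed

text \<open>The quantitative form of local injectivity asks for continuity of the derivative in operator norm;
  on the plane the operator norm is controlled by the two partial derivatives.\<close>

lemma immersion_locally_injective:
  fixes Y :: "real \<times> real \<Rightarrow> 'a::euclidean_space"
  assumes "open V" "smooth_on V Y" "x \<in> V" "inj (frechet_derivative Y (at x))"
  obtains r where "r > 0" "ball x r \<subseteq> V" "inj_on Y (ball x r)"
proof -
  let ?D = "\<lambda>y. frechet_derivative Y (at y)"
  have D: "(Y has_derivative ?D y) (at y)" if "y \<in> V" for y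
    using smooth_on_has_derivative[OF assms(2) that] .
  have lin: "linear (?D y)" if "y \<in> V" for y
    using D[OF that] has_derivative_linear by blast
  obtain g' where g': "linear g'" "g' \<circ> ?D x = id"
    using linear_injective_left_inverse[OF lin[OF assms(3)] assms(4)] by blast
  have cont: "isCont (\<lambda>y. ?D y v) x" for v
    using smooth_on_continuous[OF smooth_on_frechet_derivative[OF assms(2)]] assms(1,3)
    by (simp add: continuous_on_eq_continuous_at)
  have small: "\<exists>d>0. \<forall>y. dist x y < d \<longrightarrow> onorm (\<lambda>v. ?D y v - ?D x v) < e" if "e > 0" for e
  proof -
    have "e / 3 > 0" using that by simp
    note ev = tendstoD[OF cont[unfolded isCont_def] this]
    have "\<forall>\<^sub>F y in at x. y \<in> V" using assms(1,3) by (simp add: eventually_at_in_open')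
    with ev[of "(1,0)"] ev[of "(0,1)"]
    have "\<forall>\<^sub>F y in at x. y \<in> V \<and> dist (?D y (1,0)) (?D x (1,0)) < e / 3
        \<and> dist (?D y (0,1)) (?D x (0,1)) < e / 3"
      by eventually_elim simp
    then obtain d where d: "d > 0" and y0: "\<And>y. y \<noteq> x \<Longrightarrow> dist y x < d \<Longrightarrow> y \<in> V \<and> dist (?D y (1,0)) (?D x (1,0)) < e / 3
        \<and> dist (?D y (0,1)) (?D x (0,1)) < e / 3"
      unfolding eventually_at by auto
    have y: "y \<in> V \<and> dist (?D y (1,0)) (?D x (1,0)) < e / 3
        \<and> dist (?D y (0,1)) (?D x (0,1)) < e / 3" if "dist y x < d" for y
      using y0[OF _ that] assms(3) \<open>e > 0\<close> by (cases "y = x") auto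
    have "onorm (\<lambda>v. ?D y v - ?D x v) < e" if "dist x y < d" for y
    proof -
      have y': "y \<in> V" "norm (?D y (1,0) - ?D x (1,0)) < e / 3" "norm (?D y (0,1) - ?D x (0,1)) < e / 3"
        using y[of y] that by (auto simp: dist_norm dist_commute norm_minus_commute)
      have "norm (?D y v - ?D x v) \<le> (2 * e / 3) * norm v" for v
      proof -
        have "?D y v - ?D x v = fst v *\<^sub>R (?D y (1,0) - ?D x (1,0)) + snd v *\<^sub>R (?D y (0,1) - ?D x (0,1))"
          using linear_real_prod_expand[OF lin[OF y'(1)], of v] linear_real_prod_expand[OF lin[OF assms(3)], of v]
          by (simp add: scaleR_diff_right)
        also have "norm \<dots> \<le> \<bar>fst v\<bar> * norm (?D y (1,0) - ?D x (1,0)) + \<bar>snd v\<bar> * norm (?D y (0,1) - ?D x (0,1))"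
          by (rule order_trans[OF norm_triangle_ineq]) simp
        also have "\<dots> \<le> norm v * (e / 3) + norm v * (e / 3)"
          using y' norm_fst_le[of "fst v" "snd v"] norm_snd_le[of "snd v" "fst v"]
          by (intro add_mono mult_mono) auto
        finally show ?thesis by (simp add: algebra_simps)
      qed
      then have "onorm (\<lambda>v. ?D y v - ?D x v) \<le> 2 * e / 3" by (rule onorm_le)
      then show ?thesis using \<open>e > 0\<close> by linarith
    qed
    then show ?thesis using d by blast
  qed
  show ?thesis
    by (rule has_derivative_locally_injective[OF assms(3,1) _ g'(2) D small])
      (use g' linear_conv_bounded_linear that in auto)
qed

text \<open>The new chart is \<open>\<psi> \<circ> \<Theta>\<inverse>\<close>. The immersion is locally injective, hence so is \<open>\<Theta>\<close>, and by invariance of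
  domain a continuous \<open>\<Theta>\<close> is then a local homeomorphism. That the immersion is smooth in the new chart
  is read off from \<open>X\<close>.\<close>

lemma chart_change:
  assumes lp: "local_param M F V \<psi>" and N: "open N" "x0 \<in> N" "N \<subseteq> V"
    and \<Theta>: "continuous_on N \<Theta>" "\<Theta> ` N \<subseteq> D" and D: "open D" "smooth_on D X"
    and imm: "\<And>x. x \<in> N \<Longrightarrow> inj (frechet_derivative X (at (\<Theta> x)))"
    and g: "congruence g" and eq: "\<And>x. x \<in> N \<Longrightarrow> g (F (\<psi> x)) = X (\<Theta> x)"
  obtains W \<xi> where "local_param M F W \<xi>" "\<Theta> x0 \<in> W" "\<xi> (\<Theta> x0) = \<psi> x0" "W \<subseteq> D"
    "\<And>y. y \<in> W \<Longrightarrow> g (F (\<xi> y)) = X y"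
proof -
  from lp obtain \<psi>' where V: "openin (top_of_set M) (\<psi> ` V)" "homeomorphism V (\<psi> ` V) \<psi> \<psi>'"
    "smooth_on V (F \<circ> \<psi>)" "\<forall>x\<in>V. inj (frechet_derivative (F \<circ> \<psi>) (at x))" "open V"
    unfolding local_param_def by blast
  obtain r where r: "r > 0" "ball x0 r \<subseteq> N" "inj_on (F \<circ> \<psi>) (ball x0 r)"
    using immersion_locally_injective[OF N(1) smooth_on_subset[OF V(3) N(3)] N(2)] V(4) N by blast
  let ?B = "ball x0 r"
  from g obtain A b where A: "orthogonal_transformation A" and gA: "g = (\<lambda>z. A z + b)"
    unfolding congruence_def by blast
  have inj\<Theta>: "inj_on \<Theta> ?B"
  proof (rule inj_onI)
    fix x y assume xy: "x \<in> ?B" "y \<in> ?B" "\<Theta> x = \<Theta> y"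
    then have "g (F (\<psi> x)) = g (F (\<psi> y))" using eq r(2) by (metis subsetD)
    then have "F (\<psi> x) = F (\<psi> y)"
      using injD[OF orthogonal_transformation_inj[OF A]] by (simp add: gA)
    then show "x = y" using r(3) xy by (auto simp: inj_on_def)
  qed
  have cB: "continuous_on ?B \<Theta>" using \<Theta>(1) r(2) continuous_on_subset by blast
  define W where "W = \<Theta> ` ?B"
  have oW: "open W" unfolding W_def by (rule invariance_of_domain[OF cB open_ball inj\<Theta>])
  obtain \<Theta>' where h: "homeomorphism ?B W \<Theta> \<Theta>'"
    unfolding W_def using invariance_of_domain_homeomorphism[OF open_ball cB _ inj\<Theta>] by auto
  define \<xi> where "\<xi> = \<psi> \<circ> \<Theta>'"
  have lpB: "local_param M F ?B \<psi>" by (rule local_param_subset[OF lp]) (use r N in auto)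
  then obtain \<psi>'' where hB: "homeomorphism ?B (\<psi> ` ?B) \<psi> \<psi>''" and oB: "openin (top_of_set M) (\<psi> ` ?B)"
    unfolding local_param_def by blast
  have im: "\<xi> ` W = \<psi> ` ?B" unfolding \<xi>_def using homeomorphism_image2[OF h] by (metis image_comp)
  have hom: "homeomorphism W (\<xi> ` W) \<xi> (\<Theta> \<circ> \<psi>'')"
    unfolding im unfolding \<xi>_def by (rule homeomorphism_compose[OF homeomorphism_symD[OF h] hB])
  have eqW: "g (F (\<xi> y)) = X y" if "y \<in> W" for y
  proof -
    from that obtain x where "x \<in> ?B" "y = \<Theta> x" unfolding W_def by blast
    moreover from this have "\<Theta>' y = x" using homeomorphism_apply1[OF h] by blast
    ultimately show ?thesis using eq[of x] subsetD[OF r(2), of x] unfolding \<xi>_def by simp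
  qed
  let ?A' = "inv A"
  have A': "linear ?A'" "inj ?A'"
    using A orthogonal_transformation_inv orthogonal_transformation_linear orthogonal_transformation_inj by blast+
  have bA': "bounded_linear ?A'" using A'(1) linear_conv_bounded_linear by blast
  have invA: "?A' (A z) = z" for z using orthogonal_transformation_inj[OF A] by simp
  have FX: "(F \<circ> \<xi>) y = ?A' (X y) + ?A' (- b)" if "y \<in> W" for y
  proof -
    have "A (F (\<xi> y)) = X y + (- b)" using eqW[OF that] by (simp add: gA algebra_simps)
    then have "F (\<xi> y) = ?A' (X y + (- b))" using invA by metis
    then show ?thesis using linear_add[OF A'(1), of "X y" "- b"] by simp
  qed
  have WD: "W \<subseteq> D" using \<Theta>(2) r(2) unfolding W_def by blast
  have sX: "smooth_on W X" using D(2) WD by (rule smooth_on_subset)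
  have sm: "smooth_on W (F \<circ> \<xi>)"
    by (rule smooth_on_cong[OF oW FX[symmetric] smooth_on_add[OF oW
        smooth_on_linear_compose[OF oW bA' sX] smooth_on_const]])
  have injW: "inj (frechet_derivative (F \<circ> \<xi>) (at y))" if y: "y \<in> W" for y
  proof -
    have "(X has_derivative frechet_derivative X (at y)) (at y)"
      using smooth_on_has_derivative[OF sX y] .
    then have "((\<lambda>y. ?A' (X y) + ?A' (- b)) has_derivative (\<lambda>v. ?A' (frechet_derivative X (at y) v))) (at y)"
      using bounded_linear.has_derivative[OF bA'] by (auto intro!: derivative_eq_intros)
    then have "((F \<circ> \<xi>) has_derivative (\<lambda>v. ?A' (frechet_derivative X (at y) v))) (at y)"
      using oW y FX by (auto intro: has_derivative_transform_within_open)
    then have "frechet_derivative (F \<circ> \<xi>) (at y) = (\<lambda>v. ?A' (frechet_derivative X (at y) v))"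
      using frechet_derivative_at by metis
    moreover have "inj (frechet_derivative X (at y))" using imm y r(2) unfolding W_def by auto
    ultimately show ?thesis using inj_compose[OF A'(2)] by (simp add: comp_def)
  qed
  have "local_param M F W \<xi>"
    unfolding local_param_def
  proof (intro conjI ballI exI)
    show "openin (top_of_set M) (\<xi> ` W)" unfolding im by (rule oB)
  qed (fact oW hom sm injW)+
  moreover have "\<Theta> x0 \<in> W" unfolding W_def using r(1) by auto
  moreover have "\<xi> (\<Theta> x0) = \<psi> x0" unfolding \<xi>_def using homeomorphism_apply1[OF h, of x0] r(1) by simp
  ultimately show ?thesis using WD eqW by (rule that)
qed

lemma locally_congruent_by_chart_change:
  assumes lp: "local_param M F V \<psi>" and N: "open N" "x0 \<in> N" "N \<subseteq> V"
    and \<Theta>: "continuous_on N \<Theta>" "\<Theta> ` N \<subseteq> D" and D: "open D" "smooth_on D X"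
    and imm: "\<And>x. x \<in> N \<Longrightarrow> inj (frechet_derivative X (at (\<Theta> x)))"
    and g: "congruence g" and eq: "\<And>x. x \<in> N \<Longrightarrow> g (F (\<psi> x)) = X (\<Theta> x)"
  shows "locally_congruent_at M F (\<psi> x0) D X"
proof -
  obtain W \<xi> where W: "local_param M F W \<xi>" "\<Theta> x0 \<in> W" "\<xi> (\<Theta> x0) = \<psi> x0" "W \<subseteq> D"
    "\<And>y. y \<in> W \<Longrightarrow> g (F (\<xi> y)) = X y"
    using chart_change[OF lp N \<Theta> D imm g eq] by blast
  have "\<psi> x0 \<in> \<xi> ` W" using imageI[OF W(2), of \<xi>] W(3) by simp
  then show ?thesis unfolding locally_congruent_at_def using W(1,4,5) g by blast
qed

section \<open>The Lagrangian and self-similarity conditions in a chart\<close>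

lemma J_simps [simp]:
  "J (a + b) = J a + J b" "J (a - b) = J a - J b" "J (- a) = - J a" "J (c *\<^sub>R a) = c *\<^sub>R J a" "J (J a) = - a" "J 0 = 0"
  by (auto simp: J_def algebra_simps prod_eq_iff zero_prod_def)

lemma inner_J_self [simp]: "a \<bullet> J a = 0" "J a \<bullet> a = 0"
  by (auto simp: J_def inner_prod_def inner_complex_def)

lemma inner_J_J [simp]: "J a \<bullet> J b = a \<bullet> b"
  by (auto simp: J_def inner_prod_def inner_complex_def)

lemma inner_J_left: "J a \<bullet> b = - (a \<bullet> J b)"
  by (auto simp: J_def inner_prod_def inner_complex_def)

lemma norm_J [simp]: "norm (J a) = norm a"
  by (simp add: norm_eq_sqrt_inner)

lemma bounded_linear_J: "bounded_linear J"
  by (rule linear_conv_bounded_linear[THEN iffD1], rule linearI) auto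

lemma normal_component_inner:
  assumes "subspace T" "\<And>v. v \<in> T \<Longrightarrow> \<nu> \<bullet> v = 0"
  shows "normal_component T w \<bullet> \<nu> = w \<bullet> \<nu>"
proof -
  obtain y n where yn: "y \<in> span T" "\<And>v. v \<in> span T \<Longrightarrow> orthogonal n v" "w = y + n"
    using orthogonal_subspace_decomp_exists by blast
  have sT: "span T = T" using assms(1) by (simp add: span_eq_iff)
  have n: "w - n \<in> T \<and> (\<forall>v\<in>T. n \<bullet> v = 0)" using yn sT by (auto simp: orthogonal_def)
  have uniq: "n' = n" if n': "w - n' \<in> T \<and> (\<forall>v\<in>T. n' \<bullet> v = 0)" for n'
  proof -
    have "n' - n \<in> T" using subspace_diff[OF assms(1), of "w - n" "w - n'"] n n' by simp
    then have "(n' - n) \<bullet> (n' - n) = 0" using n n' by (simp add: inner_diff_left)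
    then show ?thesis by simp
  qed
  have "normal_component T w = n" unfolding normal_component_def
    by (rule the_equality, rule n, rule uniq)
  moreover have "w \<bullet> \<nu> = n \<bullet> \<nu>"
    using yn(1,3) sT assms(2)[of y] by (simp add: inner_add_left inner_commute[of y \<nu>])
  ultimately show ?thesis by simp
qed

lemma frechet_derivative_partials:
  assumes "(X has_derivative (\<lambda>h. fst h *\<^sub>R X1 + snd h *\<^sub>R X2)) (at x)"
  shows "frechet_derivative X (at x) (h, k) = h *\<^sub>R X1 + k *\<^sub>R X2"
  using frechet_derivative_at[OF assms] by (metis fst_conv snd_conv)

lemma lagrangian_partials:
  assumes "local_param M F V \<psi>" "lagrangian M F" "\<And>y. y \<in> V \<Longrightarrow> F (\<psi> y) = X y" "x \<in> V"
    and "(X has_derivative (\<lambda>h. fst h *\<^sub>R X1 + snd h *\<^sub>R X2)) (at x)"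
  shows "X1 \<bullet> J X2 = 0"
proof -
  have oV: "open V" using assms(1) unfolding local_param_def by blast
  have "((F \<circ> \<psi>) has_derivative (\<lambda>h. fst h *\<^sub>R X1 + snd h *\<^sub>R X2)) (at x)"
    by (rule has_derivative_transform_within_open[OF assms(5) oV assms(4)]) (simp add: assms(3))
  then have f: "frechet_derivative (F \<circ> \<psi>) (at x) (h, k) = h *\<^sub>R X1 + k *\<^sub>R X2" for h k
    by (rule frechet_derivative_partials)
  have "X1 = frechet_derivative (F \<circ> \<psi>) (at x) (1, 0)" "X2 = frechet_derivative (F \<circ> \<psi>) (at x) (0, 1)"
    by (simp_all add: f)
  then have "X1 \<in> tangent_plane (F \<circ> \<psi>) x" "X2 \<in> tangent_plane (F \<circ> \<psi>) x"
    unfolding tangent_plane_def by simp_all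
  moreover have "\<forall>v\<in>tangent_plane (F \<circ> \<psi>) x. \<forall>w\<in>tangent_plane (F \<circ> \<psi>) x. v \<bullet> J w = 0"
    using assms(2)[unfolded lagrangian_def, rule_format, OF assms(1,4)] by simp
  ultimately show ?thesis by simp
qed

text \<open>If the Gram determinant vanishes, the coefficients \<open>\<langle>X2, X2\<rangle>, - \<langle>X1, X2\<rangle>\<close> give a linear relation between \<open>X1\<close>
  and \<open>X2\<close>, which is trivial only for \<open>X2 = 0\<close>.\<close>

lemma immersion_gram_pos:
  fixes X1 X2 :: "'a::real_inner"
  assumes "inj (\<lambda>h. fst h *\<^sub>R X1 + snd h *\<^sub>R X2)"
  shows "(X1 \<bullet> X1) * (X2 \<bullet> X2) - (X1 \<bullet> X2)\<^sup>2 > 0"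
proof (rule ccontr)
  assume "\<not> ?thesis"
  then have z: "(X1 \<bullet> X1) * (X2 \<bullet> X2) - (X1 \<bullet> X2)\<^sup>2 = 0"
    using Cauchy_Schwarz_ineq[of X1 X2] by linarith
  let ?w = "(X2 \<bullet> X2) *\<^sub>R X1 + (- (X1 \<bullet> X2)) *\<^sub>R X2"
  have "?w \<bullet> ?w = (X2 \<bullet> X2) * ((X1 \<bullet> X1) * (X2 \<bullet> X2) - (X1 \<bullet> X2)\<^sup>2)"
    by (simp add: inner_add_left inner_add_right inner_commute algebra_simps power2_eq_square)
  then have "?w = 0" using z by simp
  then have "(X2 \<bullet> X2, - (X1 \<bullet> X2)) = (0, 0)" by (intro injD[OF assms]) simp
  then have "X2 = 0" by simp
  then have "(0::real, 1::real) = (0, 0)" by (intro injD[OF assms]) simp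
  then show False by simp
qed

lemma gram_pos_imp_inj:
  fixes X1 X2 :: "'a::real_inner"
  assumes "(X1 \<bullet> X1) * (X2 \<bullet> X2) - (X1 \<bullet> X2)\<^sup>2 > 0"
  shows "inj (\<lambda>h::real \<times> real. fst h *\<^sub>R X1 + snd h *\<^sub>R X2)"
proof -
  have lin: "linear (\<lambda>h::real \<times> real. fst h *\<^sub>R X1 + snd h *\<^sub>R X2)"
    by (rule linearI) (auto simp: algebra_simps)
  have "h = 0" if "fst h *\<^sub>R X1 + snd h *\<^sub>R X2 = 0" for h :: "real \<times> real"
  proof -
    let ?a = "fst h" and ?b = "snd h" and ?E = "X1 \<bullet> X1" and ?F = "X1 \<bullet> X2" and ?G = "X2 \<bullet> X2"
    have 1: "?a * ?E + ?b * ?F = 0" using arg_cong[OF that, of "\<lambda>v. v \<bullet> X1"] by (simp add: inner_add_left inner_commute[of X2 X1])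
    have 2: "?a * ?F + ?b * ?G = 0" using arg_cong[OF that, of "\<lambda>v. v \<bullet> X2"] by (simp add: inner_add_left)
    have "?a * (?E * ?G - ?F\<^sup>2) = (?a * ?E + ?b * ?F) * ?G - (?a * ?F + ?b * ?G) * ?F"
      "?b * (?E * ?G - ?F\<^sup>2) = (?a * ?F + ?b * ?G) * ?E - (?a * ?E + ?b * ?F) * ?F"
      by (simp_all add: algebra_simps power2_eq_square)
    then have "?a = 0" "?b = 0" using assms 1 2 by auto
    then show ?thesis by (simp add: prod_eq_iff)
  qed
  then show ?thesis using linear_injective_0[OF lin] by blast
qed

text \<open>Testing the equation against a normal vector \<open>\<nu>\<close> removes all normal projections from it.\<close>

lemma self_similar_tested:
  fixes X X1 X2 :: "real \<times> real \<Rightarrow> C2"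
  assumes lp: "local_param M F V \<psi>" and ss: "self_similar lam M F"
    and FX: "\<And>y. y \<in> V \<Longrightarrow> F (\<psi> y) = X y" and x: "x \<in> V"
    and d: "\<And>y. y \<in> V \<Longrightarrow> (X has_derivative (\<lambda>h. fst h *\<^sub>R X1 y + snd h *\<^sub>R X2 y)) (at y)"
    and d1: "(X1 has_derivative (\<lambda>h. fst h *\<^sub>R X11 + snd h *\<^sub>R X12)) (at x)"
    and d2: "(X2 has_derivative (\<lambda>h. fst h *\<^sub>R X21 + snd h *\<^sub>R X22)) (at x)"
  defines "gE \<equiv> X1 x \<bullet> X1 x" and "gF \<equiv> X1 x \<bullet> X2 x" and "gG \<equiv> X2 x \<bullet> X2 x"
  shows "gE * gG - gF\<^sup>2 > 0"
    and "\<nu> \<bullet> X1 x = 0 \<Longrightarrow> \<nu> \<bullet> X2 x = 0 \<Longrightarrow>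
      gG * (X11 \<bullet> \<nu>) - 2 * gF * (X12 \<bullet> \<nu>) + gE * (X22 \<bullet> \<nu>)
        + lam * (gE * gG - gF\<^sup>2) * (X x \<bullet> \<nu>) = 0"
proof -
  have oV: "open V" using lp unfolding local_param_def by blast
  let ?Y = "F \<circ> \<psi>"
  have dY: "(?Y has_derivative (\<lambda>h. fst h *\<^sub>R X1 y + snd h *\<^sub>R X2 y)) (at y)" if "y \<in> V" for y
    by (rule has_derivative_transform_within_open[OF d[OF that] oV that]) (simp add: FX)
  note fY = frechet_derivative_partials[OF dY]
  have "inj (frechet_derivative ?Y (at x))" using lp x unfolding local_param_def by blast
  then have "inj (\<lambda>h. fst h *\<^sub>R X1 x + snd h *\<^sub>R X2 x)"
    using frechet_derivative_at[OF dY[OF x]] by simp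
  then show pos: "gE * gG - gF\<^sup>2 > 0" unfolding gE_def gF_def gG_def by (rule immersion_gram_pos)
  have T: "frechet_derivative ?Y (at x) = (\<lambda>h. fst h *\<^sub>R X1 x + snd h *\<^sub>R X2 x)"
    using frechet_derivative_at[OF dY[OF x]] by simp
  have sub: "subspace (tangent_plane ?Y x)"
    unfolding tangent_plane_def T
    by (rule linear_subspace_image[OF has_derivative_linear[OF dY[OF x]] subspace_UNIV])
  have s1: "((\<lambda>y. frechet_derivative ?Y (at y) (1, 0)) has_derivative (\<lambda>h. fst h *\<^sub>R X11 + snd h *\<^sub>R X12)) (at x)"
    by (rule has_derivative_transform_within_open[OF d1 oV x]) (simp add: fY)
  have s2: "((\<lambda>y. frechet_derivative ?Y (at y) (0, 1)) has_derivative (\<lambda>h. fst h *\<^sub>R X21 + snd h *\<^sub>R X22)) (at x)"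
    by (rule has_derivative_transform_within_open[OF d2 oV x]) (simp add: fY)
  assume \<nu>: "\<nu> \<bullet> X1 x = 0" "\<nu> \<bullet> X2 x = 0"
  have n: "normal_component (tangent_plane ?Y x) w \<bullet> \<nu> = w \<bullet> \<nu>" for w
    by (rule normal_component_inner[OF sub]) (auto simp: tangent_plane_def T inner_add_right \<nu>)
  have II: "second_fundamental_form ?Y x (1,0) (1,0) \<bullet> \<nu> = X11 \<bullet> \<nu>"
    "second_fundamental_form ?Y x (1,0) (0,1) \<bullet> \<nu> = X12 \<bullet> \<nu>"
    "second_fundamental_form ?Y x (0,1) (0,1) \<bullet> \<nu> = X22 \<bullet> \<nu>"
    unfolding second_fundamental_form_def n
    by (simp_all add: frechet_derivative_partials[OF s1] frechet_derivative_partials[OF s2])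
  have "mean_curvature_vector ?Y x + lam *\<^sub>R normal_component (tangent_plane ?Y x) (F (\<psi> x)) = 0"
    using ss lp x unfolding self_similar_def by blast
  then have "(mean_curvature_vector ?Y x + lam *\<^sub>R normal_component (tangent_plane ?Y x) (F (\<psi> x))) \<bullet> \<nu> = 0"
    by simp
  then have "(1 / (gE * gG - gF\<^sup>2)) * (gG * (X11 \<bullet> \<nu>) - 2 * gF * (X12 \<bullet> \<nu>) + gE * (X22 \<bullet> \<nu>)) + lam * (X x \<bullet> \<nu>) = 0"
    unfolding mean_curvature_vector_def Let_def
    by (simp add: inner_add_left inner_diff_left n II FX[OF x] fY[OF x] gE_def gF_def gG_def)
  then show "gG * (X11 \<bullet> \<nu>) - 2 * gF * (X12 \<bullet> \<nu>) + gE * (X22 \<bullet> \<nu>)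
        + lam * (gE * gG - gF\<^sup>2) * (X x \<bullet> \<nu>) = 0"
    using pos by (simp add: field_simps)
qed

section \<open>Smooth families of circles\<close>

text \<open>The matrix that expresses one orthonormal pair in terms of another in the same plane has orthonormal rows,
  hence orthonormal columns.\<close>

lemma plane_expand:
  fixes \<epsilon>1 \<epsilon>2 e1 e2 w :: "'a::real_inner"
  assumes \<epsilon>: "\<epsilon>1 \<bullet> \<epsilon>1 = 1" "\<epsilon>2 \<bullet> \<epsilon>2 = 1" "\<epsilon>1 \<bullet> \<epsilon>2 = 0"
    and e: "e1 = x1 *\<^sub>R \<epsilon>1 + x2 *\<^sub>R \<epsilon>2" "e2 = y1 *\<^sub>R \<epsilon>1 + y2 *\<^sub>R \<epsilon>2" "w = w1 *\<^sub>R \<epsilon>1 + w2 *\<^sub>R \<epsilon>2"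
    and on: "e1 \<bullet> e1 = 1" "e2 \<bullet> e2 = 1" "e1 \<bullet> e2 = 0"
  shows "w = (w \<bullet> e1) *\<^sub>R e1 + (w \<bullet> e2) *\<^sub>R e2"
proof -
  have \<epsilon>': "\<epsilon>2 \<bullet> \<epsilon>1 = 0" using \<epsilon>(3) by (simp add: inner_commute)
  have x: "x1 * x1 + x2 * x2 = 1" and y: "y1 * y1 + y2 * y2 = 1" and xy: "x1 * y1 + x2 * y2 = 0"
    using on by (simp_all add: e inner_add_left inner_add_right \<epsilon> \<epsilon>' algebra_simps)
  have "y1 = y1 * (x1 * x1 + x2 * x2)" "y2 = y2 * (x1 * x1 + x2 * x2)" using x by auto
  then have yD: "y1 = - x2 * (x1 * y2 - x2 * y1)" "y2 = x1 * (x1 * y2 - x2 * y1)"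
    using xy by algebra+
  define D where "D = x1 * y2 - x2 * y1"
  have D: "D * D = 1" using x y xy unfolding D_def by algebra
  have c: "x1 * x1 + y1 * y1 = 1" "x1 * x2 + y1 * y2 = 0" "x2 * x2 + y2 * y2 = 1"
    using yD[folded D_def] D x by algebra+
  have we: "w \<bullet> e1 = w1 * x1 + w2 * x2" "w \<bullet> e2 = w1 * y1 + w2 * y2"
    by (simp_all add: e inner_add_left inner_add_right \<epsilon> \<epsilon>' algebra_simps)
  have k: "(w1 * x1 + w2 * x2) * x1 + (w1 * y1 + w2 * y2) * y1 = w1"
    "(w1 * x1 + w2 * x2) * x2 + (w1 * y1 + w2 * y2) * y2 = w2"
    using c by algebra+
  have "(w \<bullet> e1) *\<^sub>R e1 + (w \<bullet> e2) *\<^sub>R e2 =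
      ((w1 * x1 + w2 * x2) * x1 + (w1 * y1 + w2 * y2) * y1) *\<^sub>R \<epsilon>1
      + ((w1 * x1 + w2 * x2) * x2 + (w1 * y1 + w2 * y2) * y2) *\<^sub>R \<epsilon>2"
    unfolding we unfolding e by (simp add: scaleR_add_left scaleR_add_right)
  then show ?thesis unfolding k e(3) by simp
qed

lemma in_plane_if_orthogonal:
  fixes \<epsilon>1 \<epsilon>2 z :: "'a::real_inner"
  assumes "\<epsilon>1 \<bullet> \<epsilon>1 = 1" "\<epsilon>2 \<bullet> \<epsilon>2 = 1" "\<epsilon>1 \<bullet> \<epsilon>2 = 0"
    and "\<And>\<nu>. \<nu> \<bullet> \<epsilon>1 = 0 \<Longrightarrow> \<nu> \<bullet> \<epsilon>2 = 0 \<Longrightarrow> \<nu> \<bullet> z = 0"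
  shows "z = (z \<bullet> \<epsilon>1) *\<^sub>R \<epsilon>1 + (z \<bullet> \<epsilon>2) *\<^sub>R \<epsilon>2"
proof -
  let ?\<nu> = "z - ((z \<bullet> \<epsilon>1) *\<^sub>R \<epsilon>1 + (z \<bullet> \<epsilon>2) *\<^sub>R \<epsilon>2)"
  have c: "\<epsilon>2 \<bullet> \<epsilon>1 = 0" using assms(3) by (simp add: inner_commute)
  have \<nu>: "?\<nu> \<bullet> \<epsilon>1 = 0" "?\<nu> \<bullet> \<epsilon>2 = 0"
    using assms(1-3) c by (simp_all add: inner_diff_left inner_add_left)
  then have "?\<nu> \<bullet> z = 0" by (rule assms(4))
  then have "?\<nu> \<bullet> ?\<nu> = 0"
    using \<nu> by (simp add: inner_diff_right[of _ z] inner_add_right)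
  then show ?thesis by simp
qed

text \<open>A curve running on a circle determines that circle by its first two derivatives: the centre is
  reached from a point by following the curvature vector.\<close>

lemma circle_from_curvature:
  fixes y y' y'' :: "real \<Rightarrow> C2"
  assumes C: "round_circle C" "\<And>t. t \<in> T \<Longrightarrow> y t \<in> C" and T: "open T" "t0 \<in> T"
    and d: "\<And>t. t \<in> T \<Longrightarrow> (y has_vector_derivative y' t) (at t)"
      "\<And>t. t \<in> T \<Longrightarrow> (y' has_vector_derivative y'' t) (at t)"
    and nz: "y' t0 \<noteq> 0"
  defines "K \<equiv> y'' t0 - ((y'' t0 \<bullet> y' t0) / (y' t0 \<bullet> y' t0)) *\<^sub>R y' t0"
  defines "r \<equiv> (y' t0 \<bullet> y' t0) / norm K" and "e1 \<equiv> - (1 / norm K) *\<^sub>R K" and "e2 \<equiv> (1 / norm (y' t0)) *\<^sub>R y' t0"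
  defines "c \<equiv> y t0 - r *\<^sub>R e1"
  shows "K \<noteq> 0" and "e1 \<bullet> e2 = 0"
    and "\<And>t. t \<in> T \<Longrightarrow> y t - c = ((y t - c) \<bullet> e1) *\<^sub>R e1 + ((y t - c) \<bullet> e2) *\<^sub>R e2"
    and "\<And>t. t \<in> T \<Longrightarrow> (y t - c) \<bullet> (y t - c) = r\<^sup>2"
proof -
  from C(1) obtain p \<epsilon>1 \<epsilon>2 \<rho> where \<rho>: "\<rho> > 0" and n: "norm \<epsilon>1 = 1" "norm \<epsilon>2 = 1" and \<epsilon>3: "\<epsilon>1 \<bullet> \<epsilon>2 = 0"
    and Ceq: "C = {p + (\<rho> * cos t) *\<^sub>R \<epsilon>1 + (\<rho> * sin t) *\<^sub>R \<epsilon>2 | t :: real. True}"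
    unfolding round_circle_def by blast
  have \<epsilon>: "\<epsilon>1 \<bullet> \<epsilon>1 = 1" "\<epsilon>2 \<bullet> \<epsilon>2 = 1" "\<epsilon>1 \<bullet> \<epsilon>2 = 0" "\<epsilon>2 \<bullet> \<epsilon>1 = 0"
    using n \<epsilon>3 by (simp_all add: norm_eq_1 inner_commute)
  define w where "w t = y t - p" for t
  have w: "w t \<bullet> w t = \<rho>\<^sup>2 \<and> (\<forall>\<nu>. \<nu> \<bullet> \<epsilon>1 = 0 \<longrightarrow> \<nu> \<bullet> \<epsilon>2 = 0 \<longrightarrow> \<nu> \<bullet> w t = 0)" if t: "t \<in> T" for t
  proof -
    obtain \<tau> where "y t = p + (\<rho> * cos \<tau>) *\<^sub>R \<epsilon>1 + (\<rho> * sin \<tau>) *\<^sub>R \<epsilon>2" using C(2)[OF t] Ceq by auto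
    then have wt: "w t = (\<rho> * cos \<tau>) *\<^sub>R \<epsilon>1 + (\<rho> * sin \<tau>) *\<^sub>R \<epsilon>2" by (simp add: w_def)
    have "w t \<bullet> w t = (\<rho> * cos \<tau>) * (\<rho> * cos \<tau>) + (\<rho> * sin \<tau>) * (\<rho> * sin \<tau>)"
      by (simp add: wt inner_add_left inner_add_right \<epsilon>)
    also have "\<dots> = \<rho>\<^sup>2 * ((cos \<tau>)\<^sup>2 + (sin \<tau>)\<^sup>2)"
      by (simp only: power2_eq_square distrib_left mult.assoc mult.left_commute)
    finally have "w t \<bullet> w t = \<rho>\<^sup>2" by simp
    then show ?thesis by (auto simp: wt inner_add_right)
  qed
  have dw: "(w has_vector_derivative y' t) (at t)" if "t \<in> T" for t
    unfolding w_def using d(1)[OF that] by (auto intro!: derivative_eq_intros)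
  have zero: "g t = 0" if t: "t \<in> T" and f: "\<And>t. t \<in> T \<Longrightarrow> f t = k"
    and g: "(f has_vector_derivative g t) (at t)" for f g :: "real \<Rightarrow> real" and k t
    by (rule derivative_zero_if_constant[OF T(1) t f g])
  have s: "\<nu> \<bullet> y' t = 0" if "t \<in> T" "\<nu> \<bullet> \<epsilon>1 = 0" "\<nu> \<bullet> \<epsilon>2 = 0" for \<nu> t
  proof (rule zero[OF that(1), of "\<lambda>t. \<nu> \<bullet> w t" 0 "\<lambda>t. \<nu> \<bullet> y' t"])
    show "\<nu> \<bullet> w t = 0" if "t \<in> T" for t
      using w[OF that] \<open>\<nu> \<bullet> \<epsilon>1 = 0\<close> \<open>\<nu> \<bullet> \<epsilon>2 = 0\<close> by blast
  qed (rule bounded_linear.has_vector_derivative[OF bounded_linear_inner_right dw[OF that(1)]])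
  have s2: "\<nu> \<bullet> y'' t = 0" if "t \<in> T" "\<nu> \<bullet> \<epsilon>1 = 0" "\<nu> \<bullet> \<epsilon>2 = 0" for \<nu> t
  proof (rule zero[OF that(1), of "\<lambda>t. \<nu> \<bullet> y' t" 0 "\<lambda>t. \<nu> \<bullet> y'' t"])
    show "\<nu> \<bullet> y' t = 0" if "t \<in> T" for t
      using s[OF that \<open>\<nu> \<bullet> \<epsilon>1 = 0\<close> \<open>\<nu> \<bullet> \<epsilon>2 = 0\<close>] .
  qed (rule bounded_linear.has_vector_derivative[OF bounded_linear_inner_right d(2)[OF that(1)]])
  have wy: "w t \<bullet> y' t = 0" if t: "t \<in> T" for t
  proof -
    have "w t \<bullet> y' t + y' t \<bullet> w t = 0"
    proof (rule zero[OF t, of "\<lambda>t. w t \<bullet> w t" "\<rho>\<^sup>2" "\<lambda>t. w t \<bullet> y' t + y' t \<bullet> w t"])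
      show "w t \<bullet> w t = \<rho>\<^sup>2" if "t \<in> T" for t using w[OF that] by blast
    qed (rule bounded_bilinear.has_vector_derivative[OF bounded_bilinear_inner dw[OF t] dw[OF t]])
    then show ?thesis by (simp add: inner_commute)
  qed
  have wy2: "w t \<bullet> y'' t + y' t \<bullet> y' t = 0" if t: "t \<in> T" for t
  proof (rule zero[OF t, of "\<lambda>t. w t \<bullet> y' t" 0 "\<lambda>t. w t \<bullet> y'' t + y' t \<bullet> y' t"])
    show "w t \<bullet> y' t = 0" if "t \<in> T" for t by (rule wy[OF that])
  qed (rule bounded_bilinear.has_vector_derivative[OF bounded_bilinear_inner dw[OF t] d(2)[OF t]])
  note pl = in_plane_if_orthogonal[OF \<epsilon>(1-3)]
  have wpl: "w t = (w t \<bullet> \<epsilon>1) *\<^sub>R \<epsilon>1 + (w t \<bullet> \<epsilon>2) *\<^sub>R \<epsilon>2" if "t \<in> T" for t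
    using w[OF that] by (intro pl) blast
  let ?T = "y' t0" and ?w = "w t0"
  have Tpos: "?T \<bullet> ?T > 0" using nz by simp
  have Tpl: "?T = (?T \<bullet> \<epsilon>1) *\<^sub>R \<epsilon>1 + (?T \<bullet> \<epsilon>2) *\<^sub>R \<epsilon>2" using s[OF T(2)] by (rule pl)
  define u1 u2 where "u1 = (1 / \<rho>) *\<^sub>R ?w" and "u2 = (1 / norm ?T) *\<^sub>R ?T"
  have u: "u1 \<bullet> u1 = 1" "u2 \<bullet> u2 = 1" "u1 \<bullet> u2 = 0"
    using w[OF T(2)] wy[OF T(2)] \<rho> nz by (auto simp: u1_def u2_def power2_eq_square dot_square_norm)
  have upl: "u1 = (?w \<bullet> \<epsilon>1 / \<rho>) *\<^sub>R \<epsilon>1 + (?w \<bullet> \<epsilon>2 / \<rho>) *\<^sub>R \<epsilon>2"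
    "u2 = (?T \<bullet> \<epsilon>1 / norm ?T) *\<^sub>R \<epsilon>1 + (?T \<bullet> \<epsilon>2 / norm ?T) *\<^sub>R \<epsilon>2"
    unfolding u1_def u2_def
    by (subst wpl[OF T(2)], simp add: scaleR_add_right) (subst Tpl, simp add: scaleR_add_right)
  have ypl: "y'' t0 = (y'' t0 \<bullet> \<epsilon>1) *\<^sub>R \<epsilon>1 + (y'' t0 \<bullet> \<epsilon>2) *\<^sub>R \<epsilon>2" using s2[OF T(2)] by (rule pl)
  note ex = plane_expand[OF \<epsilon>(1-3) upl _ u]
  have "y'' t0 = (y'' t0 \<bullet> u1) *\<^sub>R u1 + (y'' t0 \<bullet> u2) *\<^sub>R u2" by (rule ex[OF ypl])
  moreover have "y'' t0 \<bullet> u1 = - (?T \<bullet> ?T) / \<rho>"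
  proof -
    have "?w \<bullet> y'' t0 = - (?T \<bullet> ?T)" using wy2[OF T(2)] by linarith
    then show ?thesis by (simp add: u1_def inner_commute[of _ ?w])
  qed
  moreover have "(y'' t0 \<bullet> u2) *\<^sub>R u2 = ((y'' t0 \<bullet> ?T) / (?T \<bullet> ?T)) *\<^sub>R ?T"
    by (simp add: u2_def dot_square_norm power2_eq_square)
  ultimately have "y'' t0 = (- (?T \<bullet> ?T) / \<rho>) *\<^sub>R u1 + ((y'' t0 \<bullet> ?T) / (?T \<bullet> ?T)) *\<^sub>R ?T"
    by metis
  then have K: "K = (- (?T \<bullet> ?T) / \<rho>) *\<^sub>R u1" unfolding K_def by (simp only: diff_eq_eq)
  have nu1: "norm u1 = 1" using u(1) by (simp add: norm_eq_1)
  have nK: "norm K = (?T \<bullet> ?T) / \<rho>" using \<rho> Tpos by (simp add: K nu1)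
  show K0: "K \<noteq> 0" using nK \<rho> Tpos by (auto simp del: inner_gt_zero_iff)
  have r: "r = \<rho>" using nK Tpos by (simp add: r_def)
  have e1: "e1 = u1" using nK \<rho> Tpos by (simp add: e1_def K)
  have e2: "e2 = u2" by (simp add: e2_def u2_def)
  show "e1 \<bullet> e2 = 0" using u e1 e2 by simp
  have c: "c = p" using \<rho> by (simp add: c_def r e1 u1_def w_def)
  fix t assume t: "t \<in> T"
  show "y t - c = ((y t - c) \<bullet> e1) *\<^sub>R e1 + ((y t - c) \<bullet> e2) *\<^sub>R e2"
    unfolding c e1 e2 using ex[OF wpl[OF t]] by (simp add: w_def)
  show "(y t - c) \<bullet> (y t - c) = r\<^sup>2" using w[OF t] by (simp add: w_def c r)
qed

definition circle_family :: "(real \<Rightarrow> C2) \<Rightarrow> (real \<Rightarrow> real) \<Rightarrow> (real \<Rightarrow> C2) \<Rightarrow> (real \<Rightarrow> C2) \<Rightarrow> real \<times> real \<Rightarrow> C2" where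
  "circle_family c r e1 e2 = (\<lambda>(s, \<theta>). c s + (r s * cos \<theta>) *\<^sub>R e1 s + (r s * sin \<theta>) *\<^sub>R e2 s)"

lemma smooth_on_fst:
  assumes "smooth_on {a<..<b::real} f"
  shows "smooth_on ({a<..<b} \<times> UNIV) (\<lambda>x::real \<times> real. f (fst x))"
  using smooth_on_compose_affine[of "{a<..<b}" "{a<..<b} \<times> UNIV" fst 0 f] assms
  by (auto simp: open_Times bounded_linear_fst)

lemma smooth_on_snd: "open S \<Longrightarrow> smooth_on S (snd :: real \<times> real \<Rightarrow> real)"
  by (rule smooth_on_bounded_linear) (auto simp: bounded_linear_snd)

lemma smooth_on_circle_family:
  assumes "smooth_on {a<..<b} c" "smooth_on {a<..<b} r" "smooth_on {a<..<b} e1" "smooth_on {a<..<b} e2"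
  shows "smooth_on ({a<..<b} \<times> UNIV) (circle_family c r e1 e2)"
proof -
  have o: "open ({a<..<b} \<times> (UNIV :: real set))" by (simp add: open_Times)
  note cs = smooth_on_cos_sin[OF o smooth_on_snd[OF o]]
  have "circle_family c r e1 e2 = (\<lambda>x. c (fst x) + (r (fst x) * cos (snd x)) *\<^sub>R e1 (fst x)
      + (r (fst x) * sin (snd x)) *\<^sub>R e2 (fst x))"
    by (auto simp: circle_family_def)
  moreover have "smooth_on ({a<..<b} \<times> UNIV) \<dots>"
    by (intro smooth_on_add[OF o] smooth_on_scaleR[OF o] smooth_on_mult[OF o] smooth_on_fst cs assms)
  ultimately show ?thesis by simp
qed

lemma congruence_id: "congruence (\<lambda>z. z)"
  unfolding congruence_def
  by (rule exI[of _ "\<lambda>z. z"], rule exI[of _ 0]) (auto simp: orthogonal_transformation_def linear_id[unfolded id_def])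

text \<open>Rotating the frame within its plane makes it parallel there; the rotation angle solves
  \<open>\<beta>' = - \<langle>f1', f2\<rangle>\<close>.\<close>

lemma parallel_frame_ex:
  fixes f1 f2 :: "real \<Rightarrow> C2"
  assumes sm: "smooth_on {a<..<b} f1" "smooth_on {a<..<b} f2" and s0: "s0 \<in> {a<..<b}"
    and on: "\<And>s. s \<in> {a<..<b} \<Longrightarrow> f1 s \<bullet> f1 s = 1" "\<And>s. s \<in> {a<..<b} \<Longrightarrow> f2 s \<bullet> f2 s = 1"
      "\<And>s. s \<in> {a<..<b} \<Longrightarrow> f1 s \<bullet> f2 s = 0"
  obtains \<beta> e1 e2 where "\<beta> s0 = 0"
    "e1 = (\<lambda>s. cos (\<beta> s) *\<^sub>R f1 s + sin (\<beta> s) *\<^sub>R f2 s)" "e2 = (\<lambda>s. cos (\<beta> s) *\<^sub>R f2 s - sin (\<beta> s) *\<^sub>R f1 s)"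
    "smooth_on {a<..<b} e1" "smooth_on {a<..<b} e2"
    "\<And>s. s \<in> {a<..<b} \<Longrightarrow> vector_derivative e1 (at s) \<bullet> e2 s = 0"
    "\<And>s. s \<in> {a<..<b} \<Longrightarrow> e1 s \<bullet> e1 s = 1" "\<And>s. s \<in> {a<..<b} \<Longrightarrow> e2 s \<bullet> e2 s = 1"
      "\<And>s. s \<in> {a<..<b} \<Longrightarrow> e1 s \<bullet> e2 s = 0"
proof -
  let ?I = "{a<..<b}"
  have I: "open ?I" by simp
  let ?f1' = "\<lambda>s. vector_derivative f1 (at s)" and ?f2' = "\<lambda>s. vector_derivative f2 (at s)"
  have "smooth_on ?I (\<lambda>s. - (?f1' s \<bullet> f2 s))"
    by (intro smooth_on_minus[OF I] smooth_on_inner[OF I] smooth_on_vector_derivative[OF I] sm)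
  then obtain \<beta> where \<beta>: "smooth_on ?I \<beta>" "\<beta> s0 = 0"
    "\<And>s. s \<in> ?I \<Longrightarrow> (\<beta> has_vector_derivative - (?f1' s \<bullet> f2 s)) (at s)"
    using smooth_primitive_ex[OF _ s0] by blast
  define e1 e2 where "e1 = (\<lambda>s. cos (\<beta> s) *\<^sub>R f1 s + sin (\<beta> s) *\<^sub>R f2 s)" and "e2 = (\<lambda>s. cos (\<beta> s) *\<^sub>R f2 s - sin (\<beta> s) *\<^sub>R f1 s)"
  note cs = smooth_on_cos_sin[OF I \<beta>(1)]
  have sme: "smooth_on ?I e1" "smooth_on ?I e2" unfolding e1_def e2_def
    by (intro smooth_on_add[OF I] smooth_on_diff[OF I] smooth_on_scaleR[OF I] cs sm)+
  have f12: "f2 s \<bullet> f1 s = 0" if "s \<in> ?I" for s using on(3)[OF that] by (simp add: inner_commute)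
  have one: "e1 s \<bullet> e1 s = 1" "e2 s \<bullet> e2 s = 1" "e1 s \<bullet> e2 s = 0" if s: "s \<in> ?I" for s
    using on[OF s] f12[OF s] cos_squared_eq[of "\<beta> s"]
    by (simp_all add: e1_def e2_def inner_add_left inner_add_right inner_diff_left inner_diff_right power2_eq_square)
  have d0: "?f1' s \<bullet> f1 s = 0" "?f2' s \<bullet> f2 s = 0" "?f2' s \<bullet> f1 s = - (?f1' s \<bullet> f2 s)" if s: "s \<in> ?I" for s
  proof -
    note z = derivative_zero_if_constant[OF I s]
    note b = bounded_bilinear.has_vector_derivative[OF bounded_bilinear_inner]
    note h = smooth_on_has_vector_derivative[OF sm(1) s] smooth_on_has_vector_derivative[OF sm(2) s]
    show "?f1' s \<bullet> f1 s = 0" using z[OF on(1) b[OF h(1) h(1)]] by (simp add: inner_commute)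
    show "?f2' s \<bullet> f2 s = 0" using z[OF on(2) b[OF h(2) h(2)]] by (simp add: inner_commute)
    show "?f2' s \<bullet> f1 s = - (?f1' s \<bullet> f2 s)" using z[OF on(3) b[OF h(1) h(2)]] by (simp add: inner_commute)
  qed
  have par: "vector_derivative e1 (at s) \<bullet> e2 s = 0" if s: "s \<in> ?I" for s
  proof -
    let ?\<beta>' = "- (?f1' s \<bullet> f2 s)"
    have dc: "((\<lambda>s. cos (\<beta> s)) has_vector_derivative - sin (\<beta> s) * ?\<beta>') (at s)"
      "((\<lambda>s. sin (\<beta> s)) has_vector_derivative cos (\<beta> s) * ?\<beta>') (at s)"
      using \<beta>(3)[OF s] unfolding has_real_derivative_iff_has_vector_derivative[symmetric]
      by (auto intro!: derivative_eq_intros)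
    have "(e1 has_vector_derivative (cos (\<beta> s) *\<^sub>R ?f1' s + (- sin (\<beta> s) * ?\<beta>') *\<^sub>R f1 s
        + (sin (\<beta> s) *\<^sub>R ?f2' s + (cos (\<beta> s) * ?\<beta>') *\<^sub>R f2 s))) (at s)"
      unfolding e1_def
      by (intro has_vector_derivative_add bounded_bilinear.has_vector_derivative[OF bounded_bilinear_scaleR]
          dc smooth_on_has_vector_derivative[OF sm(1) s] smooth_on_has_vector_derivative[OF sm(2) s])
    then have ve: "vector_derivative e1 (at s) = cos (\<beta> s) *\<^sub>R ?f1' s + (- sin (\<beta> s) * ?\<beta>') *\<^sub>R f1 s
        + (sin (\<beta> s) *\<^sub>R ?f2' s + (cos (\<beta> s) * ?\<beta>') *\<^sub>R f2 s)"
      by (rule vector_derivative_at)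
    define C S where "C = cos (\<beta> s)" and "S = sin (\<beta> s)"
    show ?thesis
      using on[OF s] f12[OF s] d0[OF s] unfolding ve e2_def C_def[symmetric] S_def[symmetric]
      by (simp add: inner_add_left inner_diff_right inner_add_right algebra_simps)
  qed
  show ?thesis by (rule that[of \<beta> e1 e2]) (fact \<beta>(2) e1_def e2_def sme par one)+
qed

lemma polar_coordinates:
  assumes "x > 0"
  shows "sqrt (x\<^sup>2 + y\<^sup>2) * cos (arctan (y / x)) = x" "sqrt (x\<^sup>2 + y\<^sup>2) * sin (arctan (y / x)) = y"
proof -
  have "x\<^sup>2 + y\<^sup>2 = x\<^sup>2 * (1 + (y / x)\<^sup>2)" using assms by (simp add: field_simps power2_eq_square)
  then have r: "sqrt (x\<^sup>2 + y\<^sup>2) = x * sqrt (1 + (y / x)\<^sup>2)" using assms by (simp add: real_sqrt_mult)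
  have "sqrt (1 + (y / x)\<^sup>2) > 0" by (simp add: add_pos_nonneg)
  then show "sqrt (x\<^sup>2 + y\<^sup>2) * cos (arctan (y / x)) = x" "sqrt (x\<^sup>2 + y\<^sup>2) * sin (arctan (y / x)) = y"
    using assms unfolding r cos_arctan sin_arctan by simp_all
qed

text \<open>The centre, the radius and the frame come from the derivatives of the immersion along the curve \<open>t = t0\<close> and
  are smooth for that reason. The coordinate change is \<open>(s, t) \<mapsto> (s, \<theta>)\<close> with \<open>\<theta>\<close> the angle on the circle, which is
  an arcus tangent near the base point; the family of circles is an immersion because it composes
  with this change to the given immersion.\<close>

lemma circle_family_chart_ex:
  assumes lp: "local_param M F ({a<..<b} \<times> {k<..<d}) \<psi>" and st0: "s0 \<in> {a<..<b}" "t0 \<in> {k<..<d}"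
    and circ: "\<And>s. s \<in> {a<..<b} \<Longrightarrow> \<exists>C. round_circle C \<and> (\<forall>t\<in>{k<..<d}. F (\<psi> (s, t)) \<in> C)"
  obtains c r e1 e2 \<xi> \<delta> where "\<delta> > 0" "{s0-\<delta><..<s0+\<delta>} \<subseteq> {a<..<b}"
    "smooth_on {a<..<b} c" "smooth_on {a<..<b} r" "smooth_on {a<..<b} e1" "smooth_on {a<..<b} e2"
    "\<And>s. s \<in> {a<..<b} \<Longrightarrow> r s > 0"
    "\<And>s. s \<in> {a<..<b} \<Longrightarrow> e1 s \<bullet> e1 s = 1" "\<And>s. s \<in> {a<..<b} \<Longrightarrow> e2 s \<bullet> e2 s = 1"
    "\<And>s. s \<in> {a<..<b} \<Longrightarrow> e1 s \<bullet> e2 s = 0"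
    "\<And>s. s \<in> {a<..<b} \<Longrightarrow> vector_derivative e1 (at s) \<bullet> e2 s = 0"
    "local_param M F ({s0-\<delta><..<s0+\<delta>} \<times> {-\<delta><..<\<delta>}) \<xi>" "\<xi> (s0, 0) = \<psi> (s0, t0)"
    "\<And>x. x \<in> {s0-\<delta><..<s0+\<delta>} \<times> {-\<delta><..<\<delta>} \<Longrightarrow> F (\<xi> x) = circle_family c r e1 e2 x"
proof -
  let ?I = "{a<..<b}" and ?T = "{k<..<d}"
  let ?R = "?I \<times> ?T"
  have I: "open ?I" and R: "open ?R" by (simp_all add: open_Times)
  define Y where "Y = F \<circ> \<psi>"
  have smY: "smooth_on ?R Y" and injY: "\<And>x. x \<in> ?R \<Longrightarrow> inj (frechet_derivative Y (at x))"
    using lp unfolding local_param_def Y_def by blast+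
  define Yt where "Yt x = frechet_derivative Y (at x) (0, 1)" for x
  define Ytt where "Ytt x = frechet_derivative Yt (at x) (0, 1)" for x
  have smYt: "smooth_on ?R Yt" unfolding Yt_def by (rule smooth_on_frechet_derivative[OF smY])
  have smYtt: "smooth_on ?R Ytt" unfolding Ytt_def by (rule smooth_on_frechet_derivative[OF smYt])
  have line: "((\<lambda>t. G (s, t)) has_vector_derivative frechet_derivative G (at (s, t)) (0, 1)) (at t)"
    if "smooth_on ?R G" "(s, t) \<in> ?R" for G :: "real \<times> real \<Rightarrow> C2" and s t
  proof -
    have G: "(G has_derivative frechet_derivative G (at (s, t))) (at (s, t))"
      by (rule smooth_on_has_derivative[OF that])
    have "((\<lambda>t. (s, t)) has_derivative (\<lambda>h. (0, h))) (at t)"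
      by (auto intro!: derivative_eq_intros)
    from has_derivative_compose[OF this G]
    have "((\<lambda>t. G (s, t)) has_derivative (\<lambda>h. frechet_derivative G (at (s, t)) (0, h))) (at t)" .
    moreover have "(\<lambda>h. frechet_derivative G (at (s, t)) (0, h)) = (\<lambda>h. h *\<^sub>R frechet_derivative G (at (s, t)) (0, 1))"
    proof
      fix h
      show "frechet_derivative G (at (s, t)) (0, h) = h *\<^sub>R frechet_derivative G (at (s, t)) (0, 1)"
        using linear_scale[OF has_derivative_linear[OF G], of h "(0, 1)"] by simp
    qed
    ultimately show ?thesis unfolding has_vector_derivative_def by (simp only:)
  qed
  have slice: "smooth_on ?I (\<lambda>s. G (s, t0))" if "smooth_on ?R G" for G :: "real \<times> real \<Rightarrow> C2"
  proof -
    have "bounded_linear (\<lambda>s::real. (s, 0::real))"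
      by (rule bounded_linear_Pair[OF bounded_linear_ident bounded_linear_zero])
    from smooth_on_compose_affine[OF R I this _ that, of "(0, t0)"] st0 show ?thesis by simp
  qed
  have Ynz: "Yt (s, t0) \<noteq> 0" if "s \<in> ?I" for s
  proof
    assume "Yt (s, t0) = 0"
    moreover have "linear (frechet_derivative Y (at (s, t0)))"
      using smooth_on_has_derivative[OF smY] has_derivative_linear that st0 by blast
    ultimately have "frechet_derivative Y (at (s, t0)) (0, 1) = frechet_derivative Y (at (s, t0)) 0"
      by (simp add: Yt_def linear_0)
    moreover have "inj (frechet_derivative Y (at (s, t0)))" using injY that st0 by blast
    ultimately have "(0::real, 1::real) = 0" by (rule injD[rotated])
    then show False by (simp add: zero_prod_def)
  qed
  define K where "K s = Ytt (s, t0) - ((Ytt (s, t0) \<bullet> Yt (s, t0)) / (Yt (s, t0) \<bullet> Yt (s, t0))) *\<^sub>R Yt (s, t0)" for s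
  define r where "r s = (Yt (s, t0) \<bullet> Yt (s, t0)) / norm (K s)" for s
  define f1 where "f1 s = - (1 / norm (K s)) *\<^sub>R K s" for s
  define f2 where "f2 s = (1 / norm (Yt (s, t0))) *\<^sub>R Yt (s, t0)" for s
  define c where "c s = Y (s, t0) - r s *\<^sub>R f1 s" for s
  have cfc: "K s \<noteq> 0" "f1 s \<bullet> f2 s = 0"
    "\<And>t. t \<in> ?T \<Longrightarrow> Y (s, t) - c s = ((Y (s, t) - c s) \<bullet> f1 s) *\<^sub>R f1 s + ((Y (s, t) - c s) \<bullet> f2 s) *\<^sub>R f2 s"
    "\<And>t. t \<in> ?T \<Longrightarrow> (Y (s, t) - c s) \<bullet> (Y (s, t) - c s) = (r s)\<^sup>2" if s: "s \<in> ?I" for s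
  proof -
    obtain C where C: "round_circle C" "\<And>t. t \<in> ?T \<Longrightarrow> Y (s, t) \<in> C"
      using circ[OF s] unfolding Y_def by auto
    have d: "((\<lambda>t. Y (s, t)) has_vector_derivative Yt (s, t)) (at t)"
      "((\<lambda>t. Yt (s, t)) has_vector_derivative Ytt (s, t)) (at t)" if "t \<in> ?T" for t
      unfolding Ytt_def using line[OF smY, of s t] line[OF smYt, of s t] s that by (auto simp: Yt_def)
    note cf = circle_from_curvature[OF C _ st0(2) d Ynz[OF s], folded K_def, folded r_def f1_def f2_def, folded c_def]
    show "K s \<noteq> 0" "f1 s \<bullet> f2 s = 0"
    "\<And>t. t \<in> ?T \<Longrightarrow> Y (s, t) - c s = ((Y (s, t) - c s) \<bullet> f1 s) *\<^sub>R f1 s + ((Y (s, t) - c s) \<bullet> f2 s) *\<^sub>R f2 s"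
    "\<And>t. t \<in> ?T \<Longrightarrow> (Y (s, t) - c s) \<bullet> (Y (s, t) - c s) = (r s)\<^sup>2"
      by (rule cf; simp)+
  qed
  have rpos: "r s > 0" if "s \<in> ?I" for s unfolding r_def using cfc(1)[OF that] Ynz[OF that] by simp
  have f11: "f1 s \<bullet> f1 s = 1" "f2 s \<bullet> f2 s = 1" if "s \<in> ?I" for s
    using cfc(1)[OF that] Ynz[OF that] by (simp_all add: f1_def f2_def dot_square_norm power2_eq_square)
  note sl = slice[OF smY] slice[OF smYt] slice[OF smYtt]
  have smK: "smooth_on ?I K" unfolding K_def
    by (intro smooth_on_diff[OF I] smooth_on_scaleR[OF I] smooth_on_divide[OF I] smooth_on_inner[OF I] sl) (use Ynz in auto)
  have smr: "smooth_on ?I r" unfolding r_def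
    by (intro smooth_on_divide[OF I] smooth_on_inner[OF I] smooth_on_norm[OF I] sl smK) (use cfc(1) in auto)
  have smf1: "smooth_on ?I f1" unfolding f1_def
    by (intro smooth_on_scaleR[OF I] smooth_on_divide[OF I] smooth_on_minus[OF I] smooth_on_norm[OF I] smK smooth_on_const) (use cfc(1) in auto)
  have smf2: "smooth_on ?I f2" unfolding f2_def
    by (intro smooth_on_scaleR[OF I] smooth_on_divide[OF I] smooth_on_norm[OF I] sl smooth_on_const) (use Ynz in auto)
  have smc: "smooth_on ?I c" unfolding c_def
    by (intro smooth_on_diff[OF I] smooth_on_scaleR[OF I] smr smf1 sl)
  obtain \<beta> e1 e2 where e: "\<beta> s0 = 0"
    "e1 = (\<lambda>s. cos (\<beta> s) *\<^sub>R f1 s + sin (\<beta> s) *\<^sub>R f2 s)" "e2 = (\<lambda>s. cos (\<beta> s) *\<^sub>R f2 s - sin (\<beta> s) *\<^sub>R f1 s)"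
    and sme: "smooth_on ?I e1" "smooth_on ?I e2"
    and par: "\<And>s. s \<in> {a<..<b} \<Longrightarrow> vector_derivative e1 (at s) \<bullet> e2 s = 0"
    and on: "\<And>s. s \<in> {a<..<b} \<Longrightarrow> e1 s \<bullet> e1 s = 1" "\<And>s. s \<in> {a<..<b} \<Longrightarrow> e2 s \<bullet> e2 s = 1"
      "\<And>s. s \<in> {a<..<b} \<Longrightarrow> e1 s \<bullet> e2 s = 0"
    using parallel_frame_ex[OF smf1 smf2 st0(1) f11 cfc(2)] by blast
  have ex: "Y (s, t) - c s = ((Y (s, t) - c s) \<bullet> e1 s) *\<^sub>R e1 s + ((Y (s, t) - c s) \<bullet> e2 s) *\<^sub>R e2 s"
    if s: "s \<in> ?I" "t \<in> ?T" for s t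
    by (rule plane_expand[where ?x1.0 = "cos (\<beta> s)" and ?x2.0 = "sin (\<beta> s)" and ?y1.0 = "- sin (\<beta> s)" and ?y2.0 = "cos (\<beta> s)",
        OF f11[OF s(1)] cfc(2)[OF s(1)] _ _ cfc(3)[OF s] on[OF s(1)]])
      (simp_all add: e(2,3))
  define w1 w2 where "w1 x = (Y x - c (fst x)) \<bullet> e1 (fst x)" and "w2 x = (Y x - c (fst x)) \<bullet> e2 (fst x)" for x
  have w2sum: "(w1 x)\<^sup>2 + (w2 x)\<^sup>2 = (r (fst x))\<^sup>2" if x: "x \<in> ?R" for x
  proof -
    obtain s t where st: "x = (s, t)" "s \<in> ?I" "t \<in> ?T" using x by auto
    have "(r s)\<^sup>2 = (Y x - c s) \<bullet> (Y x - c s)" using cfc(4)[OF st(2,3)] st by simp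
    also have "\<dots> = (Y x - c s) \<bullet> (w1 x *\<^sub>R e1 s + w2 x *\<^sub>R e2 s)"
      using ex[OF st(2,3)] by (simp add: w1_def w2_def st)
    also have "\<dots> = (w1 x)\<^sup>2 + (w2 x)\<^sup>2" by (simp add: inner_add_right w1_def w2_def st power2_eq_square)
    finally show ?thesis by (simp add: st)
  qed
  note sub = smooth_on_subset[OF smooth_on_fst, of _ _ _ ?R]
  have smw: "smooth_on ?R w1" "smooth_on ?R w2" unfolding w1_def w2_def
    by (intro smooth_on_inner[OF R] smooth_on_diff[OF R] smY sub[OF smc] sub[OF sme(1)] sub[OF sme(2)]; auto)+
  define N where "N = {x \<in> ?R. w1 x > 0}"
  have N: "open N" unfolding N_def
    using continuous_open_preimage[OF smooth_on_continuous[OF smw(1)] R open_greaterThan[of 0]]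
    by (simp add: vimage_def Int_def)
  have NR: "N \<subseteq> ?R" unfolding N_def by blast
  have "w1 (s0, t0) = r s0"
    using f11(1)[OF st0(1)] by (simp add: w1_def c_def e)
  then have x0N: "(s0, t0) \<in> N" using st0 rpos[OF st0(1)] by (auto simp: N_def)
  have w20: "w2 (s0, t0) = 0" using cfc(2)[OF st0(1)] by (simp add: w2_def c_def e)
  define \<Theta> where "\<Theta> x = (fst x, arctan (w2 x / w1 x))" for x
  define X where "X = circle_family c r e1 e2"
  let ?D = "?I \<times> (UNIV :: real set)"
  have smX: "smooth_on ?D X" unfolding X_def by (rule smooth_on_circle_family[OF smc smr sme])
  have D: "open ?D" by (simp add: open_Times)
  have YX: "Y x = X (\<Theta> x)" if x: "x \<in> N" for x
  proof -
    obtain s t where st: "x = (s, t)" "s \<in> ?I" "t \<in> ?T" and w1: "w1 x > 0" using x by (auto simp: N_def)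
    have xR: "x \<in> ?R" using st by simp
    have rs: "r s = sqrt ((w1 x)\<^sup>2 + (w2 x)\<^sup>2)" using w2sum[OF xR] rpos[OF st(2)] st by simp
    note cs = polar_coordinates[OF w1, of "w2 x", folded rs]
    have "X (\<Theta> x) = c s + w1 x *\<^sub>R e1 s + w2 x *\<^sub>R e2 s"
      by (simp add: X_def circle_family_def \<Theta>_def st(1)[symmetric] cs) (simp add: st(1) cs[unfolded st(1)])
    also have "\<dots> = c s + (Y (s, t) - c s)"
      by (subst ex[OF st(2,3)]) (simp add: st(1) w1_def w2_def)
    finally show ?thesis by (simp add: st(1))
  qed
  have d\<Theta>: "\<Theta> differentiable (at x)" if x: "x \<in> N" for x
  proof -
    have "w1 differentiable (at x)" "w2 differentiable (at x)"
      using smooth_on_differentiable[OF smw(1)] smooth_on_differentiable[OF smw(2)] x NR by auto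
    then have "(\<lambda>x. w2 x / w1 x) differentiable (at x)" using x by (intro differentiable_divide) (auto simp: N_def)
    then obtain q where q: "((\<lambda>x. w2 x / w1 x) has_derivative q) (at x)" by (auto simp: differentiable_def)
    have "((\<lambda>x. arctan (w2 x / w1 x)) has_derivative (\<lambda>v. q v * inverse (1 + (w2 x / w1 x)\<^sup>2))) (at x)"
      by (rule DERIV_compose_FDERIV[OF DERIV_arctan q])
    then have "(\<Theta> has_derivative (\<lambda>v. (fst v, q v * inverse (1 + (w2 x / w1 x)\<^sup>2)))) (at x)"
      unfolding \<Theta>_def by (intro has_derivative_Pair) (auto intro!: derivative_eq_intros)
    then show ?thesis by (auto simp: differentiable_def)
  qed
  have cont: "continuous_on N \<Theta>"
    using d\<Theta> by (intro continuous_at_imp_continuous_on ballI differentiable_imp_continuous_within)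
  have \<Theta>D: "\<Theta> ` N \<subseteq> ?D" using NR by (auto simp: \<Theta>_def)
  have imm: "inj (frechet_derivative X (at (\<Theta> x)))" if x: "x \<in> N" for x
  proof -
    let ?A = "frechet_derivative X (at (\<Theta> x))" and ?B = "frechet_derivative \<Theta> (at x)"
    have "(X has_derivative ?A) (at (\<Theta> x))"
      using smooth_on_has_derivative[OF smX] \<Theta>D x by blast
    moreover have dB: "(\<Theta> has_derivative ?B) (at x)" using d\<Theta>[OF x] frechet_derivative_works by blast
    ultimately have "((\<lambda>x. X (\<Theta> x)) has_derivative (\<lambda>v. ?A (?B v))) (at x)"
      by (rule has_derivative_compose[rotated])
    then have "(Y has_derivative (\<lambda>v. ?A (?B v))) (at x)"
      by (rule has_derivative_transform_within_open[OF _ N x]) (simp add: YX)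
    then have fY: "frechet_derivative Y (at x) = (\<lambda>v. ?A (?B v))" using frechet_derivative_at by metis
    have i: "inj (\<lambda>v. ?A (?B v))" using injY[of x] x NR fY by auto
    then have "inj ?B" by (simp add: inj_def) metis
    then have "surj ?B" using linear_injective_imp_surjective has_derivative_linear[OF dB] by blast
    then show ?thesis using i unfolding inj_def surj_def by metis
  qed
  obtain W \<xi> where W: "local_param M F W \<xi>" "\<Theta> (s0, t0) \<in> W" "\<xi> (\<Theta> (s0, t0)) = \<psi> (s0, t0)" "W \<subseteq> ?D"
    "\<And>y. y \<in> W \<Longrightarrow> F (\<xi> y) = X y"
  proof (rule chart_change[OF lp N x0N NR cont \<Theta>D D smX imm congruence_id])
    show "F (\<psi> x) = X (\<Theta> x)" if "x \<in> N" for x using YX[OF that] by (simp add: Y_def)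
  qed (assumption, elim that)
  have \<Theta>0: "\<Theta> (s0, t0) = (s0, 0)" by (simp add: \<Theta>_def w20)
  have "open W" using W(1) unfolding local_param_def by blast
  then obtain A B where AB: "open A" "open B" "s0 \<in> A" "0 \<in> B" "A \<times> B \<subseteq> W"
    using W(2) unfolding \<Theta>0 by (elim open_prod_elim) auto
  obtain \<epsilon>1 \<epsilon>2 where \<epsilon>: "\<epsilon>1 > 0" "ball s0 \<epsilon>1 \<subseteq> A" "\<epsilon>2 > 0" "ball 0 \<epsilon>2 \<subseteq> B"
    using AB openE by metis
  define \<delta> where "\<delta> = min \<epsilon>1 \<epsilon>2"
  have sub: "{s0-\<delta><..<s0+\<delta>} \<times> {-\<delta><..<\<delta>} \<subseteq> W"
    using \<epsilon>(2,4) AB(5) by (force simp: \<delta>_def subset_eq dist_real_def)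
  have \<delta>: "\<delta> > 0" using \<epsilon> by (simp add: \<delta>_def)
  have "{s0-\<delta><..<s0+\<delta>} \<subseteq> ?I"
  proof
    fix s assume "s \<in> {s0-\<delta><..<s0+\<delta>}"
    then have "(s, 0) \<in> W" using sub \<delta> by (auto simp: subset_eq)
    then show "s \<in> ?I" using W(4) by blast
  qed
  moreover have "local_param M F ({s0-\<delta><..<s0+\<delta>} \<times> {-\<delta><..<\<delta>}) \<xi>"
    by (rule local_param_subset[OF W(1) _ sub]) (simp add: open_Times)
  moreover have "\<xi> (s0, 0) = \<psi> (s0, t0)" using W(3) \<Theta>0 by simp
  moreover have "F (\<xi> x) = circle_family c r e1 e2 x" if "x \<in> {s0-\<delta><..<s0+\<delta>} \<times> {-\<delta><..<\<delta>}" for x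
    using W(5)[OF subsetD[OF sub that]] by (simp add: X_def)
  ultimately show ?thesis
    using \<delta> smc smr sme rpos on par by (intro that[of \<delta> c r e1 e2 \<xi>])
qed

section \<open>Trigonometric polynomials\<close>

text \<open>Multiplication by a power of \<open>cis \<theta>\<close> clears the negative frequencies.\<close>

definition trig_poly :: "(real \<Rightarrow> real) \<Rightarrow> bool" where
  "trig_poly f \<longleftrightarrow> (\<exists>n p. \<forall>\<theta>. complex_of_real (f \<theta>) * cis \<theta> ^ n = poly p (cis \<theta>))"

lemma trig_poly_const [intro]: "trig_poly (\<lambda>\<theta>. k)"
  unfolding trig_poly_def by (rule exI[of _ 0], rule exI[of _ "[:complex_of_real k:]"]) simp

lemma trig_poly_cos [intro]: "trig_poly cos"
  unfolding trig_poly_def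
proof (rule exI[of _ "1::nat"], rule exI[of _ "[:1/2, 0, 1/2:]"], rule allI)
  fix \<theta> :: real
  have "1 + cis \<theta> * cis \<theta> = complex_of_real (2 * cos \<theta>) * cis \<theta>"
    by (simp add: complex_eq_iff cis.ctr) (metis cos_squared_eq power2_eq_square add_diff_cancel_left' diff_add_cancel mult_2)
  then show "complex_of_real (cos \<theta>) * cis \<theta> ^ 1 = poly [:1/2, 0, 1/2:] (cis \<theta>)"
    by (simp add: add_divide_distrib[symmetric])
qed

lemma trig_poly_sin [intro]: "trig_poly sin"
  unfolding trig_poly_def
proof (rule exI[of _ "1::nat"], rule exI[of _ "[:\<i>/2, 0, -\<i>/2:]"], rule allI)
  fix \<theta> :: real
  have "1 - cis \<theta> * cis \<theta> = - 2 * \<i> * complex_of_real (sin \<theta>) * cis \<theta>"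
  proof (rule complex_eqI)
    have s: "1 - cos \<theta> * cos \<theta> = sin \<theta> * sin \<theta>" using sin_cos_squared_add3[of \<theta>] by linarith
    show "Re (1 - cis \<theta> * cis \<theta>) = Re (- 2 * \<i> * complex_of_real (sin \<theta>) * cis \<theta>)" by (simp add: s)
  qed simp
  then have "\<i> * (1 - cis \<theta> * cis \<theta>) = 2 * complex_of_real (sin \<theta>) * cis \<theta>"
    using i_squared by algebra
  then show "complex_of_real (sin \<theta>) * cis \<theta> ^ 1 = poly [:\<i>/2, 0, -\<i>/2:] (cis \<theta>)"
    by (simp add: field_simps eq_diff_eq[symmetric])
qed

lemma trig_poly_mult [intro]:
  assumes "trig_poly f" "trig_poly g"
  shows "trig_poly (\<lambda>\<theta>. f \<theta> * g \<theta>)"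
proof -
  obtain n p m q where "\<And>\<theta>. complex_of_real (f \<theta>) * cis \<theta> ^ n = poly p (cis \<theta>)"
    "\<And>\<theta>. complex_of_real (g \<theta>) * cis \<theta> ^ m = poly q (cis \<theta>)"
    using assms unfolding trig_poly_def by blast
  then have "complex_of_real (f \<theta> * g \<theta>) * cis \<theta> ^ (n + m) = poly (p * q) (cis \<theta>)" for \<theta>
    by (simp add: power_add algebra_simps) (metis mult.assoc mult.commute)
  then show ?thesis unfolding trig_poly_def by blast
qed

lemma trig_poly_add [intro]:
  assumes "trig_poly f" "trig_poly g"
  shows "trig_poly (\<lambda>\<theta>. f \<theta> + g \<theta>)"
proof -
  obtain n p m q where pq: "\<And>\<theta>. complex_of_real (f \<theta>) * cis \<theta> ^ n = poly p (cis \<theta>)"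
    "\<And>\<theta>. complex_of_real (g \<theta>) * cis \<theta> ^ m = poly q (cis \<theta>)"
    using assms unfolding trig_poly_def by blast
  have "complex_of_real (f \<theta> + g \<theta>) * cis \<theta> ^ (n + m) = poly (p * monom 1 m + q * monom 1 n) (cis \<theta>)" for \<theta>
    by (simp add: power_add distrib_right poly_monom pq[symmetric] mult.assoc mult.commute[of "cis \<theta> ^ n"])
  then show ?thesis unfolding trig_poly_def by blast
qed

lemma trig_poly_minus [intro]: "trig_poly f \<Longrightarrow> trig_poly (\<lambda>\<theta>. - f \<theta>)"
  using trig_poly_mult[OF trig_poly_const[of "-1"], of f] by simp

lemma trig_poly_diff [intro]: "trig_poly f \<Longrightarrow> trig_poly g \<Longrightarrow> trig_poly (\<lambda>\<theta>. f \<theta> - g \<theta>)"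
  using trig_poly_add[OF _ trig_poly_minus, of f g] by simp

lemma trig_poly_power2 [intro]: "trig_poly f \<Longrightarrow> trig_poly (\<lambda>\<theta>. (f \<theta>)\<^sup>2)"
  unfolding power2_eq_square by (rule trig_poly_mult)

text \<open>The polynomial attached to a trigonometric polynomial that vanishes on an arc has infinitely many
  roots, so it is zero. This is what makes an arc of each leaf as good as the whole circle.\<close>

lemma trig_poly_eq_0:
  assumes "trig_poly f" "\<delta> > 0" "\<And>\<theta>. \<bar>\<theta>\<bar> < \<delta> \<Longrightarrow> f \<theta> = 0"
  shows "f \<theta> = 0"
proof -
  obtain n p where np: "\<And>\<theta>. complex_of_real (f \<theta>) * cis \<theta> ^ n = poly p (cis \<theta>)"
    using assms(1) unfolding trig_poly_def by blast
  define \<epsilon> where "\<epsilon> = min \<delta> pi"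
  have \<epsilon>: "\<epsilon> > 0" "\<epsilon> \<le> \<delta>" "\<epsilon> \<le> pi" using assms(2) pi_gt_zero by (auto simp: \<epsilon>_def)
  have inj: "inj_on cis {0<..<\<epsilon>}"
  proof (rule inj_onI)
    fix x y assume xy: "x \<in> {0<..<\<epsilon>}" "y \<in> {0<..<\<epsilon>}" "cis x = cis y"
    then have "cos x = cos y" by (metis cis.sel(1))
    then show "x = y" using xy \<epsilon> cos_inj_pi[of x y] by auto
  qed
  have "infinite (cis ` {0<..<\<epsilon>})"
    using finite_imageD[OF _ inj] infinite_Ioo[OF \<epsilon>(1)] by blast
  moreover have "cis ` {0<..<\<epsilon>} \<subseteq> {z. poly p z = 0}"
  proof
    fix z assume "z \<in> cis ` {0<..<\<epsilon>}"
    then obtain t where "z = cis t" "0 < t" "t < \<epsilon>" by auto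
    then show "z \<in> {z. poly p z = 0}" using np[of t] assms(3)[of t] \<epsilon> by simp
  qed
  ultimately have "p = 0" using poly_roots_finite finite_subset by blast
  then show ?thesis using np[of \<theta>] by simp
qed

definition trig_vec :: "C2 \<Rightarrow> C2 \<Rightarrow> C2 \<Rightarrow> real \<Rightarrow> C2" where
  "trig_vec A B C \<theta> = A + cos \<theta> *\<^sub>R B + sin \<theta> *\<^sub>R C"

lemma trig_poly_trig_vec_inner [intro]:
  "trig_poly (\<lambda>\<theta>. trig_vec A B C \<theta> \<bullet> trig_vec A' B' C' \<theta>)"
  unfolding trig_vec_def inner_add_left inner_add_right inner_scaleR_left inner_scaleR_right
  by (intro trig_poly_add trig_poly_mult trig_poly_const trig_poly_cos trig_poly_sin)

lemma J_trig_vec: "J (trig_vec A B C \<theta>) = trig_vec (J A) (J B) (J C) \<theta>"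
  by (simp add: trig_vec_def)

section \<open>The equations along one circle\<close>

lemma orthonormal_frame_expand:
  fixes e1 e2 f1 f2 z :: C2
  assumes n: "e1 \<bullet> e1 = 1" "e2 \<bullet> e2 = 1" "f1 \<bullet> f1 = 1" "f2 \<bullet> f2 = 1"
    and o: "e1 \<bullet> e2 = 0" "e1 \<bullet> f1 = 0" "e1 \<bullet> f2 = 0" "e2 \<bullet> f1 = 0" "e2 \<bullet> f2 = 0" "f1 \<bullet> f2 = 0"
  shows "z = (z \<bullet> e1) *\<^sub>R e1 + (z \<bullet> e2) *\<^sub>R e2 + (z \<bullet> f1) *\<^sub>R f1 + (z \<bullet> f2) *\<^sub>R f2"
proof -
  let ?B = "{e1, e2, f1, f2}"
  have o': "e2 \<bullet> e1 = 0" "f1 \<bullet> e1 = 0" "f2 \<bullet> e1 = 0" "f1 \<bullet> e2 = 0" "f2 \<bullet> e2 = 0" "f2 \<bullet> f1 = 0"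
    using o by (simp_all add: inner_commute)
  have neq: "e1 \<noteq> e2" "e1 \<noteq> f1" "e1 \<noteq> f2" "e2 \<noteq> f1" "e2 \<noteq> f2" "f1 \<noteq> f2" using n o by auto
  have "independent ?B"
  proof (rule pairwise_orthogonal_independent)
    show "pairwise orthogonal ?B" using o o' unfolding pairwise_def orthogonal_def by blast
    show "0 \<notin> ?B" using n by (metis inner_zero_left insertE singletonD zero_neq_one)
  qed
  moreover have "card ?B = 4" using neq by simp
  ultimately have "UNIV \<subseteq> span ?B"
    by (intro card_ge_dim_independent) auto
  define w where "w = z - ((z \<bullet> e1) *\<^sub>R e1 + (z \<bullet> e2) *\<^sub>R e2 + (z \<bullet> f1) *\<^sub>R f1 + (z \<bullet> f2) *\<^sub>R f2)"
  have "w \<bullet> e1 = 0" "w \<bullet> e2 = 0" "w \<bullet> f1 = 0" "w \<bullet> f2 = 0"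
    unfolding w_def by (simp_all add: inner_diff_left inner_add_left n o o')
  then have "orthogonal w x" if "x \<in> ?B" for x using that unfolding orthogonal_def by blast
  then have "orthogonal w w" using orthogonal_to_span[of w ?B w] \<open>UNIV \<subseteq> span ?B\<close> by blast
  then show ?thesis unfolding w_def by (simp add: orthogonal_def)
qed

text \<open>Coordinates with respect to an orthonormal basis in which \<open>J\<close> has the shape it takes when
  \<open>e1, e2\<close> span a plane of Kaehler angle with cosine \<open>w\<close> and sine \<open>\<sigma>\<close>.\<close>

definition "vec4 e1 e2 f1 f2 z1 z2 z3 z4 = z1 *\<^sub>R e1 + z2 *\<^sub>R e2 + z3 *\<^sub>R f1 + z4 *\<^sub>R (f2 :: C2)"

locale kaehler_frame =
  fixes e1 e2 f1 f2 :: C2 and w \<sigma> :: real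
  assumes e: "e1 \<bullet> e1 = 1" "e2 \<bullet> e2 = 1" "e1 \<bullet> e2 = 0" and w: "w = e1 \<bullet> J e2" "\<bar>w\<bar> < 1"
    and \<sigma>_def: "\<sigma> = sqrt (1 - w\<^sup>2)"
    and f_def: "f1 = (1 / \<sigma>) *\<^sub>R (J e1 + w *\<^sub>R e2)" "f2 = (1 / \<sigma>) *\<^sub>R (J e2 - w *\<^sub>R e1)"
begin

abbreviation "v4 \<equiv> vec4 e1 e2 f1 f2"

lemma \<sigma>: "\<sigma> > 0" "\<sigma> * \<sigma> = 1 - w * w"
proof -
  have "w\<^sup>2 < 1" using w(2) by (simp add: abs_square_less_1)
  then show "\<sigma> > 0" "\<sigma> * \<sigma> = 1 - w * w" by (simp_all add: \<sigma>_def power2_eq_square)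
qed

lemma Je: "J e1 = \<sigma> *\<^sub>R f1 - w *\<^sub>R e2" "J e2 = \<sigma> *\<^sub>R f2 + w *\<^sub>R e1"
  using \<sigma>(1) by (simp_all add: f_def)

lemma inners:
  "e1 \<bullet> e1 = 1" "e2 \<bullet> e2 = 1" "f1 \<bullet> f1 = 1" "f2 \<bullet> f2 = 1"
  "e1 \<bullet> e2 = 0" "e1 \<bullet> f1 = 0" "e1 \<bullet> f2 = 0" "e2 \<bullet> f1 = 0" "e2 \<bullet> f2 = 0" "f1 \<bullet> f2 = 0"
  "e2 \<bullet> e1 = 0" "f1 \<bullet> e1 = 0" "f2 \<bullet> e1 = 0" "f1 \<bullet> e2 = 0" "f2 \<bullet> e2 = 0" "f2 \<bullet> f1 = 0"
proof -
  have a: "e2 \<bullet> e1 = 0" "J e1 \<bullet> e2 = - w" "e2 \<bullet> J e1 = - w" "J e2 \<bullet> e1 = w" "e1 \<bullet> J e2 = w"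
    using e(3) w(1) inner_J_left[of e1 e2] inner_J_left[of e2 e1] inner_commute[of "J e2" e1] inner_commute[of e2 e1]
    by linarith+
  have n: "(J e1 + w *\<^sub>R e2) \<bullet> (J e1 + w *\<^sub>R e2) = 1 - w * w" "(J e2 - w *\<^sub>R e1) \<bullet> (J e2 - w *\<^sub>R e1) = 1 - w * w"
    by (simp_all add: inner_add_left inner_add_right inner_diff_left inner_diff_right e a)
  show "f1 \<bullet> f1 = 1" "f2 \<bullet> f2 = 1"
    using \<sigma>(1) n unfolding \<sigma>(2)[symmetric] by (simp_all add: f_def)
  show ef: "e1 \<bullet> f1 = 0" "e1 \<bullet> f2 = 0" "e2 \<bullet> f1 = 0" "e2 \<bullet> f2 = 0" "f1 \<bullet> f2 = 0"
    by (simp_all add: f_def inner_add_left inner_add_right inner_diff_left inner_diff_right e a)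
  then show "f1 \<bullet> e1 = 0" "f2 \<bullet> e1 = 0" "f1 \<bullet> e2 = 0" "f2 \<bullet> e2 = 0" "f2 \<bullet> f1 = 0"
    by (simp_all add: inner_commute)
  show "e1 \<bullet> e1 = 1" "e2 \<bullet> e2 = 1" "e1 \<bullet> e2 = 0" "e2 \<bullet> e1 = 0" by (rule e a)+
qed

lemma Jf: "J f1 = w *\<^sub>R f2 - \<sigma> *\<^sub>R e1" "J f2 = - \<sigma> *\<^sub>R e2 - w *\<^sub>R f1"
proof -
  have "\<sigma> *\<^sub>R J f1 = J (\<sigma> *\<^sub>R f1)" by simp
  also have "\<sigma> *\<^sub>R f1 = J e1 + w *\<^sub>R e2" using Je(1) by simp
  also have "J \<dots> = - ((\<sigma> * \<sigma>) *\<^sub>R e1) + (w * \<sigma>) *\<^sub>R f2" unfolding \<sigma>(2) by (simp add: Je(2) algebra_simps)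
  also have "\<dots> = \<sigma> *\<^sub>R (w *\<^sub>R f2 - \<sigma> *\<^sub>R e1)" by (simp add: algebra_simps)
  finally show "J f1 = w *\<^sub>R f2 - \<sigma> *\<^sub>R e1" using \<sigma>(1) by simp
  have "\<sigma> *\<^sub>R J f2 = J (\<sigma> *\<^sub>R f2)" by simp
  also have "\<sigma> *\<^sub>R f2 = J e2 - w *\<^sub>R e1" using Je(2) by simp
  also have "J \<dots> = - ((\<sigma> * \<sigma>) *\<^sub>R e2) - (w * \<sigma>) *\<^sub>R f1" unfolding \<sigma>(2) by (simp add: Je(1) algebra_simps)
  also have "\<dots> = \<sigma> *\<^sub>R (- \<sigma> *\<^sub>R e2 - w *\<^sub>R f1)" by (simp add: algebra_simps)
  finally show "J f2 = - \<sigma> *\<^sub>R e2 - w *\<^sub>R f1" using \<sigma>(1) by (simp del: scaleR_right_diff_distrib)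
qed

lemma expand: "z = v4 (z \<bullet> e1) (z \<bullet> e2) (z \<bullet> f1) (z \<bullet> f2)"
  unfolding vec4_def by (rule orthonormal_frame_expand) (fact inners)+

lemma v4_inner: "v4 a1 a2 a3 a4 \<bullet> v4 b1 b2 b3 b4 = a1 * b1 + a2 * b2 + a3 * b3 + a4 * b4"
  unfolding vec4_def by (simp add: inner_add_left inner_add_right inners)

lemma v4_J: "J (v4 b1 b2 b3 b4) = v4 (w * b2 - \<sigma> * b3) (- w * b1 - \<sigma> * b4) (\<sigma> * b1 - w * b4) (\<sigma> * b2 + w * b3)"
  unfolding vec4_def by (simp add: Je Jf algebra_simps)

end

text \<open>The first-order data of the family at one parameter value. The equations are required for all
  \<open>\<theta>\<close>; \<open>testing\<close> is the self-similarity equation tested with \<open>J X_\<theta>\<close>, in which \<open>\<langle>X_ss, J X_\<theta>\<rangle>\<close> has been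
  replaced by \<open>\<langle>X_s\<theta>, J X_s\<rangle>\<close>, so that no second derivatives in \<open>s\<close> occur.\<close>

locale circle_jet =
  fixes e1 e2 p1 p2 c c1 :: C2 and r rd lam :: real
  assumes e: "e1 \<bullet> e1 = 1" "e2 \<bullet> e2 = 1" "e1 \<bullet> e2 = 0"
    and pe: "p1 \<bullet> e1 = 0" "p1 \<bullet> e2 = 0" "p2 \<bullet> e1 = 0" "p2 \<bullet> e2 = 0"
    and r: "r > 0" and lam: "lam \<noteq> 0"
  fixes X1 X2 X12 X22 X0 :: "real \<Rightarrow> C2"
  defines "X0 \<equiv> trig_vec c (r *\<^sub>R e1) (r *\<^sub>R e2)"
    and "X1 \<equiv> trig_vec c1 (rd *\<^sub>R e1 + r *\<^sub>R p1) (rd *\<^sub>R e2 + r *\<^sub>R p2)"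
    and "X2 \<equiv> trig_vec 0 (r *\<^sub>R e2) (- (r *\<^sub>R e1))"
    and "X12 \<equiv> trig_vec 0 (rd *\<^sub>R e2 + r *\<^sub>R p2) (- (rd *\<^sub>R e1 + r *\<^sub>R p1))"
    and "X22 \<equiv> trig_vec 0 (- (r *\<^sub>R e1)) (- (r *\<^sub>R e2))"
  assumes lagr: "X1 \<theta> \<bullet> J (X2 \<theta>) = 0"
    and testing: "(X2 \<theta> \<bullet> X2 \<theta>) * (X12 \<theta> \<bullet> J (X1 \<theta>)) - 2 * (X1 \<theta> \<bullet> X2 \<theta>) * (X22 \<theta> \<bullet> J (X1 \<theta>))
        + (X1 \<theta> \<bullet> X1 \<theta>) * (X22 \<theta> \<bullet> J (X2 \<theta>))
        + lam * ((X1 \<theta> \<bullet> X1 \<theta>) * (X2 \<theta> \<bullet> X2 \<theta>) - (X1 \<theta> \<bullet> X2 \<theta>)\<^sup>2) * (X0 \<theta> \<bullet> J (X2 \<theta>)) = 0"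
    and immersed: "(X1 0 \<bullet> X1 0) * (X2 0 \<bullet> X2 0) - (X1 0 \<bullet> X2 0)\<^sup>2 > 0"
begin

text \<open>The cosine of the Kaehler angle of the plane spanned by \<open>e1, e2\<close>.\<close>

definition w :: real where "w = e1 \<bullet> J e2"

lemma eJ: "e2 \<bullet> e1 = 0" "e1 \<bullet> J e2 = w" "e2 \<bullet> J e1 = - w"
  using e(3) inner_J_left[of e1 e2] inner_J_left[of e2 e1] inner_commute[of "J e2" e1] inner_commute[of e2 e1]
  by (auto simp: w_def)

text \<open>These are the Fourier coefficients of \<open>\<langle>X_s, J X_\<theta>\<rangle>\<close>, extracted by evaluation at rational points of the
  unit circle.\<close>

lemma lagrangian_relations:
  "c1 \<bullet> J e1 = 0" "c1 \<bullet> J e2 = 0" "rd * w + r * (p1 \<bullet> J e2) = 0" "rd * w - r * (p2 \<bullet> J e1) = 0"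
  "p2 \<bullet> J e2 = p1 \<bullet> J e1"
proof -
  have L: "- y * (c1 \<bullet> J e1) + x * (c1 \<bullet> J e2) + rd * w + r * (x\<^sup>2 * (p1 \<bullet> J e2) - y\<^sup>2 * (p2 \<bullet> J e1)
      + x * y * (p2 \<bullet> J e2 - p1 \<bullet> J e1)) = 0" if xy: "x\<^sup>2 + y\<^sup>2 = 1" for x y
  proof -
    obtain \<theta> where \<theta>: "x = cos \<theta>" "y = sin \<theta>" using sincos_total_2pi[OF xy] by metis
    have "r * (- y * (c1 \<bullet> J e1) + x * (c1 \<bullet> J e2) + rd * w * (x\<^sup>2 + y\<^sup>2) + r * (x\<^sup>2 * (p1 \<bullet> J e2) - y\<^sup>2 * (p2 \<bullet> J e1)
      + x * y * (p2 \<bullet> J e2 - p1 \<bullet> J e1))) = X1 \<theta> \<bullet> J (X2 \<theta>)"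
      unfolding X1_def X2_def trig_vec_def \<theta>[symmetric]
      by (simp add: inner_add_left inner_add_right eJ algebra_simps power2_eq_square)
    then show ?thesis using lagr[of \<theta>] r xy by simp
  qed
  have 1: "(c1 \<bullet> J e2) + rd * w + r * (p1 \<bullet> J e2) = 0" using L[of 1 0] by simp
  have 2: "- (c1 \<bullet> J e2) + rd * w + r * (p1 \<bullet> J e2) = 0" using L[of "-1" 0] by simp
  have 3: "- (c1 \<bullet> J e1) + rd * w - r * (p2 \<bullet> J e1) = 0" using L[of 0 1] by simp
  have 4: "(c1 \<bullet> J e1) + rd * w - r * (p2 \<bullet> J e1) = 0" using L[of 0 "-1"] by simp
  show z: "c1 \<bullet> J e1 = 0" "c1 \<bullet> J e2 = 0" "rd * w + r * (p1 \<bullet> J e2) = 0" "rd * w - r * (p2 \<bullet> J e1) = 0"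
    using 1 2 3 4 by linarith+
  have 5: "rd * w + r * (9/25 * (p1 \<bullet> J e2) - 16/25 * (p2 \<bullet> J e1) + 12/25 * (p2 \<bullet> J e2 - p1 \<bullet> J e1)) = 0"
    using L[of "3/5" "4/5"] z by (simp add: power2_eq_square)
  have "r * (p2 \<bullet> J e2 - p1 \<bullet> J e1) = 0" using 5 z(3,4) by algebra
  then show "p2 \<bullet> J e2 = p1 \<bullet> J e1" using r by simp
qed

end

text \<open>Here \<open>g1, g2\<close> and \<open>l1, l2\<close> stand for the inner products of \<open>c'\<close> with \<open>e1, e2\<close> and of \<open>c\<close> with \<open>J e1, J e2\<close>. The third
  harmonic of the equation in \<open>\<theta>\<close> is, up to a factor, the product of the second harmonic of the squared area
  element, which vanishes only if \<open>g1 = g2 = 0\<close>, with the first harmonic \<open>(l1, l2)\<close> of \<open>\<langle>X, J X_\<theta>\<rangle>\<close>;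
  if \<open>g1 = g2 = 0\<close>, the first harmonic of the equation is a nonzero multiple of \<open>(l1, l2)\<close>.
  Evaluation at rational points of the unit circle extracts these coefficients.\<close>

lemma cubic_on_circle:
  fixes g1 g2 l1 l2 k S \<sigma> \<alpha> rd w lam r :: real
  assumes S: "S = 1 + k * k" and N: "lam * r \<noteq> 0"
    and f: "\<And>x y. x\<^sup>2 + y\<^sup>2 = 1 \<Longrightarrow>
      (w * (rd\<^sup>2 * S + \<alpha>\<^sup>2) + rd * w * S * (g1 * x + g2 * y) + \<alpha> * \<sigma> * S * (g2 * x - g1 * y))
       - 2 * (g2 * x - g1 * y) * \<sigma> * \<alpha>
       - w * ((g1 * x + g2 * y + rd)\<^sup>2 * S + (g2 * x - g1 * y)\<^sup>2 + (\<alpha> + k * (g2 * x - g1 * y))\<^sup>2)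
       + lam * ((g1 * x + g2 * y + rd)\<^sup>2 * S + (\<alpha> + k * (g2 * x - g1 * y))\<^sup>2) * (r * (l2 * x - l1 * y) + r\<^sup>2 * w) = 0"
    and pos: "(g1 + rd)\<^sup>2 * S + (\<alpha> + k * g2)\<^sup>2 > 0"
  shows "l1 = 0 \<and> l2 = 0"
proof -
  define K where "K = rd\<^sup>2 * S + \<alpha>\<^sup>2"
  define L1 where "L1 = rd * w * S * g1 + \<alpha> * \<sigma> * S * g2 - 2 * g2 * \<sigma> * \<alpha>
      - w * (2 * rd * S * g1 + 2 * \<alpha> * k * g2) + lam * r\<^sup>2 * w * (2 * rd * S * g1 + 2 * \<alpha> * k * g2)"
  define L2 where "L2 = rd * w * S * g2 - \<alpha> * \<sigma> * S * g1 + 2 * g1 * \<sigma> * \<alpha>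
      - w * (2 * rd * S * g2 - 2 * \<alpha> * k * g1) + lam * r\<^sup>2 * w * (2 * rd * S * g2 - 2 * \<alpha> * k * g1)"
  have odd: "L1 * x + L2 * y + lam * r * (l2 * x - l1 * y) * ((g1 * x + g2 * y)\<^sup>2 * S + k\<^sup>2 * (g2 * x - g1 * y)\<^sup>2 + K) = 0"
    if xy: "x\<^sup>2 + y\<^sup>2 = 1" for x y
  proof -
    have "(- x)\<^sup>2 + (- y)\<^sup>2 = 1" using xy by simp
    then show ?thesis using f[OF xy] f[of "- x" "- y"] unfolding K_def L1_def L2_def by algebra
  qed
  define N where "N = lam * r"
  have N0: "N \<noteq> 0" using N by (simp add: N_def)
  have o1: "L1 + N * l2 * (g1\<^sup>2 * S + k\<^sup>2 * g2\<^sup>2 + K) = 0" using odd[of 1 0] by (simp add: N_def)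
  have o2: "L2 - N * l1 * (g2\<^sup>2 * S + k\<^sup>2 * g1\<^sup>2 + K) = 0" using odd[of 0 1] by (simp add: N_def)
  have o3: "L1 * (3/5) + L2 * (4/5) + N * (l2 * (3/5) - l1 * (4/5)) * ((g1 * (3/5) + g2 * (4/5))\<^sup>2 * S + k\<^sup>2 * (g2 * (3/5) - g1 * (4/5))\<^sup>2 + K) = 0"
    using odd[of "3/5" "4/5"] unfolding N_def by (simp add: power2_eq_square)
  have o4: "L1 * (3/5) + L2 * (-4/5) + N * (l2 * (3/5) - l1 * (-4/5)) * ((g1 * (3/5) + g2 * (-4/5))\<^sup>2 * S + k\<^sup>2 * (g2 * (3/5) - g1 * (-4/5))\<^sup>2 + K) = 0"
    using odd[of "3/5" "-4/5"] unfolding N_def by (simp add: power2_eq_square)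
  have "N * (l2 * (g1\<^sup>2 - g2\<^sup>2) + 2 * (g1 * g2) * l1) = 0"
    using o1 o2 o3 o4 S by algebra
  then have a: "l2 * (g1\<^sup>2 - g2\<^sup>2) + 2 * (g1 * g2) * l1 = 0" using N0 by simp
  have "N * (2 * (g1 * g2) * l2 - l1 * (g1\<^sup>2 - g2\<^sup>2)) = 0"
    using o1 o2 o3 o4 S by algebra
  then have b: "2 * (g1 * g2) * l2 - l1 * (g1\<^sup>2 - g2\<^sup>2) = 0" using N0 by simp
  have "(g1\<^sup>2 + g2\<^sup>2)\<^sup>2 * (l1\<^sup>2 + l2\<^sup>2) = 0" using a b by algebra
  then consider "g1 = 0 \<and> g2 = 0" | "l1 = 0 \<and> l2 = 0" by (auto simp: sum_power2_eq_zero_iff)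
  then show ?thesis
  proof cases
    case 1
    then have "K > 0" "L1 = 0" "L2 = 0" using pos by (simp_all add: K_def L1_def L2_def)
    then show ?thesis using o1 o2 1 N0 by simp
  qed
qed

context circle_jet
begin

text \<open>The frame of \<open>kaehler_frame\<close> and the shape of all the data in it when the plane of the circle is
  not complex.\<close>

context
  fixes f1 f2 :: C2 and \<sigma> :: real
  assumes KF: "kaehler_frame e1 e2 f1 f2 w \<sigma>"
begin

interpretation kaehler_frame e1 e2 f1 f2 w \<sigma> by (rule KF)

text \<open>The Lagrangian relations leave two real parameters \<open>g1, g2\<close> for \<open>c'\<close> and two real parameters \<open>a, b\<close> for the
  velocity of the plane, of which \<open>b\<close> is tied to \<open>r'\<close>; here \<open>k\<close> is the cotangent of the Kaehler angle.\<close>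

lemma jet_coordinates:
  obtains a b k g1 g2 where "w = k * \<sigma>" "\<sigma> * \<sigma> * (1 + k * k) = 1" "r * b = - k * rd"
    "p1 = v4 0 0 a b" "p2 = v4 0 0 (- b) a" "c1 = v4 g1 g2 (k * g2) (- k * g1)"
proof -
  have J1: "z \<bullet> J e1 = \<sigma> * (z \<bullet> f1) - w * (z \<bullet> e2)" and J2: "z \<bullet> J e2 = \<sigma> * (z \<bullet> f2) + w * (z \<bullet> e1)" for z
    unfolding Je by (simp_all add: inner_add_right inner_diff_right)
  define k where "k = w / \<sigma>"
  have k: "w = k * \<sigma>" using \<sigma> by (simp add: k_def)
  have S: "\<sigma> * \<sigma> * (1 + k * k) = 1" using \<sigma>(2) unfolding k by algebra
  note R = lagrangian_relations[unfolded J1 J2 pe]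
  have rb: "r * (p1 \<bullet> f2) = - k * rd"
  proof -
    have "\<sigma> * (r * (p1 \<bullet> f2) + k * rd) = 0" using R(3) unfolding k by (simp add: algebra_simps)
    then show ?thesis using \<sigma>(1) by simp
  qed
  have "\<sigma> * r * ((p2 \<bullet> f1) + (p1 \<bullet> f2)) = 0" using R(3,4) by (simp add: algebra_simps)
  then have b: "p2 \<bullet> f1 = - (p1 \<bullet> f2)" using \<sigma>(1) r by simp
  have a: "p2 \<bullet> f2 = p1 \<bullet> f1" using R(5) \<sigma>(1) by simp
  have "\<sigma> * (c1 \<bullet> f1 - k * (c1 \<bullet> e2)) = 0" using R(1) unfolding k by (simp add: algebra_simps)
  then have c1: "c1 \<bullet> f1 = k * (c1 \<bullet> e2)" using \<sigma>(1) by simp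
  have "\<sigma> * (c1 \<bullet> f2 + k * (c1 \<bullet> e1)) = 0" using R(2) unfolding k by (simp add: algebra_simps)
  then have c2: "c1 \<bullet> f2 = - k * (c1 \<bullet> e1)" using \<sigma>(1) by simp
  show ?thesis
    using expand[of p1] expand[of p2] expand[of c1] unfolding pe a b c1 c2
    by (rule that[OF k S rb])
qed

lemma jet_equation:
  assumes k: "w = k * \<sigma>" and S: "\<sigma> * \<sigma> * (1 + k * k) = 1" and rb: "r * b = - k * rd"
    and p: "p1 = v4 0 0 a b" "p2 = v4 0 0 (- b) a" "c1 = v4 g1 g2 (k * g2) (- k * g1)"
    and \<alpha>: "\<alpha> = r * a"
  shows "x\<^sup>2 + y\<^sup>2 = 1 \<Longrightarrow>
      (w * (rd\<^sup>2 * (1 + k * k) + \<alpha>\<^sup>2) + rd * w * (1 + k * k) * (g1 * x + g2 * y) + \<alpha> * \<sigma> * (1 + k * k) * (g2 * x - g1 * y))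
       - 2 * (g2 * x - g1 * y) * \<sigma> * \<alpha>
       - w * ((g1 * x + g2 * y + rd)\<^sup>2 * (1 + k * k) + (g2 * x - g1 * y)\<^sup>2 + (\<alpha> + k * (g2 * x - g1 * y))\<^sup>2)
       + lam * ((g1 * x + g2 * y + rd)\<^sup>2 * (1 + k * k) + (\<alpha> + k * (g2 * x - g1 * y))\<^sup>2)
         * (r * ((c \<bullet> J e2) * x - (c \<bullet> J e1) * y) + r\<^sup>2 * w) = 0"
    and "(g1 + rd)\<^sup>2 * (1 + k * k) + (\<alpha> + k * g2)\<^sup>2 > 0"
proof -
  have B: "rd *\<^sub>R e1 + r *\<^sub>R p1 = v4 rd 0 \<alpha> (- k * rd)" "rd *\<^sub>R e2 + r *\<^sub>R p2 = v4 0 rd (k * rd) \<alpha>"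
    by (simp_all add: p(1,2) vec4_def scaleR_add_right scaleR_diff_right \<alpha> rb)
  have Xs: "X1 \<theta> = v4 (g1 + rd * cos \<theta>) (g2 + rd * sin \<theta>) (k * g2 + \<alpha> * cos \<theta> + k * rd * sin \<theta>) (- k * g1 - k * rd * cos \<theta> + \<alpha> * sin \<theta>)"
    "X2 \<theta> = v4 (- r * sin \<theta>) (r * cos \<theta>) 0 0"
    "X12 \<theta> = v4 (- rd * sin \<theta>) (rd * cos \<theta>) (k * rd * cos \<theta> - \<alpha> * sin \<theta>) (k * rd * sin \<theta> + \<alpha> * cos \<theta>)"
    "X22 \<theta> = v4 (- r * cos \<theta>) (- r * sin \<theta>) 0 0" for \<theta>
    unfolding X1_def X2_def X12_def X22_def B p(3) trig_vec_def
    unfolding vec4_def by (simp_all add: algebra_simps)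
  have ip: "X2 \<theta> \<bullet> X2 \<theta> = r\<^sup>2" "X1 \<theta> \<bullet> X2 \<theta> = r * (g2 * cos \<theta> - g1 * sin \<theta>)"
    "X22 \<theta> \<bullet> J (X1 \<theta>) = r * \<sigma> * \<alpha>"
    "X22 \<theta> \<bullet> J (X2 \<theta>) = - r\<^sup>2 * w"
    "X1 \<theta> \<bullet> X1 \<theta> = (g1 * cos \<theta> + g2 * sin \<theta> + rd)\<^sup>2 * (1 + k * k) + (g2 * cos \<theta> - g1 * sin \<theta>)\<^sup>2 + (\<alpha> + k * (g2 * cos \<theta> - g1 * sin \<theta>))\<^sup>2"
    "X12 \<theta> \<bullet> J (X1 \<theta>) = w * (rd\<^sup>2 * (1 + k * k) + \<alpha>\<^sup>2) + rd * w * (1 + k * k) * (g1 * cos \<theta> + g2 * sin \<theta>) + \<alpha> * \<sigma> * (1 + k * k) * (g2 * cos \<theta> - g1 * sin \<theta>)"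
    for \<theta>
  proof -
    define x y where "x = cos \<theta>" and "y = sin \<theta>"
    have xy: "x\<^sup>2 + y\<^sup>2 = 1" by (simp add: x_def y_def)
    note u = Xs v4_J v4_inner x_def[symmetric] y_def[symmetric]
    show "X2 \<theta> \<bullet> X2 \<theta> = r\<^sup>2"
      unfolding u using xy by algebra
    show "X1 \<theta> \<bullet> X2 \<theta> = r * (g2 * cos \<theta> - g1 * sin \<theta>)"
      unfolding u by (simp add: algebra_simps)
    show "X22 \<theta> \<bullet> J (X1 \<theta>) = r * \<sigma> * \<alpha>"
      unfolding u using xy k by algebra
    show "X22 \<theta> \<bullet> J (X2 \<theta>) = - r\<^sup>2 * w"
      unfolding u using xy by algebra
    show "X1 \<theta> \<bullet> X1 \<theta> = (g1 * cos \<theta> + g2 * sin \<theta> + rd)\<^sup>2 * (1 + k * k) + (g2 * cos \<theta> - g1 * sin \<theta>)\<^sup>2 + (\<alpha> + k * (g2 * cos \<theta> - g1 * sin \<theta>))\<^sup>2"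
      unfolding u using xy by algebra
    show "X12 \<theta> \<bullet> J (X1 \<theta>) = w * (rd\<^sup>2 * (1 + k * k) + \<alpha>\<^sup>2) + rd * w * (1 + k * k) * (g1 * cos \<theta> + g2 * sin \<theta>) + \<alpha> * \<sigma> * (1 + k * k) * (g2 * cos \<theta> - g1 * sin \<theta>)"
      unfolding u using xy k by algebra
  qed
  have x0: "X0 \<theta> \<bullet> J (X2 \<theta>) = r * ((c \<bullet> J e2) * cos \<theta> - (c \<bullet> J e1) * sin \<theta>) + r\<^sup>2 * w" for \<theta>
  proof -
    define x y where "x = cos \<theta>" and "y = sin \<theta>"
    have xy: "x\<^sup>2 + y\<^sup>2 = 1" by (simp add: x_def y_def)
    have "X0 \<theta> \<bullet> J (X2 \<theta>) = r * ((c \<bullet> J e2) * x - (c \<bullet> J e1) * y) + r\<^sup>2 * w * (x\<^sup>2 + y\<^sup>2)"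
      unfolding X0_def X2_def trig_vec_def x_def[symmetric] y_def[symmetric]
      by (simp add: inner_add_left inner_add_right eJ algebra_simps power2_eq_square)
    then show ?thesis unfolding xy x_def y_def by simp
  qed
  have "r\<^sup>2 * ((g1 + rd)\<^sup>2 * (1 + k * k) + (\<alpha> + k * g2)\<^sup>2) > 0"
    using immersed unfolding ip by (simp add: algebra_simps power2_eq_square)
  then show "(g1 + rd)\<^sup>2 * (1 + k * k) + (\<alpha> + k * g2)\<^sup>2 > 0"
    using r by (simp add: zero_less_mult_iff)
  assume "x\<^sup>2 + y\<^sup>2 = 1"
  then obtain \<theta> where \<theta>: "x = cos \<theta>" "y = sin \<theta>" using sincos_total_2pi by metis
  let ?f = "(w * (rd\<^sup>2 * (1 + k * k) + \<alpha>\<^sup>2) + rd * w * (1 + k * k) * (g1 * x + g2 * y) + \<alpha> * \<sigma> * (1 + k * k) * (g2 * x - g1 * y))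
       - 2 * (g2 * x - g1 * y) * \<sigma> * \<alpha>
       - w * ((g1 * x + g2 * y + rd)\<^sup>2 * (1 + k * k) + (g2 * x - g1 * y)\<^sup>2 + (\<alpha> + k * (g2 * x - g1 * y))\<^sup>2)
       + lam * ((g1 * x + g2 * y + rd)\<^sup>2 * (1 + k * k) + (\<alpha> + k * (g2 * x - g1 * y))\<^sup>2)
         * (r * ((c \<bullet> J e2) * x - (c \<bullet> J e1) * y) + r\<^sup>2 * w)"
  have "r\<^sup>2 * ?f = 0" using testing[of \<theta>] unfolding ip x0 \<theta>[symmetric] by algebra
  then show "?f = 0" using r by simp
qed

end

lemma kaehler_frame_ex:
  assumes "\<bar>w\<bar> < 1"
  shows "\<exists>f1 f2 \<sigma>. kaehler_frame e1 e2 f1 f2 w \<sigma>"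
proof (intro exI)
  show "kaehler_frame e1 e2 ((1 / sqrt (1 - w\<^sup>2)) *\<^sub>R (J e1 + w *\<^sub>R e2)) ((1 / sqrt (1 - w\<^sup>2)) *\<^sub>R (J e2 - w *\<^sub>R e1)) w (sqrt (1 - w\<^sup>2))"
    by unfold_locales (use e assms in \<open>auto simp: w_def\<close>)
qed

lemma centre_normal:
  assumes "\<bar>w\<bar> < 1"
  shows "c \<bullet> J e1 = 0" "c \<bullet> J e2 = 0"
proof -
  obtain f1 f2 \<sigma> where KF: "kaehler_frame e1 e2 f1 f2 w \<sigma>" using kaehler_frame_ex[OF assms] by blast
  obtain a b k g1 g2 where j: "w = k * \<sigma>" "\<sigma> * \<sigma> * (1 + k * k) = 1" "r * b = - k * rd"
    "p1 = vec4 e1 e2 f1 f2 0 0 a b" "p2 = vec4 e1 e2 f1 f2 0 0 (- b) a" "c1 = vec4 e1 e2 f1 f2 g1 g2 (k * g2) (- k * g1)"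
    by (rule jet_coordinates[OF KF])
  note eq = jet_equation[OF KF j refl]
  have "c \<bullet> J e1 = 0 \<and> c \<bullet> J e2 = 0"
    by (rule cubic_on_circle[OF refl _ eq]) (use lam r in auto)
  then show "c \<bullet> J e1 = 0" "c \<bullet> J e2 = 0" by auto
qed

text \<open>With \<open>c' = 0\<close> the equation reduces, up to a positive factor, to \<open>\<lambda> w\<close> times the squared area element. With a
  resting plane and \<open>w \<noteq> 0\<close> the radius is stationary, and then the second harmonic of the equation forces \<open>c' = 0\<close>.\<close>

lemma kaehler_angle_zero:
  assumes "\<bar>w\<bar> < 1" "c1 = 0 \<or> p1 = 0 \<and> p2 = 0"
  shows "w = 0"
proof (rule ccontr)
  assume w0: "w \<noteq> 0"
  obtain f1 f2 \<sigma> where KF: "kaehler_frame e1 e2 f1 f2 w \<sigma>" using kaehler_frame_ex[OF assms(1)] by blast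
  interpret kaehler_frame e1 e2 f1 f2 w \<sigma> by (rule KF)
  obtain a b k g1 g2 where j: "w = k * \<sigma>" "\<sigma> * \<sigma> * (1 + k * k) = 1" "r * b = - k * rd"
    "p1 = v4 0 0 a b" "p2 = v4 0 0 (- b) a" "c1 = v4 g1 g2 (k * g2) (- k * g1)"
    by (rule jet_coordinates[OF KF])
  note eq = jet_equation[OF KF j refl, unfolded centre_normal[OF assms(1)]]
  have coord: "z1 = 0 \<and> z2 = 0 \<and> z3 = 0 \<and> z4 = 0" if "v4 z1 z2 z3 z4 = 0" for z1 z2 z3 z4
  proof -
    have "z1 * z1 + z2 * z2 + z3 * z3 + z4 * z4 = 0" using v4_inner[of z1 z2 z3 z4 z1 z2 z3 z4] that by simp
    then show ?thesis by (simp add: add_nonneg_eq_0_iff)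
  qed
  define S where "S = 1 + k * k"
  have S: "S > 0" by (simp add: S_def add_pos_nonneg)
  show False
  proof (cases "c1 = 0")
    case True
    then have g: "g1 = 0" "g2 = 0" using coord j(6) by metis+
    have "lam * (rd\<^sup>2 * S + (r * a)\<^sup>2) * (r\<^sup>2 * w) = 0"
      using eq(1)[of 1 0] unfolding g S_def[symmetric] by (simp add: algebra_simps)
    moreover have "rd\<^sup>2 * S + (r * a)\<^sup>2 > 0" using eq(2) unfolding g S_def by simp
    ultimately show False using w0 lam r by simp
  next
    case False
    then have "p1 = 0" using assms(2) by simp
    then have ab: "a = 0" "b = 0" using coord j(4) by metis+
    have "k \<noteq> 0" using w0 j(1) by auto
    then have rd: "rd = 0" using j(3) ab by simp
    note eq' = eq(1)[unfolded rd ab, folded S_def]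
    have E1: "- (w * (g1\<^sup>2 * S + g2\<^sup>2 + (k * g2)\<^sup>2)) + lam * (g1\<^sup>2 * S + (k * g2)\<^sup>2) * (r\<^sup>2 * w) = 0" using eq'[of 1 0] by simp
    have E2: "- (w * (g2\<^sup>2 * S + g1\<^sup>2 + (k * g1)\<^sup>2)) + lam * (g2\<^sup>2 * S + (k * g1)\<^sup>2) * (r\<^sup>2 * w) = 0" using eq'[of 0 1] by simp
    have E3: "- (w * ((g1 * (3/5) + g2 * (4/5))\<^sup>2 * S + (g2 * (3/5) - g1 * (4/5))\<^sup>2 + (k * (g2 * (3/5) - g1 * (4/5)))\<^sup>2))
      + lam * ((g1 * (3/5) + g2 * (4/5))\<^sup>2 * S + (k * (g2 * (3/5) - g1 * (4/5)))\<^sup>2) * (r\<^sup>2 * w) = 0"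
      using eq'[of "3/5" "4/5"] by (simp add: power2_eq_square)
    have "lam * r\<^sup>2 * w * (g1\<^sup>2 - g2\<^sup>2) = 0" using E1 E2 S_def by algebra
    then have g12: "g1\<^sup>2 = g2\<^sup>2" using lam r w0 by simp
    have "lam * r\<^sup>2 * w * (g1 * g2) = 0" using E1 E2 E3 S_def g12 by algebra
    then have "g1 * g2 = 0" using lam r w0 by simp
    then have "g1 = 0" "g2 = 0" using g12 by auto
    then have "c1 = 0" using j(6) by (simp add: vec4_def)
    then show False using False by simp
  qed
qed

text \<open>On the orthogonal complement of \<open>JP\<close>, which contains \<open>c\<close>, the two inner products are up to a common factor the real and
  imaginary part of the product of two complex numbers, one with parts \<open>a, b\<close> and one formed from the coordinates of \<open>c\<close>.\<close>

lemma centre_zero_or_parallel: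
  assumes "\<bar>w\<bar> < 1" "c \<bullet> J p1 = 0" "c \<bullet> J p2 = 0"
  shows "c = 0 \<or> p1 = 0 \<and> p2 = 0"
proof -
  obtain f1 f2 \<sigma> where KF: "kaehler_frame e1 e2 f1 f2 w \<sigma>" using kaehler_frame_ex[OF assms(1)] by blast
  interpret kaehler_frame e1 e2 f1 f2 w \<sigma> by (rule KF)
  obtain a b k g1 g2 where j: "w = k * \<sigma>" "\<sigma> * \<sigma> * (1 + k * k) = 1" "r * b = - k * rd"
    "p1 = v4 0 0 a b" "p2 = v4 0 0 (- b) a" "c1 = v4 g1 g2 (k * g2) (- k * g1)"
    by (rule jet_coordinates[OF KF])
  define x1 x2 where "x1 = c \<bullet> e1" and "x2 = c \<bullet> e2"
  have "\<sigma> * (c \<bullet> f1) = w * x2" "\<sigma> * (c \<bullet> f2) = - w * x1"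
    using centre_normal[OF assms(1)] unfolding Je x1_def x2_def by (simp_all add: inner_diff_right inner_add_right)
  then have "\<sigma> * (c \<bullet> f1 - k * x2) = 0" "\<sigma> * (c \<bullet> f2 + k * x1) = 0" unfolding j(1) by (simp_all add: algebra_simps)
  then have "c \<bullet> f1 = k * x2" "c \<bullet> f2 = - k * x1" using \<sigma>(1) by auto
  then have c: "c = v4 x1 x2 (k * x2) (- k * x1)" using expand[of c] unfolding x1_def x2_def by simp
  have 1: "(\<sigma> + w * k) * (a * x1 + b * x2) = 0"
    using assms(2) unfolding c j(4) v4_J v4_inner by (simp add: algebra_simps)
  have 2: "(\<sigma> + w * k) * (b * x1 - a * x2) = 0"
    using assms(3) unfolding c j(5) v4_J v4_inner by (simp add: algebra_simps)
  have "\<sigma> + w * k = \<sigma> * (1 + k * k)" by (simp add: j(1) algebra_simps)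
  then have "\<sigma> + w * k \<noteq> 0" using j(2) by auto
  then have "a * x1 + b * x2 = 0" "b * x1 - a * x2 = 0" using 1 2 by simp_all
  then have "(a\<^sup>2 + b\<^sup>2) * (x1\<^sup>2 + x2\<^sup>2) = 0" by algebra
  then consider "a = 0 \<and> b = 0" | "x1 = 0 \<and> x2 = 0" by (auto simp: sum_power2_eq_zero_iff)
  then show ?thesis using c j(4,5) by cases (auto simp: vec4_def)
qed

text \<open>The case of circles in complex lines, where \<open>\<epsilon>\<close> records the orientation. The second harmonic of the equation is, up to a
  factor and conjugations, the product of complex numbers formed from the first harmonic \<open>(m1, m2)\<close> of the squared area element and
  from the first harmonic \<open>(n1, n2)\<close> of \<open>\<langle>X, J X_\<theta>\<rangle>\<close>. If \<open>(m1, m2)\<close> vanishes, the first harmonic of the equation is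
  a multiple of \<open>(n1, n2)\<close>, so that in any case \<open>c\<close> is orthogonal to the line.\<close>

lemma complex_line:
  assumes \<epsilon>: "\<epsilon> * \<epsilon> = 1" and e2: "e2 = - \<epsilon> *\<^sub>R J e1" and p2: "p2 = - \<epsilon> *\<^sub>R J p1"
  shows "rd = 0" "c1 \<bullet> e1 = 0" "c1 \<bullet> J e1 = 0" "p1 \<bullet> J e1 = 0" "c \<bullet> e1 = 0" "c \<bullet> J e1 = 0"
    "p1 = 0 \<Longrightarrow> lam * r\<^sup>2 = 1 \<and> c1 \<noteq> 0" "c1 = 0 \<Longrightarrow> lam * r\<^sup>2 = 2 \<and> p1 \<noteq> 0"
proof -
  have "e1 \<bullet> J e2 = \<epsilon>" by (simp add: e2 e)
  then have w: "w = \<epsilon>" by (simp only: w_def)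
  have \<epsilon>0: "\<epsilon> \<noteq> 0" using \<epsilon> by auto
  have "c1 \<bullet> J e2 = \<epsilon> * (c1 \<bullet> e1)" "p1 \<bullet> J e2 = \<epsilon> * (p1 \<bullet> e1)" "p1 \<bullet> e2 = - \<epsilon> * (p1 \<bullet> J e1)" by (simp_all add: e2)
  then show z: "rd = 0" "c1 \<bullet> e1 = 0" "c1 \<bullet> J e1 = 0" "p1 \<bullet> J e1 = 0"
    using lagrangian_relations(1-3) pe \<epsilon>0 by (auto simp: w)
  define m1 m2 n1 n2 \<eta> q where "m1 = p1 \<bullet> c1" and "m2 = p1 \<bullet> J c1" and "n1 = c \<bullet> e1" and "n2 = c \<bullet> J e1" and "\<eta> = p1 \<bullet> p1" and "q = c1 \<bullet> c1"
  have e1p: "e1 \<bullet> p1 = 0" "e1 \<bullet> J p1 = 0" "e1 \<bullet> c1 = 0" "e1 \<bullet> J c1 = 0" "c1 \<bullet> p1 = m1" "c1 \<bullet> J p1 = - m2" "p1 \<bullet> c1 = m1" "p1 \<bullet> J c1 = m2" "p1 \<bullet> p1 = \<eta>" "c1 \<bullet> c1 = q"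
    "c \<bullet> e1 = n1" "c \<bullet> J e1 = n2"
    using pe(1) z inner_J_left[of e1 p1] inner_J_left[of e1 c1] inner_J_left[of c1 p1] inner_commute[of p1 e1] inner_commute[of c1 e1]
      inner_commute[of "J e1" p1] inner_commute[of "J e1" c1] inner_commute[of c1 p1] inner_commute[of "J c1" p1]
    by (auto simp: m1_def m2_def \<eta>_def q_def n1_def n2_def)
  have T: "- (r\<^sup>2 * \<eta> + r * (x * m1 + \<epsilon> * y * m2)) - (r\<^sup>2 * \<eta> + 2 * r * (x * m1 + \<epsilon> * y * m2) + q)
      + lam * (r\<^sup>2 * \<eta> + 2 * r * (x * m1 + \<epsilon> * y * m2) + q) * (r * (x * n1 - \<epsilon> * y * n2) + r\<^sup>2) = 0"
    and E: "X1 \<theta> \<bullet> X1 \<theta> = r\<^sup>2 * \<eta> + 2 * r * (x * m1 + \<epsilon> * y * m2) + q" "X1 \<theta> \<bullet> X2 \<theta> = 0"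
    if \<theta>: "x = cos \<theta>" "y = sin \<theta>" for x y \<theta>
  proof -
    have xy: "x\<^sup>2 + y\<^sup>2 = 1" by (simp add: \<theta>)
    have X: "X1 \<theta> = c1 + (r * x) *\<^sub>R p1 - (r * \<epsilon> * y) *\<^sub>R J p1" "X2 \<theta> = (- r * \<epsilon> * x) *\<^sub>R J e1 - (r * y) *\<^sub>R e1"
      "X12 \<theta> = (- r * \<epsilon> * x) *\<^sub>R J p1 - (r * y) *\<^sub>R p1" "X22 \<theta> = (r * \<epsilon> * y) *\<^sub>R J e1 - (r * x) *\<^sub>R e1"
      "X0 \<theta> = c + (r * x) *\<^sub>R e1 - (r * \<epsilon> * y) *\<^sub>R J e1"
      unfolding X0_def X1_def X2_def X12_def X22_def trig_vec_def \<theta> e2 p2 z(1) by (simp_all add: algebra_simps)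
    note ips = inner_add_left inner_add_right inner_diff_left inner_diff_right inner_J_left e e1p pe z
    show E: "X1 \<theta> \<bullet> X1 \<theta> = r\<^sup>2 * \<eta> + 2 * r * (x * m1 + \<epsilon> * y * m2) + q" (is "_ = ?E")
      unfolding X by (simp add: ips) (use xy \<epsilon> in algebra)
    show F: "X1 \<theta> \<bullet> X2 \<theta> = 0" unfolding X by (simp add: ips)
    have G: "X2 \<theta> \<bullet> X2 \<theta> = r\<^sup>2" unfolding X by (simp add: ips) (use xy \<epsilon> in algebra)
    have M: "X12 \<theta> \<bullet> J (X1 \<theta>) = - \<epsilon> * (r\<^sup>2 * \<eta> + r * (x * m1 + \<epsilon> * y * m2))"
      unfolding X by (simp add: ips) (use xy \<epsilon> in algebra)
    have M2: "X22 \<theta> \<bullet> J (X2 \<theta>) = - r\<^sup>2 * \<epsilon>" unfolding X by (simp add: ips) (use xy \<epsilon> in algebra)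
    have M0: "X0 \<theta> \<bullet> J (X2 \<theta>) = \<epsilon> * (r * (x * n1 - \<epsilon> * y * n2) + r\<^sup>2)"
      unfolding X by (simp add: ips) (use xy \<epsilon> in algebra)
    have "r\<^sup>2 * \<epsilon> * (- (r\<^sup>2 * \<eta> + r * (x * m1 + \<epsilon> * y * m2)) - ?E + lam * ?E * (r * (x * n1 - \<epsilon> * y * n2) + r\<^sup>2)) = 0"
      using testing[of \<theta>] unfolding E F G M M2 M0 by (simp add: algebra_simps)
    then show "- (r\<^sup>2 * \<eta> + r * (x * m1 + \<epsilon> * y * m2)) - ?E + lam * ?E * (r * (x * n1 - \<epsilon> * y * n2) + r\<^sup>2) = 0"
      using r \<epsilon>0 by simp
  qed
  have T': "- (r\<^sup>2 * \<eta> + r * (x * m1 + \<epsilon> * y * m2)) - (r\<^sup>2 * \<eta> + 2 * r * (x * m1 + \<epsilon> * y * m2) + q)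
      + lam * (r\<^sup>2 * \<eta> + 2 * r * (x * m1 + \<epsilon> * y * m2) + q) * (r * (x * n1 - \<epsilon> * y * n2) + r\<^sup>2) = 0"
    if "x\<^sup>2 + y\<^sup>2 = 1" for x y
    using T sincos_total_2pi[OF that] by metis
  have "X2 0 \<bullet> X2 0 = r\<^sup>2" by (simp add: X2_def trig_vec_def e power2_eq_square)
  then have pos: "r\<^sup>2 * \<eta> + 2 * r * m1 + q > 0"
    using immersed E[of 1 0 0] r by (simp add: zero_less_mult_iff)
  have even: "- 2 * r\<^sup>2 * \<eta> - q + lam * ((r\<^sup>2 * \<eta> + q) * r\<^sup>2 + 2 * r * (x * m1 + \<epsilon> * y * m2) * r * (x * n1 - \<epsilon> * y * n2)) = 0"
    if "x\<^sup>2 + y\<^sup>2 = 1" for x y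
  proof -
    have "(- x)\<^sup>2 + (- y)\<^sup>2 = 1" using that by simp
    from T'[OF that] T'[OF this] show ?thesis by algebra
  qed
  have o1: "- 2 * r\<^sup>2 * \<eta> - q + lam * ((r\<^sup>2 * \<eta> + q) * r\<^sup>2 + 2 * r * m1 * r * n1) = 0" using even[of 1 0] by simp
  have o2: "- 2 * r\<^sup>2 * \<eta> - q + lam * ((r\<^sup>2 * \<eta> + q) * r\<^sup>2 + 2 * r * (\<epsilon> * m2) * r * (- \<epsilon> * n2)) = 0" using even[of 0 1] by simp
  have o3: "- 2 * r\<^sup>2 * \<eta> - q + lam * ((r\<^sup>2 * \<eta> + q) * r\<^sup>2 + 2 * r * ((3/5) * m1 + \<epsilon> * (4/5) * m2) * r * ((3/5) * n1 - \<epsilon> * (4/5) * n2)) = 0"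
    by (rule even) (simp add: power2_eq_square)
  have "lam * r\<^sup>2 * (m1 * n1 + m2 * n2) = 0" using o1 o2 \<epsilon> by algebra
  then have mn1: "m1 * n1 + m2 * n2 = 0" using lam r by simp
  have "lam * r\<^sup>2 * \<epsilon> * (m2 * n1 - m1 * n2) = 0" using o1 o2 o3 \<epsilon> by algebra
  then have mn2: "m2 * n1 - m1 * n2 = 0" using lam r \<epsilon>0 by simp
  have "(m1\<^sup>2 + m2\<^sup>2) * (n1\<^sup>2 + n2\<^sup>2) = 0" using mn1 mn2 by algebra
  then have n: "n1 = 0 \<and> n2 = 0"
  proof (cases "n1\<^sup>2 + n2\<^sup>2 = 0")
    case True then show ?thesis by (simp add: sum_power2_eq_zero_iff)
  next
    case False
    with \<open>(m1\<^sup>2 + m2\<^sup>2) * (n1\<^sup>2 + n2\<^sup>2) = 0\<close> have m: "m1 = 0" "m2 = 0" by (auto simp: sum_power2_eq_zero_iff)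
    have K: "r\<^sup>2 * \<eta> + q > 0" using pos m by simp
    have circ: "1\<^sup>2 + 0\<^sup>2 = (1::real)" "(-1)\<^sup>2 + 0\<^sup>2 = (1::real)" "0\<^sup>2 + 1\<^sup>2 = (1::real)" "0\<^sup>2 + (-1)\<^sup>2 = (1::real)"
      by simp_all
    have "lam * (r\<^sup>2 * \<eta> + q) * r * n1 = 0"
      using T'[OF circ(1)] T'[OF circ(2)] unfolding m by algebra
    moreover have "lam * (r\<^sup>2 * \<eta> + q) * r * (\<epsilon> * n2) = 0"
      using T'[OF circ(3)] T'[OF circ(4)] unfolding m by algebra
    ultimately show ?thesis using K lam r \<epsilon>0 by simp
  qed
  then show "c \<bullet> e1 = 0" "c \<bullet> J e1 = 0" by (simp_all add: n1_def n2_def)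
  have T1: "- (r\<^sup>2 * \<eta> + r * m1) + (lam * r\<^sup>2 - 1) * (r\<^sup>2 * \<eta> + 2 * r * m1 + q) = 0"
    using T'[of 1 0] n by (simp add: algebra_simps)
  show "lam * r\<^sup>2 = 1 \<and> c1 \<noteq> 0" if "p1 = 0"
  proof -
    have "\<eta> = 0" "m1 = 0" using that by (simp_all add: \<eta>_def m1_def)
    then show ?thesis using T1 pos by (auto simp: q_def)
  qed
  show "lam * r\<^sup>2 = 2 \<and> p1 \<noteq> 0" if "c1 = 0"
  proof -
    have 0: "q = 0" "m1 = 0" using that by (simp_all add: q_def m1_def)
    then have "(lam * r\<^sup>2 - 2) * (r\<^sup>2 * \<eta>) = 0" using T1 by (simp add: algebra_simps)
    then show ?thesis using pos 0 by (auto simp: \<eta>_def)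
  qed
qed

end

section \<open>The possible families of circles\<close>

abbreviation vd :: "(real \<Rightarrow> 'a::real_normed_vector) \<Rightarrow> real \<Rightarrow> 'a" where
  "vd f \<equiv> (\<lambda>s. vector_derivative f (at s))"

lemma inner_derivative:
  fixes f g :: "real \<Rightarrow> 'a::real_inner"
  shows "(f has_vector_derivative f') (at s) \<Longrightarrow> (g has_vector_derivative g') (at s)
    \<Longrightarrow> ((\<lambda>s. f s \<bullet> g s) has_vector_derivative (f s \<bullet> g' + f' \<bullet> g s)) (at s)"
  by (rule bounded_bilinear.has_vector_derivative[OF bounded_bilinear_inner])

lemma scaleR_derivative:
  shows "(f has_vector_derivative f') (at s) \<Longrightarrow> (g has_vector_derivative g') (at s)
    \<Longrightarrow> ((\<lambda>s. f s *\<^sub>R g s) has_vector_derivative (f s *\<^sub>R g' + f' *\<^sub>R g s)) (at s)"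
  by (rule bounded_bilinear.has_vector_derivative[OF bounded_bilinear_scaleR])

lemma J_derivative:
  "(f has_vector_derivative f') (at s) \<Longrightarrow> ((\<lambda>s. J (f s)) has_vector_derivative J f') (at s)"
  by (rule bounded_linear.has_vector_derivative[OF bounded_linear_J])

lemma trig_family_derivative:
  assumes "smooth_on S A" "smooth_on S B" "smooth_on S C" "s \<in> S"
  shows "((\<lambda>x. trig_vec (A (fst x)) (B (fst x)) (C (fst x)) (snd x)) has_derivative
    (\<lambda>h. fst h *\<^sub>R trig_vec (vd A s) (vd B s) (vd C s) \<theta> + snd h *\<^sub>R trig_vec 0 (C s) (- B s) \<theta>)) (at (s, \<theta>))"
proof -
  have d: "((\<lambda>x::real \<times> real. f (fst x)) has_derivative (\<lambda>h. fst h *\<^sub>R vd f s)) (at (s, \<theta>))"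
    if "smooth_on S f" for f :: "real \<Rightarrow> C2"
  proof -
    have "(fst has_derivative fst) (at (s, \<theta>))" by (auto intro!: derivative_eq_intros)
    moreover have "(f has_derivative (\<lambda>h. h *\<^sub>R vd f s)) (at (fst (s, \<theta>)))"
      using smooth_on_has_vector_derivative[OF that assms(4)] by (simp add: has_vector_derivative_def)
    ultimately show ?thesis by (rule has_derivative_compose)
  qed
  have cs: "((\<lambda>x::real \<times> real. cos (snd x)) has_derivative (\<lambda>h. snd h * - sin \<theta>)) (at (s, \<theta>))"
    "((\<lambda>x::real \<times> real. sin (snd x)) has_derivative (\<lambda>h. snd h * cos \<theta>)) (at (s, \<theta>))"
    by (auto intro!: derivative_eq_intros)
  show ?thesis
    unfolding trig_vec_def
    by (rule has_derivative_eq_rhs[OF has_derivative_add[OF has_derivative_add[OF d[OF assms(1)]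
          has_derivative_scaleR[OF cs(1) d[OF assms(2)]]] has_derivative_scaleR[OF cs(2) d[OF assms(3)]]]])
       (simp add: fun_eq_iff algebra_simps)
qed

lemma nonzero_near:
  fixes f :: "real \<Rightarrow> 'a::real_normed_vector"
  assumes "continuous_on S f" "open S" "s \<in> S" "f s \<noteq> 0"
  obtains N where "open N" "s \<in> N" "N \<subseteq> S" "\<And>t. t \<in> N \<Longrightarrow> f t \<noteq> 0"
proof (rule that)
  show "open (S \<inter> f -` (- {0}))" by (rule continuous_open_preimage[OF assms(1,2)]) auto
qed (use assms in auto)

locale cyclic_soliton =
  fixes M :: "'m::{t2_space,second_countable_topology} set" and F :: "'m \<Rightarrow> C2" and \<xi> :: "real \<times> real \<Rightarrow> 'm"
    and a b \<delta> lam :: real and c e1 e2 :: "real \<Rightarrow> C2" and r :: "real \<Rightarrow> real"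
  assumes \<delta>: "\<delta> > 0" and chart: "local_param M F ({a<..<b} \<times> {-\<delta><..<\<delta>}) \<xi>"
    and param: "\<And>x. x \<in> {a<..<b} \<times> {-\<delta><..<\<delta>} \<Longrightarrow> F (\<xi> x) = circle_family c r e1 e2 x"
    and lagr: "lagrangian M F" and soliton: "self_similar lam M F" and lam: "lam \<noteq> 0"
    and sm: "smooth_on {a<..<b} c" "smooth_on {a<..<b} r" "smooth_on {a<..<b} e1" "smooth_on {a<..<b} e2"
    and rpos: "\<And>s. s \<in> {a<..<b} \<Longrightarrow> r s > 0"
    and on: "\<And>s. s \<in> {a<..<b} \<Longrightarrow> e1 s \<bullet> e1 s = 1" "\<And>s. s \<in> {a<..<b} \<Longrightarrow> e2 s \<bullet> e2 s = 1"
      "\<And>s. s \<in> {a<..<b} \<Longrightarrow> e1 s \<bullet> e2 s = 0"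
    and par: "\<And>s. s \<in> {a<..<b} \<Longrightarrow> vd e1 s \<bullet> e2 s = 0"
begin

abbreviation "I \<equiv> {a<..<b}"

lemma I: "open I" by simp

definition B where "B s = r s *\<^sub>R e1 s"
definition C where "C s = r s *\<^sub>R e2 s"

lemma smBC: "smooth_on I B" "smooth_on I C"
  unfolding B_def C_def using smooth_on_scaleR[OF I sm(2,3)] smooth_on_scaleR[OF I sm(2,4)] .

lemmas hd = smooth_on_has_vector_derivative

lemma vdBC: assumes "s \<in> I"
  shows "vd B s = vd r s *\<^sub>R e1 s + r s *\<^sub>R vd e1 s" "vd C s = vd r s *\<^sub>R e2 s + r s *\<^sub>R vd e2 s"
proof -
  show "vd B s = vd r s *\<^sub>R e1 s + r s *\<^sub>R vd e1 s"
    unfolding B_def using scaleR_derivative[OF hd[OF sm(2) assms] hd[OF sm(3) assms]]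
    by (subst add.commute) (rule vector_derivative_at)
  show "vd C s = vd r s *\<^sub>R e2 s + r s *\<^sub>R vd e2 s"
    unfolding C_def using scaleR_derivative[OF hd[OF sm(2) assms] hd[OF sm(4) assms]]
    by (subst add.commute) (rule vector_derivative_at)
qed

lemma vd_frame:
  assumes "s \<in> I"
  shows "vd e1 s \<bullet> e1 s = 0" "vd e2 s \<bullet> e1 s = 0" "vd e2 s \<bullet> e2 s = 0"
proof -
  note h = hd[OF sm(3) assms] hd[OF sm(4) assms]
  note z = derivative_zero_if_constant[OF I assms]
  show "vd e1 s \<bullet> e1 s = 0" using z[OF on(1) inner_derivative[OF h(1) h(1)]] by (simp add: inner_commute)
  show "vd e2 s \<bullet> e2 s = 0" using z[OF on(2) inner_derivative[OF h(2) h(2)]] by (simp add: inner_commute)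
  show "vd e2 s \<bullet> e1 s = 0" using z[OF on(3) inner_derivative[OF h(1) h(2)]] par[OF assms] by (simp add: inner_commute)
qed

definition "X0 s = trig_vec (c s) (B s) (C s)"
definition "X1 s = trig_vec (vd c s) (vd B s) (vd C s)"
definition "X2 s = trig_vec 0 (C s) (- B s)"
definition "X11 s = trig_vec (vd (vd c) s) (vd (vd B) s) (vd (vd C) s)"
definition "X12 s = trig_vec 0 (vd C s) (- vd B s)"
definition "X22 s = trig_vec 0 (- B s) (- C s)"

lemma partials:
  assumes "s \<in> I"
  shows "((\<lambda>x. X0 (fst x) (snd x)) has_derivative (\<lambda>h. fst h *\<^sub>R X1 s \<theta> + snd h *\<^sub>R X2 s \<theta>)) (at (s, \<theta>))"
    "((\<lambda>x. X1 (fst x) (snd x)) has_derivative (\<lambda>h. fst h *\<^sub>R X11 s \<theta> + snd h *\<^sub>R X12 s \<theta>)) (at (s, \<theta>))"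
    "((\<lambda>x. X2 (fst x) (snd x)) has_derivative (\<lambda>h. fst h *\<^sub>R X12 s \<theta> + snd h *\<^sub>R X22 s \<theta>)) (at (s, \<theta>))"
proof -
  show "((\<lambda>x. X0 (fst x) (snd x)) has_derivative (\<lambda>h. fst h *\<^sub>R X1 s \<theta> + snd h *\<^sub>R X2 s \<theta>)) (at (s, \<theta>))"
    unfolding X0_def X1_def X2_def by (rule trig_family_derivative[OF sm(1) smBC assms])
  show "((\<lambda>x. X1 (fst x) (snd x)) has_derivative (\<lambda>h. fst h *\<^sub>R X11 s \<theta> + snd h *\<^sub>R X12 s \<theta>)) (at (s, \<theta>))"
    unfolding X1_def X11_def X12_def
    by (rule trig_family_derivative[OF smooth_on_vector_derivative[OF I sm(1)] smooth_on_vector_derivative[OF I smBC(1)]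
        smooth_on_vector_derivative[OF I smBC(2)] assms])
  have "((\<lambda>s. - B s) has_vector_derivative - vd B s) (at s)"
    using hd[OF smBC(1) assms] by (auto intro!: derivative_eq_intros)
  then have m: "vd (\<lambda>s. - B s) s = - vd B s" by (rule vector_derivative_at)
  have z: "vd (\<lambda>s. 0 :: C2) s = 0" by (simp add: vector_derivative_const_at)
  show "((\<lambda>x. X2 (fst x) (snd x)) has_derivative (\<lambda>h. fst h *\<^sub>R X12 s \<theta> + snd h *\<^sub>R X22 s \<theta>)) (at (s, \<theta>))"
    using trig_family_derivative[OF smooth_on_const smBC(2) smooth_on_minus[OF I smBC(1)] assms, of 0 \<theta>]
    unfolding X2_def X12_def X22_def m z by simp
qed

lemma param': "x \<in> I \<times> {-\<delta><..<\<delta>} \<Longrightarrow> F (\<xi> x) = X0 (fst x) (snd x)"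
  by (subst param) (auto simp: circle_family_def X0_def trig_vec_def B_def C_def mult.commute split: prod.splits)

lemma lagrangian_local: "s \<in> I \<Longrightarrow> \<bar>\<theta>\<bar> < \<delta> \<Longrightarrow> X1 s \<theta> \<bullet> J (X2 s \<theta>) = 0"
  by (rule lagrangian_partials[OF chart lagr param' _ partials(1)]) auto

lemma lagrangian_all:
  assumes s: "s \<in> I"
  shows "X1 s \<theta> \<bullet> J (X2 s \<theta>) = 0"
proof (rule trig_poly_eq_0[where f = "\<lambda>\<theta>. X1 s \<theta> \<bullet> J (X2 s \<theta>)", OF _ \<delta>])
  show "trig_poly (\<lambda>\<theta>. X1 s \<theta> \<bullet> J (X2 s \<theta>))"
    unfolding X1_def X2_def J_trig_vec by (rule trig_poly_trig_vec_inner)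
qed (use lagrangian_local[OF s] in auto)

text \<open>The cubic form \<open>\<langle>X_ij, J X_k\<rangle>\<close> of a Lagrangian immersion is symmetric: differentiate the Lagrangian condition.\<close>

lemma X12_symmetric:
  assumes s: "s \<in> I"
  shows "X11 s \<theta> \<bullet> J (X2 s \<theta>) = X12 s \<theta> \<bullet> J (X1 s \<theta>)"
proof -
  have line: "((\<lambda>s. G (s, \<theta>)) has_vector_derivative g1) (at s)"
    if G: "(G has_derivative (\<lambda>h. fst h *\<^sub>R g1 + snd h *\<^sub>R g2)) (at (s, \<theta>))" for G :: "real \<times> real \<Rightarrow> C2" and g1 g2
  proof -
    have "((\<lambda>s. (s, \<theta>)) has_derivative (\<lambda>h. (h, 0))) (at s)" by (auto intro!: derivative_eq_intros)
    from has_derivative_compose[OF this G] show ?thesis by (simp add: has_vector_derivative_def)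
  qed
  have "X1 s \<theta> \<bullet> J (X12 s \<theta>) + X11 s \<theta> \<bullet> J (X2 s \<theta>) = 0"
    using derivative_zero_if_constant[OF I s lagrangian_all
       inner_derivative[OF line[OF partials(2)[OF s, of \<theta>]] J_derivative[OF line[OF partials(3)[OF s, of \<theta>]]], simplified]]
    by simp
  then show ?thesis using inner_J_left[of "X1 s \<theta>" "X12 s \<theta>"] inner_commute[of "J (X1 s \<theta>)" "X12 s \<theta>"] by simp
qed

lemma soliton_local:
  assumes s: "s \<in> I" and \<theta>: "\<bar>\<theta>\<bar> < \<delta>"
  shows "(X1 s \<theta> \<bullet> X1 s \<theta>) * (X2 s \<theta> \<bullet> X2 s \<theta>) - (X1 s \<theta> \<bullet> X2 s \<theta>)\<^sup>2 > 0"
    and "\<nu> \<bullet> X1 s \<theta> = 0 \<Longrightarrow> \<nu> \<bullet> X2 s \<theta> = 0 \<Longrightarrow>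
      (X2 s \<theta> \<bullet> X2 s \<theta>) * (X11 s \<theta> \<bullet> \<nu>) - 2 * (X1 s \<theta> \<bullet> X2 s \<theta>) * (X12 s \<theta> \<bullet> \<nu>) + (X1 s \<theta> \<bullet> X1 s \<theta>) * (X22 s \<theta> \<bullet> \<nu>)
        + lam * ((X1 s \<theta> \<bullet> X1 s \<theta>) * (X2 s \<theta> \<bullet> X2 s \<theta>) - (X1 s \<theta> \<bullet> X2 s \<theta>)\<^sup>2) * (X0 s \<theta> \<bullet> \<nu>) = 0"
proof -
  have x: "(s, \<theta>) \<in> I \<times> {-\<delta><..<\<delta>}" using s \<theta> by auto
  have d: "((\<lambda>x. X0 (fst x) (snd x)) has_derivative (\<lambda>h. fst h *\<^sub>R X1 (fst y) (snd y) + snd h *\<^sub>R X2 (fst y) (snd y))) (at y)"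
    if "y \<in> I \<times> {-\<delta><..<\<delta>}" for y
    using partials(1)[of "fst y" "snd y"] that by auto
  note T = self_similar_tested[OF chart soliton param' x d partials(2)[OF s] partials(3)[OF s]]
  show "(X1 s \<theta> \<bullet> X1 s \<theta>) * (X2 s \<theta> \<bullet> X2 s \<theta>) - (X1 s \<theta> \<bullet> X2 s \<theta>)\<^sup>2 > 0" using T(1) by simp
  show "\<nu> \<bullet> X1 s \<theta> = 0 \<Longrightarrow> \<nu> \<bullet> X2 s \<theta> = 0 \<Longrightarrow>
      (X2 s \<theta> \<bullet> X2 s \<theta>) * (X11 s \<theta> \<bullet> \<nu>) - 2 * (X1 s \<theta> \<bullet> X2 s \<theta>) * (X12 s \<theta> \<bullet> \<nu>) + (X1 s \<theta> \<bullet> X1 s \<theta>) * (X22 s \<theta> \<bullet> \<nu>)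
        + lam * ((X1 s \<theta> \<bullet> X1 s \<theta>) * (X2 s \<theta> \<bullet> X2 s \<theta>) - (X1 s \<theta> \<bullet> X2 s \<theta>)\<^sup>2) * (X0 s \<theta> \<bullet> \<nu>) = 0"
    using T(2)[of \<nu>] by simp
qed

text \<open>Here the equations pass from the arc covered by the chart to the whole circle.\<close>

lemma jet:
  assumes s: "s \<in> I"
  shows "circle_jet (e1 s) (e2 s) (vd e1 s) (vd e2 s) (c s) (vd c s) (r s) (vd r s) lam"
proof -
  let ?f = "\<lambda>\<theta>. (X2 s \<theta> \<bullet> X2 s \<theta>) * (X12 s \<theta> \<bullet> J (X1 s \<theta>)) - 2 * (X1 s \<theta> \<bullet> X2 s \<theta>) * (X22 s \<theta> \<bullet> J (X1 s \<theta>)) + (X1 s \<theta> \<bullet> X1 s \<theta>) * (X22 s \<theta> \<bullet> J (X2 s \<theta>))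
        + lam * ((X1 s \<theta> \<bullet> X1 s \<theta>) * (X2 s \<theta> \<bullet> X2 s \<theta>) - (X1 s \<theta> \<bullet> X2 s \<theta>)\<^sup>2) * (X0 s \<theta> \<bullet> J (X2 s \<theta>))"
  have eq: "?f \<theta> = 0" for \<theta>
  proof (rule trig_poly_eq_0[where f = ?f, OF _ \<delta>])
    show "trig_poly ?f"
      unfolding X0_def X1_def X2_def X12_def X22_def J_trig_vec
      by (intro trig_poly_add trig_poly_diff trig_poly_mult trig_poly_power2 trig_poly_const trig_poly_trig_vec_inner)
    fix \<theta> assume \<theta>: "\<bar>\<theta>\<bar> < \<delta>"
    have "J (X2 s \<theta>) \<bullet> X1 s \<theta> = 0" using lagrangian_all[OF s] by (simp add: inner_commute)
    moreover have "X12 s \<theta> \<bullet> J (X2 s \<theta>) = X22 s \<theta> \<bullet> J (X1 s \<theta>)"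
    proof -
      have lin: "X1 s \<theta> \<bullet> J (X22 s \<theta>) + X12 s \<theta> \<bullet> J (X2 s \<theta>) = 0"
      proof (rule derivative_zero_if_constant[OF open_UNIV UNIV_I lagrangian_all[OF s]])
        have "(trig_vec A B C has_vector_derivative trig_vec 0 C (- B) \<theta>) (at \<theta>)" for A B C
          unfolding trig_vec_def
          by (auto intro!: derivative_eq_intros simp: has_vector_derivative_def fun_eq_iff algebra_simps)
        then have "(X1 s has_vector_derivative X12 s \<theta>) (at \<theta>)" "(X2 s has_vector_derivative X22 s \<theta>) (at \<theta>)"
          unfolding X1_def X2_def X12_def X22_def by auto
        then show "((\<lambda>\<theta>. X1 s \<theta> \<bullet> J (X2 s \<theta>)) has_vector_derivative X1 s \<theta> \<bullet> J (X22 s \<theta>) + X12 s \<theta> \<bullet> J (X2 s \<theta>)) (at \<theta>)"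
          by (intro inner_derivative J_derivative)
      qed
      then show ?thesis using inner_J_left[of "X1 s \<theta>" "X22 s \<theta>"] inner_commute[of "J (X1 s \<theta>)" "X22 s \<theta>"] by simp
    qed
    ultimately show "?f \<theta> = 0" using soliton_local(2)[OF s \<theta>, of "J (X2 s \<theta>)"] X12_symmetric[OF s, of \<theta>] by simp
  qed
  have pos: "(X1 s 0 \<bullet> X1 s 0) * (X2 s 0 \<bullet> X2 s 0) - (X1 s 0 \<bullet> X2 s 0)\<^sup>2 > 0"
    by (rule soliton_local(1)[OF s]) (use \<delta> in simp)
  note X = X0_def X1_def X2_def X12_def X22_def vdBC[OF s] B_def C_def
  show ?thesis
    by (rule circle_jet.intro; (rule lagrangian_all[OF s, unfolded X] eq[unfolded X] pos[unfolded X])?)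
       (use on s par vd_frame rpos lam in auto)
qed

text \<open>The equation tested with \<open>J X_s\<close>, which is where second derivatives in \<open>s\<close> enter. One point of each circle
  carries its content, because the meridian \<open>\<theta> = 0\<close> or the curve of centres generates the surface.\<close>

lemma soliton_meridian:
  assumes s: "s \<in> I"
  shows "(r s)\<^sup>2 * ((vd (vd c) s + vd (vd B) s) \<bullet> J (vd c s + vd B s))
      - 2 * ((vd c s + vd B s) \<bullet> C s) * (vd C s \<bullet> J (vd c s + vd B s))
      - ((vd c s + vd B s) \<bullet> (vd c s + vd B s)) * (B s \<bullet> J (vd c s + vd B s))
      + lam * (((vd c s + vd B s) \<bullet> (vd c s + vd B s)) * (r s)\<^sup>2 - ((vd c s + vd B s) \<bullet> C s)\<^sup>2) * ((c s + B s) \<bullet> J (vd c s + vd B s)) = 0"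
    and "vd c s + vd B s \<noteq> 0"
proof -
  have X: "X0 s 0 = c s + B s" "X1 s 0 = vd c s + vd B s" "X2 s 0 = C s" "X11 s 0 = vd (vd c) s + vd (vd B) s"
    "X12 s 0 = vd C s" "X22 s 0 = - B s"
    by (simp_all add: X0_def X1_def X2_def X11_def X12_def X22_def trig_vec_def)
  have G: "C s \<bullet> C s = (r s)\<^sup>2" using on(2)[OF s] by (simp add: C_def power2_eq_square)
  have 0: "\<bar>0\<bar> < \<delta>" using \<delta> by simp
  have n: "J (X1 s 0) \<bullet> X2 s 0 = 0" using lagrangian_all[OF s, of 0] inner_J_left[of "X1 s 0" "X2 s 0"] by simp
  from soliton_local(2)[OF s 0 inner_J_self(2) n] show "(r s)\<^sup>2 * ((vd (vd c) s + vd (vd B) s) \<bullet> J (vd c s + vd B s))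
      - 2 * ((vd c s + vd B s) \<bullet> C s) * (vd C s \<bullet> J (vd c s + vd B s))
      - ((vd c s + vd B s) \<bullet> (vd c s + vd B s)) * (B s \<bullet> J (vd c s + vd B s))
      + lam * (((vd c s + vd B s) \<bullet> (vd c s + vd B s)) * (r s)\<^sup>2 - ((vd c s + vd B s) \<bullet> C s)\<^sup>2) * ((c s + B s) \<bullet> J (vd c s + vd B s)) = 0"
    unfolding X G by simp
  show "vd c s + vd B s \<noteq> 0" using soliton_local(1)[OF s 0] unfolding X by auto
qed

text \<open>The cosine of the Kaehler angle of the plane of the circle with parameter \<open>s\<close>.\<close>

definition "w s = e1 s \<bullet> J (e2 s)"

lemma w_jet: "circle_jet.w (e1 s) (e2 s) = w s" if "s \<in> I"
  using circle_jet.w_def[OF jet[OF that]] by (simp add: w_def)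

lemma continuous_jet: "continuous_on I c" "continuous_on I (vd c)" "continuous_on I (vd e1)" "continuous_on I (vd e2)" "continuous_on I w"
  unfolding w_def
  by (intro smooth_on_continuous smooth_on_vector_derivative[OF I] smooth_on_inner[OF I] sm
      smooth_on_linear_compose[OF I bounded_linear_J])+

text \<open>The relations \<open>\<langle>c, J e_j\<rangle> = 0\<close> hold near \<open>s\<close>; since also \<open>\<langle>c', J e_j\<rangle> = 0\<close>, their derivatives say
  \<open>\<langle>c, J e_j'\<rangle> = 0\<close>.\<close>

lemma centre_zero_or_plane_parallel:
  assumes s: "s \<in> I" and w1: "\<bar>w s\<bar> < 1"
  shows "c s = 0 \<or> vd e1 s = 0 \<and> vd e2 s = 0"
proof -
  note cj = jet[OF s]
  define N where "N = I \<inter> w -` {-1<..<1}"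
  have N: "open N" unfolding N_def by (rule continuous_open_preimage[OF continuous_jet(5) I]) auto
  have sN: "s \<in> N" using s w1 by (auto simp: N_def)
  have z: "c t \<bullet> J (e1 t) = 0" "c t \<bullet> J (e2 t) = 0" if "t \<in> N" for t
  proof -
    have t: "t \<in> I" "\<bar>w t\<bar> < 1" using that by (auto simp: N_def)
    show "c t \<bullet> J (e1 t) = 0" "c t \<bullet> J (e2 t) = 0"
      using circle_jet.centre_normal[OF jet[OF t(1)], unfolded w_jet[OF t(1)], OF t(2)] .
  qed
  have "c s \<bullet> J (vd e1 s) + vd c s \<bullet> J (e1 s) = 0" "c s \<bullet> J (vd e2 s) + vd c s \<bullet> J (e2 s) = 0"
    using derivative_zero_if_constant[OF N sN z(1) inner_derivative[OF hd[OF sm(1) s] J_derivative[OF hd[OF sm(3) s]]]]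
      derivative_zero_if_constant[OF N sN z(2) inner_derivative[OF hd[OF sm(1) s] J_derivative[OF hd[OF sm(4) s]]]]
    by simp_all
  then show ?thesis
    using circle_jet.centre_zero_or_parallel[OF cj] circle_jet.lagrangian_relations(1,2)[OF cj] w1 unfolding w_jet[OF s] by simp
qed

lemma centre_zero_near:
  assumes s: "s \<in> I" "\<bar>w s\<bar> < 1" and nz: "vd e1 s \<noteq> 0 \<or> vd e2 s \<noteq> 0"
  obtains N where "open N" "s \<in> N" "N \<subseteq> I" "\<And>t. t \<in> N \<Longrightarrow> c t = 0"
proof -
  have c: "continuous_on I (\<lambda>t. (vd e1 t, vd e2 t))" using continuous_jet by (intro continuous_intros)
  obtain N where N: "open N" "s \<in> N" "N \<subseteq> I" "\<And>t. t \<in> N \<Longrightarrow> (vd e1 t, vd e2 t) \<noteq> 0"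
    by (rule nonzero_near[OF c I s(1)]) (use nz in \<open>auto simp: zero_prod_def\<close>)
  define N' where "N' = I \<inter> w -` {-1<..<1}"
  have N': "open N'" unfolding N'_def by (rule continuous_open_preimage[OF continuous_jet(5) I]) auto
  show ?thesis
  proof (rule that[of "N \<inter> N'"])
    show "open (N \<inter> N')" using N N' by auto
    show "s \<in> N \<inter> N'" using N s by (auto simp: N'_def)
    show "N \<inter> N' \<subseteq> I" using N by auto
    show "c t = 0" if "t \<in> N \<inter> N'" for t
      using centre_zero_or_plane_parallel[of t] N(4)[of t] that by (auto simp: N'_def zero_prod_def)
  qed
qed

lemma vd_zero: "open N \<Longrightarrow> t \<in> N \<Longrightarrow> N \<subseteq> I \<Longrightarrow> (\<And>t. t \<in> N \<Longrightarrow> f t = k) \<Longrightarrow> smooth_on I f \<Longrightarrow> vd f t = 0"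
  by (rule derivative_zero_if_constant[of N t f k]) (auto intro: hd)

text \<open>Where the plane moves, the centre is zero on a neighbourhood, so that \<open>c' = 0\<close>; both alternatives of
  \<open>kaehler_angle_zero\<close> are covered.\<close>

lemma w_values:
  assumes s: "s \<in> I"
  shows "w s \<in> {-1, 0, 1}"
proof -
  note cj = jet[OF s]
  have "w s = 0" if w1: "\<bar>w s\<bar> < 1"
  proof (cases "vd e1 s = 0 \<and> vd e2 s = 0")
    case True
    then show ?thesis using circle_jet.kaehler_angle_zero[OF cj] w1 unfolding w_jet[OF s] by blast
  next
    case False
    then obtain N where N: "open N" "s \<in> N" "N \<subseteq> I" "\<And>t. t \<in> N \<Longrightarrow> c t = 0"
      using centre_zero_near[OF s w1] by blast
    have "vd c s = 0" by (rule vd_zero[OF N sm(1)])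
    then show ?thesis using circle_jet.kaehler_angle_zero[OF cj] w1 unfolding w_jet[OF s] by blast
  qed
  moreover have "\<bar>w s\<bar> \<le> 1"
  proof -
    have "norm (e1 s) = 1" "norm (e2 s) = 1" using on(1,2)[OF s] by (simp_all add: norm_eq_1)
    then show ?thesis using Cauchy_Schwarz_ineq2[of "e1 s" "J (e2 s)"] by (simp add: w_def)
  qed
  ultimately show ?thesis by (cases "\<bar>w s\<bar> < 1") auto
qed

text \<open>The planes of the circles are thus either all Lagrangian or all complex with the same orientation; a
  continuous function with finitely many values is constant on an interval.\<close>

lemma w_constant:
  obtains \<epsilon> where "\<epsilon> \<in> {-1, 0, 1}" "\<And>s. s \<in> I \<Longrightarrow> w s = \<epsilon>"
proof (cases "I = {}")
  case True
  then show ?thesis using that[of 0] by auto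
next
  case False
  have "w ` I \<subseteq> {-1, 0, 1}" using w_values by blast
  then have "finite (w ` I)" using finite_subset by blast
  then have "w constant_on I"
    by (intro continuous_finite_range_constant continuous_jet(5)) (auto simp: connected_Ioo)
  then obtain k where k: "\<And>s. s \<in> I \<Longrightarrow> w s = k" unfolding constant_on_def by blast
  obtain s where "s \<in> I" using False by blast
  then have "k \<in> {-1, 0, 1}" using w_values k by metis
  then show ?thesis using k by (rule that)
qed

end

section \<open>Unitary coordinates and the model surfaces\<close>

text \<open>The two Hermitian products with \<open>\<epsilon>1\<close> and \<open>\<epsilon>2\<close>; their imaginary parts are the real products with
  \<open>J \<epsilon>1\<close> and \<open>J \<epsilon>2\<close>.\<close>

definition unitary_coords :: "C2 \<Rightarrow> C2 \<Rightarrow> C2 \<Rightarrow> C2" where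
  "unitary_coords \<epsilon>1 \<epsilon>2 z = (Complex (z \<bullet> \<epsilon>1) (z \<bullet> J \<epsilon>1), Complex (z \<bullet> \<epsilon>2) (z \<bullet> J \<epsilon>2))"

locale unitary_basis =
  fixes \<epsilon>1 \<epsilon>2 :: C2
  assumes \<epsilon>: "\<epsilon>1 \<bullet> \<epsilon>1 = 1" "\<epsilon>2 \<bullet> \<epsilon>2 = 1" "\<epsilon>1 \<bullet> \<epsilon>2 = 0" "\<epsilon>1 \<bullet> J \<epsilon>2 = 0"
begin

abbreviation "U \<equiv> unitary_coords \<epsilon>1 \<epsilon>2"

lemma \<epsilon>': "\<epsilon>2 \<bullet> \<epsilon>1 = 0" "\<epsilon>2 \<bullet> J \<epsilon>1 = 0"
  using \<epsilon>(3,4) inner_J_left[of \<epsilon>2 \<epsilon>1] inner_commute[of "J \<epsilon>2" \<epsilon>1] by (auto simp: inner_commute)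

lemma U_linear: "linear U"
  by (rule linearI) (simp_all add: unitary_coords_def inner_add_left complex_eq_iff prod_eq_iff)

lemma U_bounded_linear: "bounded_linear U"
  using U_linear linear_conv_bounded_linear by blast

lemma U_simps: "U (y + z) = U y + U z" "U (k *\<^sub>R z) = k *\<^sub>R U z" "U (- z) = - U z" "U (y - z) = U y - U z" "U 0 = 0"
  using linear_add[OF U_linear] linear_scale[OF U_linear] linear_neg[OF U_linear] linear_diff[OF U_linear] linear_0[OF U_linear] by auto

lemma U_inner: "U y \<bullet> U z = y \<bullet> z"
proof -
  have n: "J \<epsilon>1 \<bullet> J \<epsilon>1 = 1" "J \<epsilon>2 \<bullet> J \<epsilon>2 = 1" "\<epsilon>1 \<bullet> J \<epsilon>1 = 0" "\<epsilon>2 \<bullet> J \<epsilon>2 = 0" "J \<epsilon>1 \<bullet> J \<epsilon>2 = 0" by (simp_all add: \<epsilon>)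
  have "y \<bullet> z = ((y \<bullet> \<epsilon>1) *\<^sub>R \<epsilon>1 + (y \<bullet> \<epsilon>2) *\<^sub>R \<epsilon>2 + (y \<bullet> J \<epsilon>1) *\<^sub>R J \<epsilon>1 + (y \<bullet> J \<epsilon>2) *\<^sub>R J \<epsilon>2) \<bullet> z"
    using orthonormal_frame_expand[OF \<epsilon>(1,2) n(1,2) \<epsilon>(3) n(3) \<epsilon>(4) \<epsilon>'(2) n(4,5), of y] by simp
  moreover have "(Complex a b, Complex c d) \<bullet> (Complex a' b', Complex c' d') = a * a' + b * b' + c * c' + d * d'"
    for a b c d a' b' c' d' by (simp add: inner_prod_def inner_complex_def)
  ultimately show ?thesis
    unfolding unitary_coords_def
    by (simp add: inner_add_left inner_commute[of z \<epsilon>1] inner_commute[of z \<epsilon>2] inner_commute[of z "J \<epsilon>1"] inner_commute[of z "J \<epsilon>2"])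
qed

lemma U_J: "U (J z) = J (U z)"
  by (simp add: unitary_coords_def J_def[of "(_, _)"] inner_J_left complex_eq_iff)

lemma U_basis: "U \<epsilon>1 = (1, 0)" "U \<epsilon>2 = (0, 1)"
  by (simp_all add: unitary_coords_def \<epsilon> \<epsilon>' complex_eq_iff)

lemma congruence_U: "congruence (\<lambda>z. U z + b)"
  unfolding congruence_def
  by (rule exI[of _ U], rule exI[of _ b]) (simp add: orthogonal_transformation_def U_linear U_inner U_J)

lemma U_nonzero: "U z = 0 \<longleftrightarrow> z = 0"
  using U_inner[of z z] by (metis inner_eq_zero_iff)

end

text \<open>The curve equations in a form that is free of square roots.\<close>

lemma curvature_equation_iff:
  assumes "vd \<gamma> s \<noteq> 0"
  shows "curvature \<gamma> s = \<kappa> * (\<gamma> s \<bullet> unit_normal \<gamma> s) \<longleftrightarrow>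
    vd (vd \<gamma>) s \<bullet> (\<i> * vd \<gamma> s) = \<kappa> * (vd \<gamma> s \<bullet> vd \<gamma> s) * (\<gamma> s \<bullet> (\<i> * vd \<gamma> s))"
proof -
  let ?n = "norm (vd \<gamma> s)"
  have N: "unit_normal \<gamma> s = (1 / ?n) *\<^sub>R (\<i> * vd \<gamma> s)"
    unfolding unit_normal_def sgn_div_norm by (simp add: inverse_eq_divide)
  have n: "?n > 0" "vd \<gamma> s \<bullet> vd \<gamma> s = ?n\<^sup>2" using assms by (simp_all add: dot_square_norm)
  show ?thesis
    unfolding curvature_def N n(2) inner_scaleR_right using n(1) by (simp add: field_simps power2_eq_square)
qed

lemma trig_family_smooth_immersion:
  fixes A B C :: "real \<Rightarrow> C2"
  assumes sm: "smooth_on {a<..<b} A" "smooth_on {a<..<b} B" "smooth_on {a<..<b} C"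
  defines "X \<equiv> (\<lambda>x. trig_vec (A (fst x)) (B (fst x)) (C (fst x)) (snd x))"
  shows "smooth_on ({a<..<b} \<times> UNIV) X"
    and "s \<in> {a<..<b} \<Longrightarrow> (let X1 = trig_vec (vd A s) (vd B s) (vd C s) \<theta>; X2 = trig_vec 0 (C s) (- B s) \<theta>
           in (X1 \<bullet> X1) * (X2 \<bullet> X2) - (X1 \<bullet> X2)\<^sup>2 > 0) \<Longrightarrow> inj (frechet_derivative X (at (s, \<theta>)))"
proof -
  have "X = circle_family A (\<lambda>s. 1) B C" by (auto simp: X_def circle_family_def trig_vec_def)
  then show "smooth_on ({a<..<b} \<times> UNIV) X" using smooth_on_circle_family[OF sm(1) smooth_on_const sm(2,3)] by simp
  assume "s \<in> {a<..<b}" and pos: "let X1 = trig_vec (vd A s) (vd B s) (vd C s) \<theta>; X2 = trig_vec 0 (C s) (- B s) \<theta>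
           in (X1 \<bullet> X1) * (X2 \<bullet> X2) - (X1 \<bullet> X2)\<^sup>2 > 0"
  from trig_family_derivative[OF sm \<open>s \<in> {a<..<b}\<close>, of \<theta>, folded X_def]
  have "frechet_derivative X (at (s, \<theta>)) = (\<lambda>h. fst h *\<^sub>R trig_vec (vd A s) (vd B s) (vd C s) \<theta> + snd h *\<^sub>R trig_vec 0 (C s) (- B s) \<theta>)"
    by (rule frechet_derivative_at[symmetric])
  then show "inj (frechet_derivative X (at (s, \<theta>)))"
    using gram_pos_imp_inj[OF pos[unfolded Let_def]] by (simp only:)
qed

lemma bounded_linear_Pair_0: "bounded_linear (\<lambda>z::complex. (z, 0 :: complex))" "bounded_linear (\<lambda>z::complex. (0 :: complex, z))"
  by (auto intro: bounded_linear_Pair bounded_linear_ident bounded_linear_zero)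

lemma Pair_0_derivative:
  fixes \<gamma>' :: complex
  assumes "(\<gamma> has_vector_derivative \<gamma>') (at s)"
  shows "vd (\<lambda>s. (\<gamma> s, 0 :: complex)) s = (\<gamma>', 0)" "vd (\<lambda>s. (0 :: complex, \<gamma> s)) s = (0, \<gamma>')"
  using bounded_linear.has_vector_derivative[OF bounded_linear_Pair_0(1) assms]
    bounded_linear.has_vector_derivative[OF bounded_linear_Pair_0(2) assms] vector_derivative_at by blast+

lemma centered_type_I_smooth_immersion:
  assumes "smooth_on {a<..<b} (polar_curve r \<phi>)"
  shows "smooth_on ({a<..<b} \<times> UNIV) (centered_type_I r \<phi>)"
    and "s \<in> {a<..<b} \<Longrightarrow> polar_curve r \<phi> s \<noteq> 0 \<Longrightarrow> vd (polar_curve r \<phi>) s \<noteq> 0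
      \<Longrightarrow> inj (frechet_derivative (centered_type_I r \<phi>) (at (s, \<theta>)))"
proof -
  let ?\<gamma> = "polar_curve r \<phi>" and ?I = "{a<..<b}"
  let ?B = "\<lambda>s. (?\<gamma> s, 0 :: complex)" and ?C = "\<lambda>s. (0 :: complex, ?\<gamma> s)"
  have I: "open ?I" by simp
  have eq: "centered_type_I r \<phi> = (\<lambda>x. trig_vec 0 (?B (fst x)) (?C (fst x)) (snd x))"
    by (auto simp: centered_type_I_def trig_vec_def scaleR_conv_of_real mult.commute)
  note sm = smooth_on_const[of ?I 0] smooth_on_linear_compose[OF I bounded_linear_Pair_0(1) assms]
    smooth_on_linear_compose[OF I bounded_linear_Pair_0(2) assms]
  show "smooth_on (?I \<times> UNIV) (centered_type_I r \<phi>)"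
    unfolding eq using trig_family_smooth_immersion(1)[OF sm] .
  assume s: "s \<in> ?I" "?\<gamma> s \<noteq> 0" "vd ?\<gamma> s \<noteq> 0"
  have d: "vd (\<lambda>s. 0 :: C2) s = 0" "vd ?B s = (vd ?\<gamma> s, 0)" "vd ?C s = (0, vd ?\<gamma> s)"
    using Pair_0_derivative[OF smooth_on_has_vector_derivative[OF assms s(1)]] by (simp_all add: vector_derivative_const_at)
  define x y where "x = cos \<theta>" and "y = sin \<theta>"
  have xy: "x * x + y * y = 1" by (simp add: x_def y_def)
  let ?G = "vd ?\<gamma> s"
  have "(trig_vec 0 (?G, 0) (0, ?G) \<theta> \<bullet> trig_vec 0 (?G, 0) (0, ?G) \<theta>) = (x * x + y * y) * (?G \<bullet> ?G)"
    "(trig_vec 0 (0, ?\<gamma> s) (- (?\<gamma> s, 0)) \<theta> \<bullet> trig_vec 0 (0, ?\<gamma> s) (- (?\<gamma> s, 0)) \<theta>) = (x * x + y * y) * (?\<gamma> s \<bullet> ?\<gamma> s)"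
    "trig_vec 0 (?G, 0) (0, ?G) \<theta> \<bullet> trig_vec 0 (0, ?\<gamma> s) (- (?\<gamma> s, 0)) \<theta> = 0"
    unfolding trig_vec_def x_def[symmetric] y_def[symmetric] by (simp_all add: algebra_simps)
  then show "inj (frechet_derivative (centered_type_I r \<phi>) (at (s, \<theta>)))"
    unfolding eq using s
    by (intro trig_family_smooth_immersion(2)[OF sm]) (simp_all add: d xy)
qed

lemma circle_times_curve_smooth_immersion:
  assumes "smooth_on {a<..<b} \<Gamma>" "\<rho> > 0"
  shows "smooth_on ({a<..<b} \<times> UNIV) (circle_times_curve \<rho> \<Gamma>)"
    and "s \<in> {a<..<b} \<Longrightarrow> vd \<Gamma> s \<noteq> 0 \<Longrightarrow> inj (frechet_derivative (circle_times_curve \<rho> \<Gamma>) (at (s, \<theta>)))"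
proof -
  let ?I = "{a<..<b}"
  let ?A = "\<lambda>s. (0 :: complex, \<Gamma> s)" and ?B = "(complex_of_real \<rho>, 0 :: complex)" and ?C = "(\<i> * complex_of_real \<rho>, 0 :: complex)"
  have I: "open ?I" by simp
  have eq: "circle_times_curve \<rho> \<Gamma> = (\<lambda>x. trig_vec (?A (fst x)) ?B ?C (snd x))"
    by (auto simp: circle_times_curve_def trig_vec_def scaleR_conv_of_real cis_conv_exp[symmetric] complex_eq_iff)
  note sm = smooth_on_linear_compose[OF I bounded_linear_Pair_0(2) assms(1)] smooth_on_const[of ?I ?B] smooth_on_const[of ?I ?C]
  show "smooth_on (?I \<times> UNIV) (circle_times_curve \<rho> \<Gamma>)"
    unfolding eq using trig_family_smooth_immersion(1)[OF sm] .
  assume s: "s \<in> ?I" "vd \<Gamma> s \<noteq> 0"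
  have d: "vd ?A s = (0, vd \<Gamma> s)" "vd (\<lambda>s. ?B) s = 0" "vd (\<lambda>s. ?C) s = 0"
    using Pair_0_derivative(2)[OF smooth_on_has_vector_derivative[OF assms(1) s(1)]] by (simp_all add: vector_derivative_const_at)
  define x y where "x = cos \<theta>" and "y = sin \<theta>"
  have xy: "x * x + y * y = 1" by (simp add: x_def y_def)
  have "(trig_vec (0, vd \<Gamma> s) 0 0 \<theta> \<bullet> trig_vec (0, vd \<Gamma> s) 0 0 \<theta>) = vd \<Gamma> s \<bullet> vd \<Gamma> s"
    "(trig_vec 0 ?C (- ?B) \<theta> \<bullet> trig_vec 0 ?C (- ?B) \<theta>) = \<rho> * \<rho> * (x * x + y * y)"
    "trig_vec (0, vd \<Gamma> s) 0 0 \<theta> \<bullet> trig_vec 0 ?C (- ?B) \<theta> = 0"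
    unfolding trig_vec_def x_def[symmetric] y_def[symmetric]
    by (simp_all add: algebra_simps inner_complex_def)
  then show "inj (frechet_derivative (circle_times_curve \<rho> \<Gamma>) (at (s, \<theta>)))"
    unfolding eq using s assms(2)
    by (intro trig_family_smooth_immersion(2)[OF sm]) (simp_all add: d xy)
qed

lemma smooth_polar_curve:
  assumes "open S" "smooth_on S r" "smooth_on S \<phi>"
  shows "smooth_on S (polar_curve r \<phi>)"
proof -
  have "polar_curve r \<phi> = (\<lambda>s. (r s * cos (\<phi> s)) *\<^sub>R 1 + (r s * sin (\<phi> s)) *\<^sub>R \<i>)"
    by (auto simp: polar_curve_def cis_conv_exp[symmetric] complex_eq_iff)
  moreover have "smooth_on S \<dots>"
    by (intro smooth_on_add smooth_on_scaleR smooth_on_mult smooth_on_const smooth_on_cos_sin assms)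
  ultimately show ?thesis by simp
qed

section \<open>Lagrangian planes\<close>

lemma (in circle_jet) lagrangian_plane_rotation:
  assumes "w = 0"
  shows "p1 = (p1 \<bullet> J e1) *\<^sub>R J e1" "p2 = (p1 \<bullet> J e1) *\<^sub>R J e2"
proof -
  have KF: "kaehler_frame e1 e2 (J e1) (J e2) w 1"
    by unfold_locales (use e assms in \<open>auto simp: w_def\<close>)
  obtain a b k g1 g2 where j: "w = k * 1" "1 * 1 * (1 + k * k) = 1" "r * b = - k * rd"
    "p1 = vec4 e1 e2 (J e1) (J e2) 0 0 a b" "p2 = vec4 e1 e2 (J e1) (J e2) 0 0 (- b) a"
    by (rule jet_coordinates[OF KF]) blast
  have "b = 0" using j(1,3) assms r by simp
  then have "p1 = a *\<^sub>R J e1" "p2 = a *\<^sub>R J e2" using j(4,5) by (simp_all add: vec4_def)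
  then show "p1 = (p1 \<bullet> J e1) *\<^sub>R J e1" "p2 = (p1 \<bullet> J e1) *\<^sub>R J e2" by (simp_all add: e)
qed

text \<open>Rotating the pair back by \<open>\<phi>\<close> gives a constant pair.\<close>

lemma rotating_pair:
  fixes e f :: "real \<Rightarrow> C2"
  assumes e: "\<And>s. s \<in> {a<..<b} \<Longrightarrow> (e has_vector_derivative \<alpha> s *\<^sub>R f s) (at s)"
    and f: "\<And>s. s \<in> {a<..<b} \<Longrightarrow> (f has_vector_derivative - \<alpha> s *\<^sub>R e s) (at s)"
    and \<phi>: "\<And>s. s \<in> {a<..<b} \<Longrightarrow> (\<phi> has_vector_derivative \<alpha> s) (at s)" "\<phi> s0 = 0"
    and s: "s \<in> {a<..<b}" "s0 \<in> {a<..<b}"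
  shows "e s = cos (\<phi> s) *\<^sub>R e s0 + sin (\<phi> s) *\<^sub>R f s0"
proof -
  define g where "g s = cos (\<phi> s) *\<^sub>R e s - sin (\<phi> s) *\<^sub>R f s" for s
  define h where "h s = sin (\<phi> s) *\<^sub>R e s + cos (\<phi> s) *\<^sub>R f s" for s
  have dgh: "(g has_vector_derivative 0) (at s)" "(h has_vector_derivative 0) (at s)" if s: "s \<in> {a<..<b}" for s
  proof -
    have dc: "((\<lambda>s. cos (\<phi> s)) has_vector_derivative - sin (\<phi> s) * \<alpha> s) (at s)"
      "((\<lambda>s. sin (\<phi> s)) has_vector_derivative cos (\<phi> s) * \<alpha> s) (at s)"
      using \<phi>(1)[OF s] unfolding has_real_derivative_iff_has_vector_derivative[symmetric]
      by (auto intro!: derivative_eq_intros)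
    show "(g has_vector_derivative 0) (at s)" unfolding g_def
      using has_vector_derivative_diff[OF scaleR_derivative[OF dc(1) e[OF s]] scaleR_derivative[OF dc(2) f[OF s]]]
      by (simp add: algebra_simps)
    show "(h has_vector_derivative 0) (at s)" unfolding h_def
      using has_vector_derivative_add[OF scaleR_derivative[OF dc(2) e[OF s]] scaleR_derivative[OF dc(1) f[OF s]]]
      by (simp add: algebra_simps)
  qed
  have "g s = g s0" "h s = h s0" using constant_if_derivative_zero[OF _ s] dgh by blast+
  then have gh: "g s = e s0" "h s = f s0" by (simp_all add: g_def h_def \<phi>(2))
  have "x *\<^sub>R (x *\<^sub>R v - y *\<^sub>R v') + y *\<^sub>R (y *\<^sub>R v + x *\<^sub>R v') = (x\<^sup>2 + y\<^sup>2) *\<^sub>R v" for x y and v v' :: C2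
    by (simp add: algebra_simps power2_eq_square)
  then have "cos (\<phi> s) *\<^sub>R g s + sin (\<phi> s) *\<^sub>R h s = ((cos (\<phi> s))\<^sup>2 + (sin (\<phi> s))\<^sup>2) *\<^sub>R e s"
    unfolding g_def h_def .
  then show ?thesis unfolding gh by simp
qed

lemma open_real_interval:
  fixes s :: real
  assumes "open N" "s \<in> N"
  obtains \<eta> where "\<eta> > 0" "{s-\<eta><..<s+\<eta>} \<subseteq> N"
proof -
  obtain \<eta> where "\<eta> > 0" "ball s \<eta> \<subseteq> N" using assms openE by blast
  moreover have "ball s \<eta> = {s-\<eta><..<s+\<eta>}" by (auto simp: dist_real_def)
  ultimately show ?thesis using that by metis
qed

text \<open>The integrating factor \<open>exp (- Q)\<close> makes the solution constant.\<close>

lemma linear_ode_zero: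
  fixes f q :: "real \<Rightarrow> real"
  assumes f: "\<And>s. s \<in> {a<..<b} \<Longrightarrow> (f has_vector_derivative q s * f s) (at s)" and q: "smooth_on {a<..<b} q"
    and s0: "s0 \<in> {a<..<b}" "f s0 = 0" and s: "s \<in> {a<..<b}"
  shows "f s = 0"
proof -
  obtain Q where Q: "\<And>s. s \<in> {a<..<b} \<Longrightarrow> (Q has_vector_derivative q s) (at s)"
    using smooth_primitive_ex[OF q s0(1)] by blast
  have "((\<lambda>s. f s * exp (- Q s)) has_vector_derivative 0) (at s)" if s: "s \<in> {a<..<b}" for s
    using f[OF s] Q[OF s] unfolding has_real_derivative_iff_has_vector_derivative[symmetric]
    by (auto intro!: derivative_eq_intros simp: algebra_simps)
  then have "f s * exp (- Q s) = f s0 * exp (- Q s0)" using s s0(1) by (rule constant_if_derivative_zero)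
  then show ?thesis using s0(2) by simp
qed

context cyclic_soliton
begin

abbreviation "type_I_at s0 \<equiv>
  \<exists>K r \<phi>. equivariant_self_similar lam K r \<phi> \<and> locally_congruent_at M F (\<xi> (s0, 0)) (K \<times> UNIV) (centered_type_I r \<phi>)"

lemma restrict_chart:
  assumes "open N" "N \<subseteq> I"
  shows "local_param M F (N \<times> {-\<delta><..<\<delta>}) \<xi>"
  by (rule local_param_subset[OF chart]) (use assms in \<open>auto simp: open_Times\<close>)

text \<open>The angular velocity with which a Lagrangian plane turns towards its image under \<open>J\<close>.\<close>

definition "\<alpha> s = vd e1 s \<bullet> J (e1 s)"

lemma smooth_\<alpha>: "smooth_on I \<alpha>"
  unfolding \<alpha>_def
  by (intro smooth_on_inner[OF I] smooth_on_vector_derivative[OF I] smooth_on_linear_compose[OF I bounded_linear_J] sm)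

context
  assumes w0: "\<And>s. s \<in> I \<Longrightarrow> w s = 0"
begin

lemma frame_rotates: "s \<in> I \<Longrightarrow> vd e1 s = \<alpha> s *\<^sub>R J (e1 s)" "s \<in> I \<Longrightarrow> vd e2 s = \<alpha> s *\<^sub>R J (e2 s)"
  unfolding \<alpha>_def using circle_jet.lagrangian_plane_rotation[OF jet] w_jet w0 by auto

lemma e1_J_e2: "s \<in> I \<Longrightarrow> e1 s \<bullet> J (e2 s) = 0" "s \<in> I \<Longrightarrow> e2 s \<bullet> J (e1 s) = 0"
proof -
  show 1: "s \<in> I \<Longrightarrow> e1 s \<bullet> J (e2 s) = 0" using w0 by (simp add: w_def)
  then show "s \<in> I \<Longrightarrow> e2 s \<bullet> J (e1 s) = 0"
    using inner_J_left[of "e2 s" "e1 s"] inner_commute[of "J (e2 s)" "e1 s"] by simp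
qed

lemma \<alpha>_zero_iff: "s \<in> I \<Longrightarrow> \<alpha> s = 0 \<longleftrightarrow> vd e1 s = 0 \<and> vd e2 s = 0"
  using frame_rotates[of s] by (auto simp: \<alpha>_def)

lemma vdB_rotating: "s \<in> I \<Longrightarrow> vd B s = vd r s *\<^sub>R e1 s + (r s * \<alpha> s) *\<^sub>R J (e1 s)"
  using vdBC(1)[of s] frame_rotates(1)[of s] by simp

text \<open>With \<open>c = 0\<close>, the equation along the meridian is the equation of the generating curve.\<close>

lemma meridian_equation:
  assumes N: "open N" "N \<subseteq> I" "\<And>s. s \<in> N \<Longrightarrow> c s = 0" and s: "s \<in> N"
  shows "(r s)\<^sup>2 * (vd (vd B) s \<bullet> J (vd B s)) = (vd B s \<bullet> vd B s) * (1 - lam * (r s)\<^sup>2) * (B s \<bullet> J (vd B s))" "vd B s \<noteq> 0"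
proof -
  have sI: "s \<in> I" using N s by auto
  have c1: "vd c t = 0" if "t \<in> N" for t by (rule vd_zero[OF N(1) that N(2,3) sm(1)])
  have c2: "vd (vd c) s = 0" by (rule vd_zero[OF N(1) s N(2) c1 smooth_on_vector_derivative[OF I sm(1)]])
  have BC: "vd B s \<bullet> C s = 0"
    unfolding vdB_rotating[OF sI] C_def using on(3)[OF sI] e1_J_e2[OF sI]
    by (simp add: inner_add_left inner_J_left)
  show "(r s)\<^sup>2 * (vd (vd B) s \<bullet> J (vd B s)) = (vd B s \<bullet> vd B s) * (1 - lam * (r s)\<^sup>2) * (B s \<bullet> J (vd B s))"
    using soliton_meridian(1)[OF sI] unfolding N(3)[OF s] c1[OF s] c2 by (simp add: BC algebra_simps)
  show "vd B s \<noteq> 0" using soliton_meridian(2)[OF sI] unfolding c1[OF s] by simp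
qed

text \<open>The unitary coordinates with respect to the frame at \<open>s0\<close> map \<open>r e1\<close> to \<open>(r exp(i \<phi>), 0)\<close> and \<open>r e2\<close> to
  \<open>(0, r exp(i \<phi>))\<close>. They preserve inner products and commute with \<open>J\<close>, which turns the meridian equation
  into the equation of the curve.\<close>

lemma type_I_if_centred:
  assumes N: "open N" "N \<subseteq> I" "\<And>s. s \<in> N \<Longrightarrow> c s = 0" and s0: "s0 \<in> N"
  shows "type_I_at s0"
proof -
  obtain \<eta> where \<eta>: "\<eta> > 0" "{s0-\<eta><..<s0+\<eta>} \<subseteq> N" using open_real_interval[OF N(1) s0] by blast
  let ?K = "{s0-\<eta><..<s0+\<eta>}"
  have KI: "?K \<subseteq> I" using \<eta> N by auto
  have s0K: "s0 \<in> ?K" and s0I: "s0 \<in> I" using \<eta> N s0 by auto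
  obtain \<phi> where \<phi>: "smooth_on I \<phi>" "\<phi> s0 = 0" "\<And>s. s \<in> I \<Longrightarrow> (\<phi> has_vector_derivative \<alpha> s) (at s)"
    using smooth_primitive_ex[OF smooth_\<alpha> s0I] by blast
  have rot: "e1 s = cos (\<phi> s) *\<^sub>R e1 s0 + sin (\<phi> s) *\<^sub>R J (e1 s0)" "e2 s = cos (\<phi> s) *\<^sub>R e2 s0 + sin (\<phi> s) *\<^sub>R J (e2 s0)"
    if s: "s \<in> I" for s
  proof -
    have d: "(e1 has_vector_derivative \<alpha> s *\<^sub>R J (e1 s)) (at s)" "(e2 has_vector_derivative \<alpha> s *\<^sub>R J (e2 s)) (at s)"
      if "s \<in> I" for s using hd[OF sm(3) that] hd[OF sm(4) that] frame_rotates[OF that] by simp_all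
    have dJ: "((\<lambda>s. J (e1 s)) has_vector_derivative - \<alpha> s *\<^sub>R e1 s) (at s)" "((\<lambda>s. J (e2 s)) has_vector_derivative - \<alpha> s *\<^sub>R e2 s) (at s)"
      if "s \<in> I" for s using J_derivative[OF d(1)[OF that]] J_derivative[OF d(2)[OF that]] by simp_all
    show "e1 s = cos (\<phi> s) *\<^sub>R e1 s0 + sin (\<phi> s) *\<^sub>R J (e1 s0)" "e2 s = cos (\<phi> s) *\<^sub>R e2 s0 + sin (\<phi> s) *\<^sub>R J (e2 s0)"
      using rotating_pair[OF d(1) dJ(1) \<phi>(3,2) s s0I] rotating_pair[OF d(2) dJ(2) \<phi>(3,2) s s0I] by simp_all
  qed
  interpret unitary_basis "e1 s0" "e2 s0"
    by unfold_locales (use on[OF s0I] e1_J_e2[OF s0I] in auto)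
  let ?\<gamma> = "polar_curve r \<phi>"
  have Ue: "U (e1 s) = (cis (\<phi> s), 0)" "U (e2 s) = (0, cis (\<phi> s))" if s: "s \<in> I" for s
    by (subst rot[OF s], simp add: U_simps U_J U_basis, simp add: J_def complex_eq_iff)+
  have \<gamma>: "?\<gamma> s = r s *\<^sub>R cis (\<phi> s)" for s by (simp add: polar_curve_def cis_conv_exp scaleR_conv_of_real)
  have UB: "U (B s) = (?\<gamma> s, 0)" if s: "s \<in> I" for s by (simp add: B_def U_simps Ue[OF s] \<gamma>)
  have UB': "U (vd B s) = (fst (U (vd B s)), 0)" if s: "s \<in> I" for s
    by (subst (1 2) vdB_rotating[OF s], simp add: U_simps U_J Ue[OF s], simp add: J_def)
  have blU: "bounded_linear (\<lambda>z. fst (U z))" using bounded_linear_compose[OF bounded_linear_fst U_bounded_linear] .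
  have d\<gamma>: "(?\<gamma> has_vector_derivative fst (U (vd B s))) (at s)" if s: "s \<in> I" for s
    by (rule has_vector_derivative_transform_within_open[OF bounded_linear.has_vector_derivative[OF blU hd[OF smBC(1) s]] I s])
       (simp add: UB)
  have vd\<gamma>: "vd ?\<gamma> s = fst (U (vd B s))" if "s \<in> I" for s using vector_derivative_at[OF d\<gamma>[OF that]] .
  have "(vd ?\<gamma> has_vector_derivative fst (U (vd (vd B) s))) (at s)" if s: "s \<in> I" for s
    by (rule has_vector_derivative_transform_within_open[OF bounded_linear.has_vector_derivative[OF blU
          hd[OF smooth_on_vector_derivative[OF I smBC(1)] s]] I s]) (simp add: vd\<gamma>)
  then have vd2\<gamma>: "vd (vd ?\<gamma>) s = fst (U (vd (vd B) s))" if "s \<in> I" for s using vector_derivative_at that by blast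
  note K = meridian_equation[OF N(1,2) N(3)]
  have equi: "equivariant_self_similar lam ?K r \<phi>"
    unfolding equivariant_self_similar_def Let_def regular_curve_def
  proof (intro conjI ballI)
    show "smooth_on ?K r" "smooth_on ?K \<phi>" using sm(2) \<phi>(1) KI smooth_on_subset by blast+
    then show "smooth_on ?K ?\<gamma>" by (intro smooth_polar_curve) auto
    show "open ?K" "is_interval ?K" by (auto simp: is_interval_oo)
    fix s assume s: "s \<in> ?K"
    then have sN: "s \<in> N" and sI: "s \<in> I" using \<eta>(2) KI by blast+
    show rs: "r s > 0" by (rule rpos[OF sI])
    have "U (vd B s) \<noteq> 0" using K(2)[OF _ sN] U_nonzero by simp
    then show nz: "vd ?\<gamma> s \<noteq> 0" unfolding vd\<gamma>[OF sI] using UB'[OF sI] by (auto simp: zero_prod_def)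
    have in1: "vd (vd ?\<gamma>) s \<bullet> (\<i> * vd ?\<gamma> s) = vd (vd B) s \<bullet> J (vd B s)"
    proof -
      have "vd (vd B) s \<bullet> J (vd B s) = U (vd (vd B) s) \<bullet> J (U (vd B s))" by (simp add: U_inner U_J[symmetric])
      also have "\<dots> = fst (U (vd (vd B) s)) \<bullet> (\<i> * fst (U (vd B s)))" by (subst UB'[OF sI]) (simp add: J_def inner_prod_def)
      finally show ?thesis by (simp add: vd2\<gamma>[OF sI] vd\<gamma>[OF sI])
    qed
    have in2: "?\<gamma> s \<bullet> (\<i> * vd ?\<gamma> s) = B s \<bullet> J (vd B s)"
    proof -
      have "B s \<bullet> J (vd B s) = U (B s) \<bullet> J (U (vd B s))" by (simp add: U_inner U_J[symmetric])
      also have "\<dots> = ?\<gamma> s \<bullet> (\<i> * fst (U (vd B s)))" by (simp add: UB[OF sI] J_def inner_prod_def)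
      finally show ?thesis by (simp add: vd\<gamma>[OF sI])
    qed
    have in3: "vd ?\<gamma> s \<bullet> vd ?\<gamma> s = vd B s \<bullet> vd B s"
    proof -
      have "vd B s \<bullet> vd B s = U (vd B s) \<bullet> U (vd B s)" by (simp add: U_inner)
      also have "\<dots> = fst (U (vd B s)) \<bullet> fst (U (vd B s))" by (subst (1 2) UB'[OF sI]) (simp add: inner_prod_def)
      finally show ?thesis by (simp add: vd\<gamma>[OF sI])
    qed
    have "norm (?\<gamma> s) = r s" using rs by (simp add: \<gamma> norm_mult)
    moreover have "vd (vd ?\<gamma>) s \<bullet> (\<i> * vd ?\<gamma> s) = (1 / (r s)\<^sup>2 - lam) * (vd ?\<gamma> s \<bullet> vd ?\<gamma> s) * (?\<gamma> s \<bullet> (\<i> * vd ?\<gamma> s))"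
      unfolding in1 in2 in3 using K(1)[OF _ sN] rs by (simp add: field_simps)
    ultimately show "curvature ?\<gamma> s = (?\<gamma> s \<bullet> unit_normal ?\<gamma> s) * (1 / (norm (?\<gamma> s))\<^sup>2 - lam)"
      using curvature_equation_iff[OF nz, of "1 / (r s)\<^sup>2 - lam"] by (simp add: mult.commute)
  qed
  have "locally_congruent_at M F (\<xi> (s0, 0)) (?K \<times> UNIV) (centered_type_I r \<phi>)"
    unfolding locally_congruent_at_def
  proof (intro exI conjI ballI)
    show "local_param M F (?K \<times> {-\<delta><..<\<delta>}) \<xi>" by (rule restrict_chart) (use KI in auto)
    show "\<xi> (s0, 0) \<in> \<xi> ` (?K \<times> {-\<delta><..<\<delta>})" using s0K \<delta> by auto
    show "?K \<times> {-\<delta><..<\<delta>} \<subseteq> ?K \<times> UNIV" by auto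
    show "congruence (\<lambda>z. U z + 0)" by (rule congruence_U)
    fix x assume x: "x \<in> ?K \<times> {-\<delta><..<\<delta>}"
    then obtain s \<theta> where s\<theta>: "x = (s, \<theta>)" "s \<in> ?K" "\<theta> \<in> {-\<delta><..<\<delta>}" by blast
    have st: "x = (s, \<theta>)" "s \<in> N" "s \<in> I" "x \<in> I \<times> {-\<delta><..<\<delta>}"
      using s\<theta> subsetD[OF \<eta>(2) s\<theta>(2)] subsetD[OF KI s\<theta>(2)] by auto
    have "F (\<xi> x) = c s + cos \<theta> *\<^sub>R B s + sin \<theta> *\<^sub>R C s"
      using param'[OF st(4)] by (simp add: X0_def trig_vec_def st(1))
    then show "U (F (\<xi> x)) + 0 = centered_type_I r \<phi> x"
      by (simp add: st(1) U_simps N(3)[OF st(2)] UB[OF st(3)] C_def Ue[OF st(3)] \<gamma> centered_type_I_def scaleR_conv_of_real mult.commute)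
  qed
  then show ?thesis using equi by blast
qed

text \<open>If the plane does not rotate, the surface lies in a Lagrangian plane. Moving the given point to
  \<open>(1, 0)\<close> keeps it away from the origin, where polar coordinates present the plane as a
  surface of type I over a straight line.\<close>

lemma type_I_if_planar:
  assumes N: "open N" "N \<subseteq> I" "\<And>s. s \<in> N \<Longrightarrow> \<alpha> s = 0" and s0: "s0 \<in> N"
  shows "type_I_at s0"
proof -
  obtain \<eta> where \<eta>: "\<eta> > 0" "{s0-\<eta><..<s0+\<eta>} \<subseteq> N" using open_real_interval[OF N(1) s0] by blast
  let ?K = "{s0-\<eta><..<s0+\<eta>}"
  have KI: "?K \<subseteq> I" using \<eta> N by auto
  have s0K: "s0 \<in> ?K" and s0I: "s0 \<in> I" using \<eta> N s0 by auto
  have e0: "e1 s = e1 s0" "e2 s = e2 s0" if s: "s \<in> ?K" for s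
  proof -
    have "(e1 has_vector_derivative 0) (at s)" "(e2 has_vector_derivative 0) (at s)" if s: "s \<in> ?K" for s
    proof -
      have sI: "s \<in> I" and "\<alpha> s = 0" using subsetD[OF KI s] N(3)[OF subsetD[OF \<eta>(2) s]] .
      then show "(e1 has_vector_derivative 0) (at s)" "(e2 has_vector_derivative 0) (at s)"
        using hd[OF sm(3) sI] hd[OF sm(4) sI] frame_rotates[OF sI] by simp_all
    qed
    then show "e1 s = e1 s0" "e2 s = e2 s0" using constant_if_derivative_zero s s0K by blast+
  qed
  interpret unitary_basis "e1 s0" "e2 s0"
    by unfold_locales (use on[OF s0I] e1_J_e2[OF s0I] in auto)
  let ?R = "?K \<times> {-\<delta><..<\<delta>}"
  define Z where "Z x = X0 (fst x) (snd x)" for x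
  have ZJ: "Z x \<bullet> J (e1 s0) = 0" "Z x \<bullet> J (e2 s0) = 0" if x: "x \<in> ?R" for x
  proof -
    have s2: "fst x \<in> ?K" using x by auto
    have s: "fst x \<in> I" "fst x \<in> ?K" "\<bar>w (fst x)\<bar> < 1" using subsetD[OF KI s2] s2 w0 by auto
    note cn = circle_jet.centre_normal[OF jet[OF s(1)], unfolded w_jet[OF s(1)], OF s(3)]
    show "Z x \<bullet> J (e1 s0) = 0" "Z x \<bullet> J (e2 s0) = 0"
      using cn unfolding Z_def X0_def trig_vec_def B_def C_def e0[OF s(2)]
      by (simp_all add: inner_add_left e1_J_e2[OF s0I])
  qed
  \<comment> \<open>The point with parameters \<open>(s0, 0)\<close> is moved to \<open>(1, 0)\<close>; \<open>z1, z2\<close> are the real coordinates in the plane.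
      The radius \<open>\<rho>\<close>, which is \<open>1\<close> there, is kept in the bounded interval from \<open>0\<close> to \<open>2\<close>.\<close>
  define z where "z x = Z x - Z (s0, 0)" for x
  define z1 z2 where "z1 x = 1 + z x \<bullet> e1 s0" and "z2 x = z x \<bullet> e2 s0" for x
  have Uz: "U (z x) + (1, 0) = (complex_of_real (z1 x), complex_of_real (z2 x))" if x: "x \<in> ?R" for x
  proof -
    have "(s0, 0) \<in> ?R" using s0K \<delta> by auto
    then have "z x \<bullet> J (e1 s0) = 0" "z x \<bullet> J (e2 s0) = 0" using ZJ x by (simp_all add: z_def inner_diff_left)
    then show ?thesis by (simp add: unitary_coords_def z1_def z2_def complex_eq_iff)
  qed
  have oR: "open ?R" by (simp add: open_Times)
  have cZ: "continuous_on ?R Z"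
  proof (rule continuous_at_imp_continuous_on, rule ballI)
    fix x assume x: "x \<in> ?R"
    then have "fst x \<in> ?K" by auto
    then have "fst x \<in> I" using KI by blast
    from has_derivative_continuous[OF partials(1)[OF this, of "snd x"]] show "isCont Z x"
      by (simp add: Z_def[abs_def])
  qed
  have cz: "continuous_on ?R z1" "continuous_on ?R z2"
    unfolding z1_def z2_def z_def by (intro continuous_intros cZ)+
  define \<rho> where "\<rho> x = sqrt ((z1 x)\<^sup>2 + (z2 x)\<^sup>2)" for x
  have c\<rho>: "continuous_on ?R \<rho>" unfolding \<rho>_def by (intro continuous_intros cz)
  define W where "W = (?R \<inter> z1 -` {0<..}) \<inter> (?R \<inter> \<rho> -` {..<2})"
  have oW: "open W" unfolding W_def
    by (intro open_Int continuous_open_preimage[OF cz(1) oR] continuous_open_preimage[OF c\<rho> oR]) auto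
  have z0: "z1 (s0, 0) = 1" "z2 (s0, 0) = 0" by (simp_all add: z1_def z2_def z_def)
  have x0W: "(s0, 0) \<in> W" using s0K \<delta> z0 by (auto simp: W_def \<rho>_def)
  define \<Theta> where "\<Theta> x = (\<rho> x, arctan (z2 x / z1 x))" for x
  have WR: "W \<subseteq> ?R" and Wp: "\<And>x. x \<in> W \<Longrightarrow> z1 x > 0" by (auto simp: W_def)
  have c\<Theta>: "continuous_on W \<Theta>" unfolding \<Theta>_def
    using continuous_on_subset[OF c\<rho> WR] continuous_on_subset[OF cz(1) WR] continuous_on_subset[OF cz(2) WR] Wp
    by (intro continuous_intros) force+
  have \<rho>pos: "\<rho> x > 0" if "x \<in> W" for x using Wp[OF that] by (simp add: \<rho>_def add_pos_nonneg)
  let ?D = "{0<..<2::real} \<times> (UNIV :: real set)"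
  have \<Theta>D: "\<Theta> ` W \<subseteq> ?D" using \<rho>pos by (auto simp: \<Theta>_def W_def)
  let ?r = "\<lambda>s::real. s" and ?\<phi> = "\<lambda>s::real. 0::real"
  have \<gamma>: "polar_curve ?r ?\<phi> = complex_of_real" by (auto simp: polar_curve_def)
  have smr: "smooth_on S ?r" if "open S" for S using smooth_on_bounded_linear[OF that bounded_linear_ident] .
  have sm\<gamma>: "smooth_on {0<..<2} (polar_curve ?r ?\<phi>)" by (intro smooth_polar_curve smr smooth_on_const) auto
  have "(complex_of_real has_vector_derivative 1) (at s)" for s
    using bounded_linear_imp_has_derivative[OF bounded_linear_of_real[where 'a = complex], of "at s"]
    by (simp add: has_vector_derivative_def scaleR_conv_of_real)
  then have vd\<gamma>: "vd (polar_curve ?r ?\<phi>) s = 1" for s unfolding \<gamma> by (rule vector_derivative_at)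
  have equi: "equivariant_self_similar lam {0<..<2} ?r ?\<phi>"
    unfolding equivariant_self_similar_def Let_def regular_curve_def
  proof (intro conjI ballI)
    fix s :: real assume "s \<in> {0<..<2}"
    show "vd (polar_curve ?r ?\<phi>) s \<noteq> 0" by (simp add: vd\<gamma>)
    then show "curvature (polar_curve ?r ?\<phi>) s = (polar_curve ?r ?\<phi> s \<bullet> unit_normal (polar_curve ?r ?\<phi>) s)
        * (1 / (norm (polar_curve ?r ?\<phi> s))\<^sup>2 - lam)"
      using curvature_equation_iff[of "polar_curve ?r ?\<phi>" s "1 / (norm (polar_curve ?r ?\<phi> s))\<^sup>2 - lam"]
      by (simp add: vd\<gamma> \<gamma> vector_derivative_const_at inner_complex_def mult.commute)
  qed (use smr smooth_on_const sm\<gamma> in \<open>auto simp: is_interval_oo\<close>)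
  have imm: "inj (frechet_derivative (centered_type_I ?r ?\<phi>) (at (\<Theta> x)))" if "x \<in> W" for x
    unfolding \<Theta>_def using \<rho>pos[OF that] that
    by (intro centered_type_I_smooth_immersion(2)[OF sm\<gamma>]) (auto simp: vd\<gamma> \<gamma> W_def)
  define g where "g = (\<lambda>y. U y + ((1, 0) - U (Z (s0, 0))))"
  have eq: "g (F (\<xi> x)) = centered_type_I ?r ?\<phi> (\<Theta> x)" if x: "x \<in> W" for x
  proof -
    have xR: "x \<in> ?R" using x WR by blast
    have xI: "x \<in> I \<times> {-\<delta><..<\<delta>}" using subsetD[OF Sigma_mono[OF KI subset_refl] xR] .
    have "g (F (\<xi> x)) = U (z x) + (1, 0)" unfolding param'[OF xI] g_def z_def Z_def by (simp add: U_simps)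
    also have "\<dots> = (complex_of_real (z1 x), complex_of_real (z2 x))" by (rule Uz[OF xR])
    also have "\<dots> = centered_type_I ?r ?\<phi> (\<Theta> x)"
      using polar_coordinates[OF Wp[OF x], of "z2 x"]
      by (simp add: centered_type_I_def \<Theta>_def \<gamma> \<rho>_def of_real_mult[symmetric] del: of_real_mult)
    finally show ?thesis .
  qed
  have lp: "local_param M F ?R \<xi>" by (rule restrict_chart) (use KI in auto)
  have "congruence g" unfolding g_def by (rule congruence_U)
  have D: "open ?D" by (simp add: open_Times)
  have "locally_congruent_at M F (\<xi> (s0, 0)) ?D (centered_type_I ?r ?\<phi>)"
    by (rule locally_congruent_by_chart_change[OF lp oW x0W WR c\<Theta> \<Theta>D D centered_type_I_smooth_immersion(1)[OF sm\<gamma>] imm \<open>congruence g\<close> eq])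
  then show ?thesis using equi by blast
qed

text \<open>The meridian equation, with \<open>B = r e1\<close> and its derivatives expressed in the basis \<open>e1, J e1\<close>.\<close>

lemma rotation_ode:
  assumes N: "open N" "N \<subseteq> I" "\<And>s. s \<in> N \<Longrightarrow> c s = 0" and s: "s \<in> N"
  shows "r s * vd r s * vd \<alpha> s = \<alpha> s * (- 2 * (vd r s)\<^sup>2 + r s * vd (vd r) s - (r s)\<^sup>2 * (\<alpha> s)\<^sup>2
      - ((vd r s)\<^sup>2 + (r s)\<^sup>2 * (\<alpha> s)\<^sup>2) * (1 - lam * (r s)\<^sup>2))"
proof -
  have sI: "s \<in> I" using N s by auto
  have rs: "r s > 0" by (rule rpos[OF sI])
  define r' r'' \<alpha>' where "r' = vd r s" and "r'' = vd (vd r) s" and "\<alpha>' = vd \<alpha> s"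
  have d: "(e1 has_vector_derivative \<alpha> s *\<^sub>R J (e1 s)) (at s)"
    using hd[OF sm(3) sI] frame_rotates(1)[OF sI] by simp
  have dr: "(r has_vector_derivative r') (at s)" "(vd r has_vector_derivative r'') (at s)" "(\<alpha> has_vector_derivative \<alpha>') (at s)"
    unfolding r'_def r''_def \<alpha>'_def
    using hd[OF sm(2) sI] hd[OF smooth_on_vector_derivative[OF I sm(2)] sI] hd[OF smooth_\<alpha> sI] .
  have dra: "((\<lambda>s. r s * \<alpha> s) has_vector_derivative r s * \<alpha>' + r' * \<alpha> s) (at s)"
    using scaleR_derivative[OF dr(1,3)] by simp
  have twice: "(2 * x) *\<^sub>R v = x *\<^sub>R v + x *\<^sub>R v" for x and v :: C2
    by (metis mult_2 scaleR_add_left)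
  from has_vector_derivative_add[OF scaleR_derivative[OF dr(2) d] scaleR_derivative[OF dra J_derivative[OF d]]]
  have "((\<lambda>s. vd r s *\<^sub>R e1 s + (r s * \<alpha> s) *\<^sub>R J (e1 s)) has_vector_derivative
     (r'' - r s * (\<alpha> s)\<^sup>2) *\<^sub>R e1 s + (r' * \<alpha> s + r' * \<alpha> s + r s * \<alpha>') *\<^sub>R J (e1 s)) (at s)"
    by (rule has_vector_derivative_eq_rhs)
       (simp add: scaleR_add_left scaleR_diff_left power2_eq_square r'_def twice ac_simps)
  then have "(vd B has_vector_derivative (r'' - r s * (\<alpha> s)\<^sup>2) *\<^sub>R e1 s + (r' * \<alpha> s + r' * \<alpha> s + r s * \<alpha>') *\<^sub>R J (e1 s)) (at s)"
    by (rule has_vector_derivative_transform_within_open[OF _ I sI]) (rule vdB_rotating[symmetric])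
  then have B2: "vd (vd B) s = (r'' - r s * (\<alpha> s)\<^sup>2) *\<^sub>R e1 s + (r' * \<alpha> s + r' * \<alpha> s + r s * \<alpha>') *\<^sub>R J (e1 s)"
    by (rule vector_derivative_at)
  have B1: "vd B s = r' *\<^sub>R e1 s + (r s * \<alpha> s) *\<^sub>R J (e1 s)" by (simp add: vdB_rotating[OF sI] r'_def)
  have i: "vd (vd B) s \<bullet> J (vd B s) = - (r s * \<alpha> s) * (r'' - r s * (\<alpha> s)\<^sup>2) + r' * (r' * \<alpha> s + r' * \<alpha> s + r s * \<alpha>')"
    "vd B s \<bullet> vd B s = r'\<^sup>2 + (r s * \<alpha> s)\<^sup>2" "B s \<bullet> J (vd B s) = - ((r s)\<^sup>2 * \<alpha> s)"
    unfolding B1 B2 B_def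
    by (simp_all add: inner_add_left inner_add_right inner_diff_left inner_diff_right on(1)[OF sI] algebra_simps power2_eq_square)
  have "(r s)\<^sup>2 * (- (r s * \<alpha> s) * (r'' - r s * (\<alpha> s)\<^sup>2) + r' * (r' * \<alpha> s + r' * \<alpha> s + r s * \<alpha>'))
     = (r'\<^sup>2 + (r s * \<alpha> s)\<^sup>2) * (1 - lam * (r s)\<^sup>2) * - ((r s)\<^sup>2 * \<alpha> s)"
    using meridian_equation(1)[OF N s] unfolding i by simp
  then have "(r s)\<^sup>2 * (r s * r' * \<alpha>' - \<alpha> s * (- 2 * r'\<^sup>2 + r s * r'' - (r s)\<^sup>2 * (\<alpha> s)\<^sup>2
      - (r'\<^sup>2 + (r s)\<^sup>2 * (\<alpha> s)\<^sup>2) * (1 - lam * (r s)\<^sup>2))) = 0"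
    by algebra
  then show ?thesis using rs unfolding r'_def r''_def \<alpha>'_def by simp
qed

text \<open>At a point where \<open>\<alpha>\<close> vanishes without vanishing near it, the centre and its velocity are zero by
  continuity. Then \<open>r' \<noteq> 0\<close> and the equation is a regular linear equation for \<open>\<alpha>\<close>, whose only solution with
  \<open>\<alpha> = 0\<close> at the point is zero.\<close>

lemma planar_near_or_centred_near:
  assumes s0: "s0 \<in> I"
  obtains N where "open N" "s0 \<in> N" "N \<subseteq> I" "(\<forall>s\<in>N. \<alpha> s = 0) \<or> (\<forall>s\<in>N. c s = 0)"
proof -
  have w1: "\<bar>w s\<bar> < 1" if "s \<in> I" for s using w0[OF that] by simp
  have centred: "\<exists>N. open N \<and> s \<in> N \<and> N \<subseteq> I \<and> (\<forall>t\<in>N. c t = 0)" if s: "s \<in> I" "\<alpha> s \<noteq> 0" for s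
    using centre_zero_near[OF s(1) w1[OF s(1)]] \<alpha>_zero_iff[OF s(1)] s(2) by metis
  have "\<exists>N. open N \<and> s0 \<in> N \<and> N \<subseteq> I \<and> ((\<forall>s\<in>N. \<alpha> s = 0) \<or> (\<forall>s\<in>N. c s = 0))"
  proof (rule ccontr)
    assume contra: "\<not> ?thesis"
    have a0: "\<alpha> s0 = 0" using centred[OF s0] contra by blast
    have dense: "\<exists>t\<in>N. \<alpha> t \<noteq> 0" if "open N" "s0 \<in> N" "N \<subseteq> I" for N using contra that by blast
    have cz: "c t = 0 \<and> vd c t = 0" if t: "t \<in> I" "\<alpha> t \<noteq> 0" for t
    proof -
      obtain N where N: "open N" "t \<in> N" "N \<subseteq> I" "\<forall>t\<in>N. c t = 0" using centred[OF t] by blast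
      then show ?thesis using vd_zero[OF N(1,2,3) _ sm(1), of 0] by blast
    qed
    have "c s0 = 0"
      using nonzero_near[OF continuous_jet(1) I s0] dense cz by (metis subsetD)
    moreover have c1: "vd c s0 = 0"
      using nonzero_near[OF continuous_jet(2) I s0] dense cz by (metis subsetD)
    ultimately have "vd B s0 \<noteq> 0" using soliton_meridian(2)[OF s0] by simp
    then have r': "vd r s0 \<noteq> 0" unfolding vdB_rotating[OF s0] a0 by auto
    have smr': "smooth_on I (vd r)" by (rule smooth_on_vector_derivative[OF I sm(2)])
    obtain N1 where N1: "open N1" "s0 \<in> N1" "N1 \<subseteq> I" "\<And>t. t \<in> N1 \<Longrightarrow> vd r t \<noteq> 0"
      using nonzero_near[OF smooth_on_continuous[OF smr'] I s0 r'] by blast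
    obtain \<eta> where \<eta>: "\<eta> > 0" "{s0-\<eta><..<s0+\<eta>} \<subseteq> N1" using open_real_interval[OF N1(1,2)] by blast
    let ?K = "{s0-\<eta><..<s0+\<eta>}"
    have K: "open ?K" and s0K: "s0 \<in> ?K" and KI: "?K \<subseteq> I" using \<eta> N1 by auto
    have rr: "r s * vd r s \<noteq> 0" if "s \<in> ?K" for s
      using rpos[OF subsetD[OF KI that]] N1(4)[OF subsetD[OF \<eta>(2) that]] by simp
    define q where "q s = (- 2 * (vd r s)\<^sup>2 + r s * vd (vd r) s - (r s)\<^sup>2 * (\<alpha> s)\<^sup>2
      - ((vd r s)\<^sup>2 + (r s)\<^sup>2 * (\<alpha> s)\<^sup>2) * (1 - lam * (r s)\<^sup>2)) / (r s * vd r s)" for s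
    note smK = smooth_on_subset[OF sm(2) KI] smooth_on_subset[OF smr' KI]
       smooth_on_subset[OF smooth_on_vector_derivative[OF I smr'] KI] smooth_on_subset[OF smooth_\<alpha> KI]
    have smq: "smooth_on ?K q" unfolding q_def power2_eq_square
      by (intro smooth_on_divide[OF K] smooth_on_diff[OF K] smooth_on_add[OF K] smooth_on_mult[OF K] smooth_on_const smK rr)
    \<comment> \<open>The equation \<open>D = 0\<close> holds where \<open>\<alpha> \<noteq> 0\<close>, and trivially in the interior of the zero set of \<open>\<alpha>\<close>; the union
      of these two open sets is dense.\<close>
    define D where "D s = vd \<alpha> s - q s * \<alpha> s" for s
    have smD: "smooth_on ?K D" unfolding D_def
      by (intro smooth_on_diff[OF K] smooth_on_mult[OF K] smq smK smooth_on_subset[OF smooth_on_vector_derivative[OF I smooth_\<alpha>] KI])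
    have D_U: "D s = 0" if s: "s \<in> ?K" "\<alpha> s \<noteq> 0" for s
    proof -
      obtain N where N: "open N" "s \<in> N" "N \<subseteq> I" "\<And>t. t \<in> N \<Longrightarrow> c t = 0"
        using centred[OF subsetD[OF KI s(1)] s(2)] by blast
      have "r s * vd r s * vd \<alpha> s = \<alpha> s * (q s * (r s * vd r s))"
        using rotation_ode[OF N(1,3,4,2)] rr[OF s(1)] by (simp add: q_def)
      then have "(r s * vd r s) * D s = 0" by (simp add: D_def algebra_simps)
      then show ?thesis using rr[OF s(1)] by simp
    qed
    have D0: "D s = 0" if s: "s \<in> ?K" for s
    proof (rule ccontr)
      assume "D s \<noteq> 0"
      then obtain N where N: "open N" "s \<in> N" "N \<subseteq> ?K" "\<And>t. t \<in> N \<Longrightarrow> D t \<noteq> 0"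
        using nonzero_near[OF smooth_on_continuous[OF smD] K s] by blast
      have a: "\<alpha> t = 0" if "t \<in> N" for t using D_U[of t] N(3,4) that by blast
      have "N \<subseteq> I" using N(3) KI by (rule subset_trans)
      then have "vd \<alpha> s = 0" using vd_zero[OF N(1,2) _ a smooth_\<alpha>] by blast
      then show False using \<open>D s \<noteq> 0\<close> a[OF N(2)] by (simp add: D_def)
    qed
    have "\<alpha> s = 0" if s: "s \<in> ?K" for s
    proof (rule linear_ode_zero[where f = \<alpha>, OF _ smq s0K a0 s])
      fix s assume s: "s \<in> ?K"
      have "vd \<alpha> s = q s * \<alpha> s" using D0[OF s] by (simp add: D_def)
      then show "(\<alpha> has_vector_derivative q s * \<alpha> s) (at s)" using hd[OF smooth_\<alpha> subsetD[OF KI s]] by simp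
    qed
    then show False using dense[OF K s0K KI] by blast
  qed
  then show ?thesis using that by blast
qed

lemma type_I_if_lagrangian_planes:
  assumes "s0 \<in> I"
  shows "type_I_at s0"
proof -
  obtain N where N: "open N" "s0 \<in> N" "N \<subseteq> I" "(\<forall>s\<in>N. \<alpha> s = 0) \<or> (\<forall>s\<in>N. c s = 0)"
    by (rule planar_near_or_centred_near[OF assms])
  then show ?thesis
    using type_I_if_planar[OF N(1,3) _ N(2)] type_I_if_centred[OF N(1,3) _ N(2)] by blast
qed

end

end

context cyclic_soliton
begin

section \<open>Complex lines\<close>

context
  fixes \<epsilon> :: real
  assumes w\<epsilon>: "\<And>s. s \<in> I \<Longrightarrow> w s = \<epsilon>" and orient: "\<epsilon> * \<epsilon> = 1"
begin

lemma frame_complex: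
  assumes s: "s \<in> I"
  shows "e2 s = - \<epsilon> *\<^sub>R J (e1 s)" "vd e2 s = - \<epsilon> *\<^sub>R J (vd e1 s)"
proof -
  have e2: "e2 s = - \<epsilon> *\<^sub>R J (e1 s)" if s: "s \<in> I" for s
  proof -
    have ws: "e1 s \<bullet> J (e2 s) = \<epsilon>" using w\<epsilon>[OF s] by (simp add: w_def)
    then have ws': "J (e2 s) \<bullet> e1 s = \<epsilon>" by (simp add: inner_commute)
    have "(e1 s - \<epsilon> *\<^sub>R J (e2 s)) \<bullet> (e1 s - \<epsilon> *\<^sub>R J (e2 s)) = 0"
      using orient by (simp add: inner_diff_left inner_diff_right on[OF s] ws ws')
    then have "e1 s = \<epsilon> *\<^sub>R J (e2 s)" by simp
    then have "- \<epsilon> *\<^sub>R J (e1 s) = - \<epsilon> *\<^sub>R J (\<epsilon> *\<^sub>R J (e2 s))" by simp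
    also have "\<dots> = e2 s" using orient by simp
    finally show ?thesis by simp
  qed
  show "e2 s = - \<epsilon> *\<^sub>R J (e1 s)" by (rule e2[OF s])
  have "((\<lambda>s. - \<epsilon> *\<^sub>R J (e1 s)) has_vector_derivative - \<epsilon> *\<^sub>R J (vd e1 s)) (at s)"
    using scaleR_derivative[OF has_vector_derivative_const J_derivative[OF hd[OF sm(3) s]], of "- \<epsilon>"] by simp
  then have "(e2 has_vector_derivative - \<epsilon> *\<^sub>R J (vd e1 s)) (at s)"
    by (rule has_vector_derivative_transform_within_open[OF _ I s]) (simp add: e2)
  then show "vd e2 s = - \<epsilon> *\<^sub>R J (vd e1 s)" by (rule vector_derivative_at)
qed

lemma cl: assumes s: "s \<in> I"
  shows "vd r s = 0" "vd c s \<bullet> e1 s = 0" "vd c s \<bullet> J (e1 s) = 0" "vd e1 s \<bullet> J (e1 s) = 0" "c s \<bullet> e1 s = 0" "c s \<bullet> J (e1 s) = 0"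
    "vd e1 s = 0 \<Longrightarrow> lam * (r s)\<^sup>2 = 1 \<and> vd c s \<noteq> 0" "vd c s = 0 \<Longrightarrow> lam * (r s)\<^sup>2 = 2 \<and> vd e1 s \<noteq> 0"
  by (rule circle_jet.complex_line[OF jet[OF s] orient frame_complex[OF s]] | assumption)+

lemma r_constant: "s \<in> I \<Longrightarrow> t \<in> I \<Longrightarrow> r s = r t"
  using constant_if_derivative_zero[of a b r s t] hd[OF sm(2)] cl(1) by metis

lemma moving_line_frame:
  assumes s: "s \<in> I" "vd e1 s \<noteq> 0"
  defines "u \<equiv> (1 / norm (vd e1 s)) *\<^sub>R vd e1 s"
  shows "z = (z \<bullet> e1 s) *\<^sub>R e1 s + (z \<bullet> J (e1 s)) *\<^sub>R J (e1 s) + (z \<bullet> u) *\<^sub>R u + (z \<bullet> J u) *\<^sub>R J u"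
proof (rule orthonormal_frame_expand)
  have pe: "vd e1 s \<bullet> e1 s = 0" "e1 s \<bullet> vd e1 s = 0" using vd_frame(1)[OF s(1)] by (simp_all add: inner_commute)
  have pJ: "e1 s \<bullet> J (vd e1 s) = 0" "J (e1 s) \<bullet> vd e1 s = 0"
    using cl(4)[OF s(1)] inner_J_left[of "e1 s" "vd e1 s"] by (simp_all add: inner_commute)
  show "u \<bullet> u = 1" "J u \<bullet> J u = 1" using s(2) by (simp_all add: u_def dot_square_norm power2_eq_square)
  show "e1 s \<bullet> u = 0" "e1 s \<bullet> J u = 0" "J (e1 s) \<bullet> u = 0" "J (e1 s) \<bullet> J u = 0"
    by (simp_all add: u_def pe pJ)
qed (simp_all add: on(1)[OF s(1)])

text \<open>The centre is orthogonal to the line for every \<open>s\<close>; the derivative of this relation makes it orthogonal to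
  \<open>e1'\<close> and \<open>J e1'\<close> as well.\<close>

lemma centre_zero_if_line_moves:
  assumes s: "s \<in> I" "vd e1 s \<noteq> 0"
  shows "c s = 0"
proof -
  note h = hd[OF sm(1) s(1)] hd[OF sm(3) s(1)]
  have "c s \<bullet> vd e1 s + vd c s \<bullet> e1 s = 0"
    by (rule derivative_zero_if_constant[OF I s(1) cl(5) inner_derivative[OF h]])
  moreover have "c s \<bullet> J (vd e1 s) + vd c s \<bullet> J (e1 s) = 0"
    by (rule derivative_zero_if_constant[OF I s(1) cl(6) inner_derivative[OF h(1) J_derivative[OF h(2)]]])
  ultimately have "c s \<bullet> vd e1 s = 0" "c s \<bullet> J (vd e1 s) = 0" using cl(2,3)[OF s(1)] by simp_all
  then show ?thesis
    by (subst moving_line_frame[OF s, of "c s"]) (simp add: cl(5,6)[OF s(1)])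
qed

lemma moving_line_radius:
  assumes s: "s \<in> I" "vd e1 s \<noteq> 0"
  shows "lam * (r s)\<^sup>2 = 2"
proof -
  obtain N where N: "open N" "s \<in> N" "N \<subseteq> I" "\<And>t. t \<in> N \<Longrightarrow> vd e1 t \<noteq> 0"
    using nonzero_near[OF continuous_jet(3) I s] by blast
  have "vd c s = 0" by (rule vd_zero[OF N(1,2,3) _ sm(1)]) (use centre_zero_if_line_moves N(3,4) in blast)
  then show ?thesis using cl(8)[OF s(1)] by blast
qed

text \<open>The unitary coordinates with respect to \<open>e1\<close> and the direction of \<open>c'\<close> at \<open>s0\<close> separate the circles from the curve
  of centres.\<close>

lemma product_if_line_fixed:
  assumes s0: "s0 \<in> I" and p0: "\<And>s. s \<in> I \<Longrightarrow> vd e1 s = 0"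
  shows "\<exists>K \<rho> \<Gamma>. \<rho> > 0 \<and> self_shrinking_curve K \<Gamma> \<and> locally_congruent_at M F (\<xi> (s0, 0)) (K \<times> UNIV) (circle_times_curve \<rho> \<Gamma>)"
proof -
  have e1: "e1 s = e1 s0" if "s \<in> I" for s
  proof (rule constant_if_derivative_zero[OF _ that s0])
    show "(e1 has_vector_derivative 0) (at t)" if "t \<in> I" for t using hd[OF sm(3) that] p0[OF that] by simp
  qed
  define \<rho> where "\<rho> = r s0"
  have \<rho>: "\<rho> > 0" "\<And>s. s \<in> I \<Longrightarrow> r s = \<rho>" unfolding \<rho>_def using rpos[OF s0] r_constant[OF _ s0] by blast+
  have l1: "lam * \<rho>\<^sup>2 = 1" using cl(7)[OF s0 p0[OF s0]] by (simp add: \<rho>_def)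
  then have lpos: "lam > 0" using \<rho>(1) by (metis zero_less_mult_pos2 zero_less_one zero_less_power)
  let ?f = "(1 / norm (vd c s0)) *\<^sub>R vd c s0"
  have c0: "vd c s0 \<noteq> 0" using cl(7)[OF s0 p0[OF s0]] by blast
  have perp: "e1 s0 \<bullet> vd c s0 = 0" "e1 s0 \<bullet> J (vd c s0) = 0"
    using cl(2,3)[OF s0] inner_J_left[of "e1 s0" "vd c s0"] by (simp_all add: inner_commute)
  interpret unitary_basis "e1 s0" ?f
    by unfold_locales (use on(1)[OF s0] c0 perp in \<open>simp_all add: dot_square_norm power2_eq_square\<close>)
  define \<Gamma> where "\<Gamma> s = snd (U (c s))" for s
  have Uc: "U (c s) = (0, \<Gamma> s)" if s: "s \<in> I" for s
    using cl(5,6)[OF s] unfolding e1[OF s] by (simp add: unitary_coords_def \<Gamma>_def complex_eq_iff)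
  have Uc': "U (vd c s) = (0, snd (U (vd c s)))" if s: "s \<in> I" for s
    using cl(2,3)[OF s] unfolding e1[OF s] by (simp add: unitary_coords_def complex_eq_iff)
  have blU: "bounded_linear (\<lambda>z. snd (U z))" using bounded_linear_compose[OF bounded_linear_snd U_bounded_linear] .
  have sm\<Gamma>: "smooth_on I \<Gamma>" unfolding \<Gamma>_def by (rule smooth_on_linear_compose[OF I blU sm(1)])
  have vd\<Gamma>: "vd \<Gamma> s = snd (U (vd c s))" if s: "s \<in> I" for s
    unfolding \<Gamma>_def using bounded_linear.has_vector_derivative[OF blU hd[OF sm(1) s]] by (rule vector_derivative_at)
  have "(vd \<Gamma> has_vector_derivative snd (U (vd (vd c) s))) (at s)" if s: "s \<in> I" for s
    by (rule has_vector_derivative_transform_within_open[OF bounded_linear.has_vector_derivative[OF blU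
          hd[OF smooth_on_vector_derivative[OF I sm(1)] s]] I s]) (simp add: vd\<Gamma>)
  then have vd2\<Gamma>: "vd (vd \<Gamma>) s = snd (U (vd (vd c) s))" if "s \<in> I" for s using vector_derivative_at that by blast
  have nz: "vd \<Gamma> s \<noteq> 0" if s: "s \<in> I" for s
  proof -
    have "U (vd c s) \<noteq> 0" using cl(7)[OF s p0[OF s]] U_nonzero by simp
    then show ?thesis using Uc'[OF s] vd\<Gamma>[OF s] by (auto simp: zero_prod_def)
  qed
  have shrink: "self_shrinking_curve I \<Gamma>"
    unfolding self_shrinking_curve_def regular_curve_def
  proof (intro conjI ballI exI[of _ lam])
    fix s assume s: "s \<in> I"
    have B0: "vd B t = 0" if "t \<in> I" for t using vdBC(1)[OF that] p0[OF that] cl(1)[OF that] by simp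
    have B2: "vd (vd B) s = 0"
      using derivative_zero_if_constant[OF I s B0 hd[OF smooth_on_vector_derivative[OF I smBC(1)] s]] by simp
    have perp: "vd c s \<bullet> C s = 0" "B s \<bullet> J (vd c s) = 0"
      using cl(2,3)[OF s] frame_complex(1)[OF s] inner_J_left[of "e1 s" "vd c s"] inner_commute[of "J (e1 s)" "vd c s"]
      by (simp_all add: B_def C_def)
    have "(r s)\<^sup>2 * (vd (vd c) s \<bullet> J (vd c s) + lam * (vd c s \<bullet> vd c s) * (c s \<bullet> J (vd c s))) = 0"
      using soliton_meridian(1)[OF s] unfolding B0[OF s] B2 by (simp add: perp inner_add_left algebra_simps)
    then have eq: "vd (vd c) s \<bullet> J (vd c s) = (- lam) * (vd c s \<bullet> vd c s) * (c s \<bullet> J (vd c s))"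
      using rpos[OF s] by simp
    have inn: "y \<bullet> J (vd c s) = snd (U y) \<bullet> (\<i> * vd \<Gamma> s)" "vd c s \<bullet> vd c s = vd \<Gamma> s \<bullet> vd \<Gamma> s" for y
    proof -
      have "y \<bullet> J (vd c s) = U y \<bullet> J (U (vd c s))" by (simp add: U_inner U_J[symmetric])
      also have "\<dots> = snd (U y) \<bullet> (\<i> * snd (U (vd c s)))" by (subst Uc'[OF s]) (simp add: J_def inner_prod_def)
      finally show "y \<bullet> J (vd c s) = snd (U y) \<bullet> (\<i> * vd \<Gamma> s)" by (simp add: vd\<Gamma>[OF s])
      have "vd c s \<bullet> vd c s = U (vd c s) \<bullet> U (vd c s)" by (simp add: U_inner)
      also have "\<dots> = snd (U (vd c s)) \<bullet> snd (U (vd c s))" by (subst (1 2) Uc'[OF s]) (simp add: inner_prod_def)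
      finally show "vd c s \<bullet> vd c s = vd \<Gamma> s \<bullet> vd \<Gamma> s" by (simp add: vd\<Gamma>[OF s])
    qed
    have "vd (vd \<Gamma>) s \<bullet> (\<i> * vd \<Gamma> s) = (- lam) * (vd \<Gamma> s \<bullet> vd \<Gamma> s) * (\<Gamma> s \<bullet> (\<i> * vd \<Gamma> s))"
      using eq unfolding inn vd2\<Gamma>[OF s, symmetric] \<Gamma>_def[symmetric] .
    then show "curvature \<Gamma> s + lam * (\<Gamma> s \<bullet> unit_normal \<Gamma> s) = 0"
      using curvature_equation_iff[OF nz[OF s], of "- lam"] by simp
  qed (use sm\<Gamma> nz lpos in \<open>auto simp: is_interval_oo\<close>)
  let ?R = "I \<times> {-\<delta><..<\<delta>}" and ?D = "I \<times> (UNIV :: real set)"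
  \<comment> \<open>Since \<open>e2 = - \<epsilon> J e1\<close>, the circle is traversed as \<open>exp (- i \<epsilon> \<theta>)\<close>.\<close>
  define \<Theta> where "\<Theta> x = (fst x, - \<epsilon> * snd x)" for x :: "real \<times> real"
  have \<epsilon>1: "\<epsilon> = 1 \<or> \<epsilon> = -1" using orient by (simp add: square_eq_1_iff)
  have eq: "U (F (\<xi> x)) + 0 = circle_times_curve \<rho> \<Gamma> (\<Theta> x)" if x: "x \<in> ?R" for x
  proof -
    obtain s \<theta> where st: "x = (s, \<theta>)" "s \<in> I" using x by blast
    have "F (\<xi> x) = c s + (\<rho> * cos \<theta>) *\<^sub>R e1 s0 - (\<epsilon> * \<rho> * sin \<theta>) *\<^sub>R J (e1 s0)"
      using param'[OF x] by (simp add: X0_def trig_vec_def st(1) B_def C_def \<rho>(2)[OF st(2)] frame_complex(1)[OF st(2)] e1[OF st(2)] mult.commute mult.left_commute)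
    then have "U (F (\<xi> x)) = (0, \<Gamma> s) + (\<rho> * cos \<theta>) *\<^sub>R (1, 0) - (\<epsilon> * \<rho> * sin \<theta>) *\<^sub>R J (1, 0)"
      by (simp add: U_simps U_J U_basis Uc[OF st(2)])
    also have "\<dots> = circle_times_curve \<rho> \<Gamma> (\<Theta> x)"
      using \<epsilon>1 by (auto simp: circle_times_curve_def \<Theta>_def st(1) J_def complex_eq_iff Re_exp Im_exp)
    finally show ?thesis by simp
  qed
  have c\<Theta>: "continuous_on ?R \<Theta>" unfolding \<Theta>_def by (intro continuous_intros)
  have R: "open ?R" "open ?D" by (simp_all add: open_Times)
  have x0: "(s0, 0) \<in> ?R" using s0 \<delta> by auto
  have \<Theta>D: "\<Theta> ` ?R \<subseteq> ?D" by (auto simp: \<Theta>_def)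
  have imm: "inj (frechet_derivative (circle_times_curve \<rho> \<Gamma>) (at (\<Theta> x)))" if x: "x \<in> ?R" for x
  proof -
    have "fst x \<in> I" using x by auto
    then show ?thesis unfolding \<Theta>_def by (intro circle_times_curve_smooth_immersion(2)[OF sm\<Gamma> \<rho>(1)] nz)
  qed
  have "locally_congruent_at M F (\<xi> (s0, 0)) ?D (circle_times_curve \<rho> \<Gamma>)"
    by (rule locally_congruent_by_chart_change[OF chart R(1) x0 subset_refl c\<Theta> \<Theta>D R(2)
          circle_times_curve_smooth_immersion(1)[OF sm\<Gamma> \<rho>(1)] imm congruence_U eq])
  then show ?thesis using shrink \<rho>(1) by blast
qed

text \<open>The meridian equation says that \<open>e1''\<close> has no component along \<open>J e1'\<close>, so that \<open>e1\<close> describes a great circle in the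
  real plane of \<open>e1\<close> and \<open>u = e1' / norm e1'\<close> at \<open>s0\<close>. The surface is \<open>\<rho> exp(- i \<epsilon> \<theta>) (cos \<sigma>, sin \<sigma>)\<close>, a surface of
  type I in which the old angle \<open>\<theta>\<close> parametrizes the generating curve and the arc length \<open>\<sigma>\<close> is the new angle.\<close>

lemma type_I_if_line_moves:
  assumes s0: "s0 \<in> I" and p: "\<And>s. s \<in> I \<Longrightarrow> vd e1 s \<noteq> 0"
  shows "type_I_at s0"
proof -
  have c: "c s = 0" if "s \<in> I" for s using centre_zero_if_line_moves[OF that p[OF that]] .
  have c1: "vd c s = 0" if s: "s \<in> I" for s by (rule vd_zero[OF I s subset_refl c sm(1)])
  have c2: "vd (vd c) s = 0" if s: "s \<in> I" for s
    by (rule vd_zero[OF I s subset_refl c1 smooth_on_vector_derivative[OF I sm(1)]])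
  define \<rho> where "\<rho> = r s0"
  have \<rho>: "\<rho> > 0" "\<And>s. s \<in> I \<Longrightarrow> r s = \<rho>" unfolding \<rho>_def using rpos[OF s0] r_constant[OF _ s0] by blast+
  have l2: "lam * \<rho>\<^sup>2 = 2" using moving_line_radius[OF s0 p[OF s0]] by (simp add: \<rho>_def)
  have smp: "smooth_on I (vd e1)" by (rule smooth_on_vector_derivative[OF I sm(3)])
  have geodesic: "vd (vd e1) s \<bullet> J (vd e1 s) = 0" if s: "s \<in> I" for s
  proof -
    have B1: "vd B t = r t *\<^sub>R vd e1 t" if "t \<in> I" for t using vdBC(1)[OF that] cl(1)[OF that] by simp
    have "((\<lambda>t. r t *\<^sub>R vd e1 t) has_vector_derivative r s *\<^sub>R vd (vd e1) s) (at s)"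
      using scaleR_derivative[OF hd[OF sm(2) s] hd[OF smp s]] cl(1)[OF s] by simp
    then have "(vd B has_vector_derivative r s *\<^sub>R vd (vd e1) s) (at s)"
      by (rule has_vector_derivative_transform_within_open[OF _ I s]) (simp add: B1)
    then have B2: "vd (vd B) s = r s *\<^sub>R vd (vd e1) s" by (rule vector_derivative_at)
    have perp: "vd e1 s \<bullet> C s = 0" "B s \<bullet> J (vd e1 s) = 0"
      using par[OF s] cl(4)[OF s] inner_J_left[of "e1 s" "vd e1 s"] inner_commute[of "J (e1 s)" "vd e1 s"]
      by (simp_all add: B_def C_def)
    have "(r s)\<^sup>2 * (r s * r s * (vd (vd e1) s \<bullet> J (vd e1 s))) = 0"
      using soliton_meridian(1)[OF s] unfolding B1[OF s] B2 c1[OF s] c2[OF s] c[OF s] by (simp add: perp)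
    then show ?thesis using rpos[OF s] by simp
  qed
  define \<nu> where "\<nu> s = norm (vd e1 s)" for s
  define u where "u s = (1 / \<nu> s) *\<^sub>R vd e1 s" for s
  have \<nu>: "\<nu> s > 0" if "s \<in> I" for s using p[OF that] by (simp add: \<nu>_def)
  have sm\<nu>: "smooth_on I \<nu>" unfolding \<nu>_def by (rule smooth_on_norm[OF I smp p])
  have smi: "smooth_on I (\<lambda>s. 1 / \<nu> s)" using \<nu> by (intro smooth_on_divide[OF I] smooth_on_const sm\<nu>) force
  have smu: "smooth_on I u" unfolding u_def by (rule smooth_on_scaleR[OF I smi smp])
  have pu: "vd e1 s = \<nu> s *\<^sub>R u s" if "s \<in> I" for s using \<nu>[OF that] by (simp add: u_def)
  have ue: "u s \<bullet> e1 s = 0" "u s \<bullet> J (e1 s) = 0" "u s \<bullet> u s = 1" if s: "s \<in> I" for s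
    using vd_frame(1)[OF s] cl(4)[OF s] \<nu>[OF s] by (simp_all add: u_def \<nu>_def dot_square_norm power2_eq_square)
  have u': "vd u s = - \<nu> s *\<^sub>R e1 s" if s: "s \<in> I" for s
  proof -
    note h = hd[OF smu s] hd[OF sm(3) s]
    have "u s \<bullet> vd e1 s + vd u s \<bullet> e1 s = 0"
      by (rule derivative_zero_if_constant[OF I s ue(1) inner_derivative[OF h]])
    then have 1: "vd u s \<bullet> e1 s = - \<nu> s" using ue(3)[OF s] by (simp add: pu[OF s])
    have "u s \<bullet> J (vd e1 s) + vd u s \<bullet> J (e1 s) = 0"
      by (rule derivative_zero_if_constant[OF I s ue(2) inner_derivative[OF h(1) J_derivative[OF h(2)]]])
    then have 2: "vd u s \<bullet> J (e1 s) = 0" by (simp add: pu[OF s])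
    have "u s \<bullet> vd u s + vd u s \<bullet> u s = 0"
      by (rule derivative_zero_if_constant[OF I s ue(3) inner_derivative[OF h(1) h(1)]])
    then have 3: "vd u s \<bullet> u s = 0" by (simp add: inner_commute)
    have "vd u s = (1 / \<nu> s) *\<^sub>R vd (vd e1) s + vd (\<lambda>s. 1 / \<nu> s) s *\<^sub>R vd e1 s"
      unfolding u_def using scaleR_derivative[OF hd[OF smi s] hd[OF smp s]] by (rule vector_derivative_at)
    then have 4: "vd u s \<bullet> J (u s) = 0" using geodesic[OF s] by (simp add: u_def inner_add_left)
    show ?thesis
      by (subst moving_line_frame[OF s p[OF s], of "vd u s", folded \<nu>_def, folded u_def]) (simp add: 1 2 3 4)
  qed
  obtain \<sigma> where \<sigma>: "smooth_on I \<sigma>" "\<sigma> s0 = 0" "\<And>s. s \<in> I \<Longrightarrow> (\<sigma> has_vector_derivative \<nu> s) (at s)"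
    using smooth_primitive_ex[OF sm\<nu> s0] by blast
  have circle: "e1 s = cos (\<sigma> s) *\<^sub>R e1 s0 + sin (\<sigma> s) *\<^sub>R u s0" if s: "s \<in> I" for s
  proof (rule rotating_pair[where e = e1 and f = u, OF _ _ \<sigma>(3,2) s s0])
    show "(e1 has_vector_derivative \<nu> s *\<^sub>R u s) (at s)" if "s \<in> I" for s using hd[OF sm(3) that] pu[OF that] by simp
    show "(u has_vector_derivative - \<nu> s *\<^sub>R e1 s) (at s)" if "s \<in> I" for s using hd[OF smu that] u'[OF that] by simp
  qed
  interpret unitary_basis "e1 s0" "u s0"
    by unfold_locales (use on(1)[OF s0] ue[OF s0] inner_J_left[of "e1 s0" "u s0"] inner_commute[of "J (e1 s0)" "u s0"]
        in \<open>simp_all add: inner_commute\<close>)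
  let ?K = "{-\<delta><..<\<delta>}" and ?r = "\<lambda>s::real. \<rho>" and ?\<phi> = "\<lambda>s::real. s"
  let ?\<gamma> = "polar_curve ?r ?\<phi>"
  have \<gamma>: "?\<gamma> s = complex_of_real \<rho> * cis s" for s by (simp add: polar_curve_def cis_conv_exp)
  have sm\<phi>: "smooth_on ?K ?\<phi>" by (rule smooth_on_bounded_linear) (auto simp: bounded_linear_ident)
  have sm\<gamma>: "smooth_on ?K ?\<gamma>" by (intro smooth_polar_curve smooth_on_const sm\<phi>) auto
  have d\<gamma>: "(?\<gamma> has_vector_derivative \<i> * ?\<gamma> s) (at s)" for s
    unfolding polar_curve_def by (auto intro!: derivative_eq_intros has_vector_derivative_real_field simp: mult_ac)
  then have vd\<gamma>: "vd ?\<gamma> s = \<i> * ?\<gamma> s" for s by (rule vector_derivative_at)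
  have "((\<lambda>s. \<i> * ?\<gamma> s) has_vector_derivative \<i> * (\<i> * ?\<gamma> s)) (at s)" for s
    using d\<gamma>[of s] by (rule has_vector_derivative_mult_right)
  then have vd2\<gamma>: "vd (vd ?\<gamma>) s = - ?\<gamma> s" for s unfolding vd\<gamma> using vector_derivative_at by fastforce
  have \<gamma>nz: "?\<gamma> s \<noteq> 0" "norm (?\<gamma> s) = \<rho>" "?\<gamma> s \<bullet> ?\<gamma> s = \<rho>\<^sup>2" for s
    using \<rho>(1) by (simp_all add: \<gamma> norm_mult dot_square_norm)
  have equi: "equivariant_self_similar lam ?K ?r ?\<phi>"
    unfolding equivariant_self_similar_def Let_def regular_curve_def
  proof (intro conjI ballI)
    fix s assume "s \<in> ?K"
    show nz: "vd ?\<gamma> s \<noteq> 0" by (simp add: vd\<gamma> \<gamma>nz(1))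
    have i: "vd (vd ?\<gamma>) s \<bullet> (\<i> * vd ?\<gamma> s) = \<rho>\<^sup>2" "vd ?\<gamma> s \<bullet> vd ?\<gamma> s = \<rho>\<^sup>2" "?\<gamma> s \<bullet> (\<i> * vd ?\<gamma> s) = - \<rho>\<^sup>2"
      unfolding vd2\<gamma> unfolding vd\<gamma> using \<gamma>nz(3)[of s]
      by (simp_all add: inner_complex_def algebra_simps)
    have "(1 / \<rho>\<^sup>2 - lam) * \<rho>\<^sup>2 = - 1" using l2 \<rho>(1) by (simp add: left_diff_distrib)
    then have "vd (vd ?\<gamma>) s \<bullet> (\<i> * vd ?\<gamma> s) = (1 / \<rho>\<^sup>2 - lam) * (vd ?\<gamma> s \<bullet> vd ?\<gamma> s) * (?\<gamma> s \<bullet> (\<i> * vd ?\<gamma> s))"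
      unfolding i by simp
    then show "curvature ?\<gamma> s = (?\<gamma> s \<bullet> unit_normal ?\<gamma> s) * (1 / (norm (?\<gamma> s))\<^sup>2 - lam)"
      using curvature_equation_iff[OF nz, of "1 / \<rho>\<^sup>2 - lam"] by (simp add: \<gamma>nz(2) mult.commute)
  qed (use \<rho>(1) sm\<phi> smooth_on_const sm\<gamma> in \<open>auto simp: is_interval_oo\<close>)
  let ?R = "I \<times> {-\<delta><..<\<delta>}" and ?D = "?K \<times> (UNIV :: real set)"
  define \<Theta> where "\<Theta> x = (- \<epsilon> * snd x, \<sigma> (fst x))" for x :: "real \<times> real"
  have \<epsilon>1: "\<epsilon> = 1 \<or> \<epsilon> = -1" using orient by (simp add: square_eq_1_iff)
  have eq: "U (F (\<xi> x)) + 0 = centered_type_I ?r ?\<phi> (\<Theta> x)" if x: "x \<in> ?R" for x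
  proof -
    obtain s \<theta> where st: "x = (s, \<theta>)" "s \<in> I" using x by blast
    have Ue: "U (e1 s) = (complex_of_real (cos (\<sigma> s)), complex_of_real (sin (\<sigma> s)))"
      by (subst circle[OF st(2)]) (simp add: U_simps U_basis complex_eq_iff)
    have "F (\<xi> x) = (\<rho> * cos \<theta>) *\<^sub>R e1 s - (\<epsilon> * \<rho> * sin \<theta>) *\<^sub>R J (e1 s)"
      using param'[OF x] by (simp add: X0_def trig_vec_def st(1) B_def C_def c[OF st(2)] \<rho>(2)[OF st(2)] frame_complex(1)[OF st(2)] mult.commute mult.left_commute)
    then have "U (F (\<xi> x)) = (\<rho> * cos \<theta>) *\<^sub>R U (e1 s) - (\<epsilon> * \<rho> * sin \<theta>) *\<^sub>R J (U (e1 s))"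
      by (simp add: U_simps U_J)
    also have "\<dots> = centered_type_I ?r ?\<phi> (\<Theta> x)"
      unfolding Ue using \<epsilon>1 by (auto simp: centered_type_I_def \<Theta>_def st(1) J_def \<gamma> complex_eq_iff)
    finally show ?thesis by simp
  qed
  have c\<sigma>: "continuous_on ?R (\<lambda>x. \<sigma> (fst x))"
    by (rule continuous_on_compose2[OF smooth_on_continuous[OF \<sigma>(1)]]) (auto intro: continuous_intros)
  have c\<Theta>: "continuous_on ?R \<Theta>" unfolding \<Theta>_def by (intro continuous_intros c\<sigma>)
  have R: "open ?R" "open ?D" by (simp_all add: open_Times)
  have x0: "(s0, 0) \<in> ?R" using s0 \<delta> by auto
  have \<Theta>D: "\<Theta> ` ?R \<subseteq> ?D" using \<epsilon>1 by (auto simp: \<Theta>_def)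
  have imm: "inj (frechet_derivative (centered_type_I ?r ?\<phi>) (at (\<Theta> x)))" if x: "x \<in> ?R" for x
  proof -
    have "\<Theta> x \<in> ?D" using \<Theta>D x by blast
    then have "- \<epsilon> * snd x \<in> ?K" by (simp add: \<Theta>_def)
    then show ?thesis unfolding \<Theta>_def
      by (intro centered_type_I_smooth_immersion(2)[OF sm\<gamma>]) (simp_all add: vd\<gamma> \<gamma>nz(1))
  qed
  have "locally_congruent_at M F (\<xi> (s0, 0)) ?D (centered_type_I ?r ?\<phi>)"
    by (rule locally_congruent_by_chart_change[OF chart R(1) x0 subset_refl c\<Theta> \<Theta>D R(2)
          centered_type_I_smooth_immersion(1)[OF sm\<gamma>] imm congruence_U eq])
  then show ?thesis using equi by blast
qed

text \<open>A fixed and a moving line require different values of \<open>\<lambda> r\<^sup>2\<close>, while \<open>r\<close> is constant.\<close>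

lemma line_fixed_or_moving:
  "(\<forall>s\<in>I. vd e1 s = 0) \<or> (\<forall>s\<in>I. vd e1 s \<noteq> 0)"
proof (rule ccontr)
  assume "\<not> ?thesis"
  then obtain s t where st: "s \<in> I" "t \<in> I" "vd e1 s \<noteq> 0" "vd e1 t = 0" by blast
  have "lam * (r s)\<^sup>2 = 2" by (rule moving_line_radius[OF st(1,3)])
  moreover have "lam * (r t)\<^sup>2 = 1" using cl(7)[OF st(2,4)] by blast
  ultimately show False using r_constant[OF st(1,2)] by simp
qed

end

section \<open>The classification\<close>

lemma local_classification:
  assumes s0: "s0 \<in> I"
  shows "type_I_at s0 \<or>
    (\<exists>K \<rho> \<Gamma>. \<rho> > 0 \<and> self_shrinking_curve K \<Gamma> \<and> locally_congruent_at M F (\<xi> (s0, 0)) (K \<times> UNIV) (circle_times_curve \<rho> \<Gamma>))"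
proof -
  obtain \<epsilon> where \<epsilon>: "\<epsilon> \<in> {-1, 0, 1}" "\<And>s. s \<in> I \<Longrightarrow> w s = \<epsilon>" using w_constant by blast
  show ?thesis
  proof (cases "\<epsilon> = 0")
    case True
    then show ?thesis using type_I_if_lagrangian_planes[OF _ s0] \<epsilon>(2) by simp
  next
    case False
    then have \<epsilon>1: "\<epsilon> * \<epsilon> = 1" using \<epsilon>(1) by auto
    show ?thesis
      using line_fixed_or_moving[OF \<epsilon>(2) \<epsilon>1] product_if_line_fixed[OF \<epsilon>(2) \<epsilon>1 s0] type_I_if_line_moves[OF \<epsilon>(2) \<epsilon>1 s0]
      by blast
  qed
qed

end

theorem theorem3:
  fixes M :: "'m::{t2_space,second_countable_topology} set"
    and F :: "'m \<Rightarrow> complex \<times> complex"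
    and lam :: real
  assumes "immersed_surface M F"
    and "lagrangian M F"
    and "cyclic M F"
    and "lam \<noteq> 0"
    and "self_similar lam M F"
  shows "\<forall>p\<in>M.
           (\<exists>I r \<phi>. equivariant_self_similar lam I r \<phi> \<and>
              locally_congruent_at M F p (I \<times> UNIV) (centered_type_I r \<phi>)) \<or>
           (\<exists>I \<rho> \<Gamma>. \<rho> > 0 \<and> self_shrinking_curve I \<Gamma> \<and>
              locally_congruent_at M F p (I \<times> UNIV) (circle_times_curve \<rho> \<Gamma>))"
proof
  fix p assume p: "p \<in> M"
  obtain \<L> where L: "\<forall>L\<in>\<L>. \<exists>C. round_circle C \<and> bij_betw F L C"
    "\<forall>p\<in>M. \<exists>a b c d \<psi>. local_param M F ({a<..<b} \<times> {c<..<d}) \<psi> \<and> p \<in> \<psi> ` ({a<..<b} \<times> {c<..<d}) \<and>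
           (\<forall>s\<in>{a<..<b}. \<exists>L\<in>\<L>. \<psi> ` ({s} \<times> {c<..<d}) \<subseteq> L)"
    using assms(3) unfolding cyclic_def by blast
  obtain a b k d \<psi> where \<psi>: "local_param M F ({a<..<b} \<times> {k<..<d}) \<psi>" "p \<in> \<psi> ` ({a<..<b} \<times> {k<..<d})"
    "\<forall>s\<in>{a<..<b}. \<exists>L\<in>\<L>. \<psi> ` ({s} \<times> {k<..<d}) \<subseteq> L"
    using L(2) p by blast
  obtain s0 t0 where st: "s0 \<in> {a<..<b}" "t0 \<in> {k<..<d}" "p = \<psi> (s0, t0)" using \<psi>(2) by blast
  have circ: "\<exists>C. round_circle C \<and> (\<forall>t\<in>{k<..<d}. F (\<psi> (s, t)) \<in> C)" if s: "s \<in> {a<..<b}" for s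
  proof -
    obtain L' C where LC: "\<psi> ` ({s} \<times> {k<..<d}) \<subseteq> L'" "round_circle C" "bij_betw F L' C" using \<psi>(3) L(1) s by meson
    have "F (\<psi> (s, t)) \<in> C" if "t \<in> {k<..<d}" for t
    proof -
      have "\<psi> (s, t) \<in> L'" using LC(1) that by blast
      then show ?thesis using LC(3) unfolding bij_betw_def by blast
    qed
    then show ?thesis using LC(2) by blast
  qed
  obtain c r e1 e2 \<xi> \<delta> where fam: "\<delta> > 0" "{s0-\<delta><..<s0+\<delta>} \<subseteq> {a<..<b}"
    "smooth_on {a<..<b} c" "smooth_on {a<..<b} r" "smooth_on {a<..<b} e1" "smooth_on {a<..<b} e2"
    "\<And>s. s \<in> {a<..<b} \<Longrightarrow> r s > 0"
    "\<And>s. s \<in> {a<..<b} \<Longrightarrow> e1 s \<bullet> e1 s = 1" "\<And>s. s \<in> {a<..<b} \<Longrightarrow> e2 s \<bullet> e2 s = 1"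
    "\<And>s. s \<in> {a<..<b} \<Longrightarrow> e1 s \<bullet> e2 s = 0"
    "\<And>s. s \<in> {a<..<b} \<Longrightarrow> vector_derivative e1 (at s) \<bullet> e2 s = 0"
    "local_param M F ({s0-\<delta><..<s0+\<delta>} \<times> {-\<delta><..<\<delta>}) \<xi>" "\<xi> (s0, 0) = \<psi> (s0, t0)"
    "\<And>x. x \<in> {s0-\<delta><..<s0+\<delta>} \<times> {-\<delta><..<\<delta>} \<Longrightarrow> F (\<xi> x) = circle_family c r e1 e2 x"
    by (rule circle_family_chart_ex[OF \<psi>(1) st(1,2) circ]) (assumption, rule that)
  note K = subsetD[OF fam(2)]
  interpret cyclic_soliton M F \<xi> "s0 - \<delta>" "s0 + \<delta>" \<delta> lam c e1 e2 r
    by unfold_locales (fact fam(1) fam(12) fam(14) assms(2) assms(5) assms(4) smooth_on_subset[OF fam(3) fam(2)]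
      smooth_on_subset[OF fam(4) fam(2)] smooth_on_subset[OF fam(5) fam(2)] smooth_on_subset[OF fam(6) fam(2)]
      fam(7)[OF K] fam(8)[OF K] fam(9)[OF K] fam(10)[OF K] fam(11)[OF K])+
  have "s0 \<in> {s0-\<delta><..<s0+\<delta>}" using fam(1) by simp
  from local_classification[OF this]
  show "(\<exists>I r \<phi>. equivariant_self_similar lam I r \<phi> \<and>
              locally_congruent_at M F p (I \<times> UNIV) (centered_type_I r \<phi>)) \<or>
           (\<exists>I \<rho> \<Gamma>. \<rho> > 0 \<and> self_shrinking_curve I \<Gamma> \<and>
              locally_congruent_at M F p (I \<times> UNIV) (circle_times_curve \<rho> \<Gamma>))"
    unfolding fam(13) st(3) .
qed

end
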